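(* Let $\mathcal{C}$ be a finite set of constraints. If $\mathcal{C}$ is Schaefer, then $\mathrm{ISO}_c(\mathcal{C})$ is polynomial-time many-one reducible to $\mathrm{VCGI}$.
   Context: A constraint of arity $k$ is a Boolean function $C:\{0,1\}^k\to\{0,1\}$; $C(x_1,\dots,x_k)$ where each $x_i$ is a variable or a constant $0$ or $1$ is a constraint application of $C$ with constants. A set of constraint applications is interpreted as the conjunction of its members; two sets are equivalent if they are satisfied by exactly the same assignments. A constraint is Horn if equivalent to a CNF with at most one positive literal per clause; anti-Horn if equivalent to a CNF with at most one negative literal per clause; bijunctive if equivalent to a 2CNF; affine if equivalent to a conjunction of XOR-clauses. $\mathcal{C}$ is Schaefer if all its constraints are Horn, or all anti-Horn, or all affine, or all bijunctive. For a permutation $\pi$ of a variable set $X$, $\pi(S)$ is obtained by simultaneously replacing each variable $x$ by $\pi(x)$. $\mathrm{ISO}_c(\mathcal{C})$: given two sets $S,U$ of constraint applications of $\mathcal{C}$ with constants over the same variable set $X$, decide whether some permutation $\pi$ of $X$ makes $\pi(S)$ equivalent to $U$. $\mathrm{VCGI}$ is the problem: given two vertex-colored graphs $G_i=(V_i,E_i,\chi_i)$, $i\in\{1,2\}$, with $\chi_i:V_i\to\mathbb{N}$, decide whether there is a bijection $\pi:V_1\to V_2$ with $\{v,w\}\in E_1$ iff $\{\pi(v),\pi(w)\}\in E_2$ and $\chi_1(v)=\chi_2(\pi(v))$ for all $v$. *)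

theory Defs
  imports "HOL-Computational_Algebra.Polynomial" "HOL-Combinatorics.Permutations"
begin

section \<open>Polynomial-time many-one reducibility\<close>

text \<open>
  Deterministic multi-tape Turing machines with two-way infinite tapes. States are the numbers
  below \<open>states\<close> and tape symbols the numbers below \<open>symbols\<close>: 0 is the blank, 1 and 2 are the
  two input bits. The transition function gets the current state and the scanned symbols (one
  per tape) and returns the next state and, for every tape, the symbol to write and the
  direction of the head.
\<close>

datatype move = Move_Left | Stay | Move_Right

record tm =
  tapes :: nat
  states :: nat
  symbols :: nat
  start :: nat
  final :: nat
  delta :: "nat \<Rightarrow> nat list \<Rightarrow> nat \<times> (nat \<times> move) list"

text \<open>Tape 0 is the input tape and tape 1 the output tape.\<close>

definition wf_tm :: "tm \<Rightarrow> bool" where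
  "wf_tm M \<longleftrightarrow> tapes M \<ge> 2 \<and> symbols M \<ge> 3 \<and> start M < states M \<and> final M < states M \<and>
     (\<forall>q rs. q < states M \<and> length rs = tapes M \<and> (\<forall>r\<in>set rs. r < symbols M) \<longrightarrow>
        fst (delta M q rs) < states M \<and>
        length (snd (delta M q rs)) = tapes M \<and>
        (\<forall>(s, m)\<in>set (snd (delta M q rs)). s < symbols M))"

text \<open>A tape is the head position together with the contents of the cells.\<close>

type_synonym tape = "int \<times> (int \<Rightarrow> nat)"
type_synonym config = "nat \<times> tape list"

fun move_offset :: "move \<Rightarrow> int" where
  "move_offset Move_Left = -1"
| "move_offset Stay = 0"
| "move_offset Move_Right = 1"

fun read_tape :: "tape \<Rightarrow> nat" where
  "read_tape (h, c) = c h"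

fun act_tape :: "nat \<times> move \<Rightarrow> tape \<Rightarrow> tape" where
  "act_tape (s, m) (h, c) = (h + move_offset m, c(h := s))"

fun tm_step :: "tm \<Rightarrow> config \<Rightarrow> config" where
  "tm_step M (q, ts) =
     (if q = final M then (q, ts)
      else let (q', acts) = delta M q (map read_tape ts) in (q', map2 act_tape acts ts))"

definition bit_symbol :: "bool \<Rightarrow> nat" where
  "bit_symbol b = (if b then 2 else 1)"

definition word_cells :: "bool list \<Rightarrow> int \<Rightarrow> nat" where
  "word_cells w i = (if 0 \<le> i \<and> nat i < length w then bit_symbol (w ! nat i) else 0)"

definition init_config :: "tm \<Rightarrow> bool list \<Rightarrow> config" where
  "init_config M w = (start M, (0, word_cells w) # replicate (tapes M - 1) (0, word_cells []))"

text \<open>Started on \<open>w\<close>, the machine halts after at most \<open>t\<close> steps, and the output tape then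
  contains \<open>v\<close> and is blank elsewhere.\<close>

definition computes_within :: "tm \<Rightarrow> bool list \<Rightarrow> bool list \<Rightarrow> nat \<Rightarrow> bool" where
  "computes_within M w v t \<longleftrightarrow>
     (let (q, ts) = (tm_step M ^^ t) (init_config M w)
      in q = final M \<and> snd (ts ! 1) = word_cells v)"

definition polytime_computable :: "(bool list \<Rightarrow> bool list) \<Rightarrow> bool" where
  "polytime_computable f \<longleftrightarrow>
     (\<exists>M (p :: nat poly). wf_tm M \<and> (\<forall>w. computes_within M w (f w) (poly p (length w))))"

definition poly_many_one_reducible :: "bool list set \<Rightarrow> bool list set \<Rightarrow> bool"
    (infix "\<le>\<^sub>p\<^sub>m" 50) where
  "A \<le>\<^sub>p\<^sub>m B \<longleftrightarrow> (\<exists>f. polytime_computable f \<and> (\<forall>w. w \<in> A \<longleftrightarrow> f w \<in> B))"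


section \<open>Constraints\<close>

text \<open>A constraint is an arity with a Boolean function on tuples of that length. Fixing the
  function to be false on lists of any other length makes HOL equality coincide with equality
  of Boolean functions.\<close>

typedef constraint = "{(k :: nat, C :: bool list \<Rightarrow> bool). \<forall>xs. length xs \<noteq> k \<longrightarrow> \<not> C xs}"
  by auto

definition arity :: "constraint \<Rightarrow> nat" where
  "arity C = fst (Rep_constraint C)"

definition holds :: "constraint \<Rightarrow> bool list \<Rightarrow> bool" where
  "holds C = snd (Rep_constraint C)"

datatype literal = is_pos: Pos (lit_index: nat) | is_neg: Neg (lit_index: nat)

type_synonym clause = "literal list"
type_synonym formula = "clause list"

fun lit_true :: "bool list \<Rightarrow> literal \<Rightarrow> bool" where
  "lit_true xs (Pos i) = xs ! i"
| "lit_true xs (Neg i) = (\<not> xs ! i)"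

definition formula_over :: "nat \<Rightarrow> formula \<Rightarrow> bool" where
  "formula_over k \<phi> \<longleftrightarrow> (\<forall>cl\<in>set \<phi>. \<forall>l\<in>set cl. lit_index l < k)"

definition cnf_true :: "bool list \<Rightarrow> formula \<Rightarrow> bool" where
  "cnf_true xs \<phi> \<longleftrightarrow> (\<forall>cl\<in>set \<phi>. \<exists>l\<in>set cl. lit_true xs l)"

text \<open>An XOR-clause \<open>l\<^sub>1 \<oplus> \<dots> \<oplus> l\<^sub>m\<close> is true iff an odd number of its literals is true.\<close>

definition xor_cnf_true :: "bool list \<Rightarrow> formula \<Rightarrow> bool" where
  "xor_cnf_true xs \<phi> \<longleftrightarrow> (\<forall>cl\<in>set \<phi>. odd (length (filter (lit_true xs) cl)))"

definition equiv_cnf :: "constraint \<Rightarrow> formula \<Rightarrow> bool" where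
  "equiv_cnf C \<phi> \<longleftrightarrow> formula_over (arity C) \<phi> \<and>
     (\<forall>xs. length xs = arity C \<longrightarrow> (holds C xs \<longleftrightarrow> cnf_true xs \<phi>))"

definition equiv_xor_cnf :: "constraint \<Rightarrow> formula \<Rightarrow> bool" where
  "equiv_xor_cnf C \<phi> \<longleftrightarrow> formula_over (arity C) \<phi> \<and>
     (\<forall>xs. length xs = arity C \<longrightarrow> (holds C xs \<longleftrightarrow> xor_cnf_true xs \<phi>))"

definition horn :: "constraint \<Rightarrow> bool" where
  "horn C \<longleftrightarrow> (\<exists>\<phi>. equiv_cnf C \<phi> \<and> (\<forall>cl\<in>set \<phi>. length (filter is_pos cl) \<le> 1))"

definition anti_horn :: "constraint \<Rightarrow> bool" where
  "anti_horn C \<longleftrightarrow> (\<exists>\<phi>. equiv_cnf C \<phi> \<and> (\<forall>cl\<in>set \<phi>. length (filter is_neg cl) \<le> 1))"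

definition bijunctive :: "constraint \<Rightarrow> bool" where
  "bijunctive C \<longleftrightarrow> (\<exists>\<phi>. equiv_cnf C \<phi> \<and> (\<forall>cl\<in>set \<phi>. length cl \<le> 2))"

definition affine_constraint :: "constraint \<Rightarrow> bool" where
  "affine_constraint C \<longleftrightarrow> (\<exists>\<phi>. equiv_xor_cnf C \<phi>)"

definition schaefer :: "constraint set \<Rightarrow> bool" where
  "schaefer \<C> \<longleftrightarrow> (\<forall>C\<in>\<C>. horn C) \<or> (\<forall>C\<in>\<C>. anti_horn C) \<or>
     (\<forall>C\<in>\<C>. affine_constraint C) \<or> (\<forall>C\<in>\<C>. bijunctive C)"


section \<open>Constraint isomorphism with constants\<close>

datatype 'v arg = Var 'v | Const bool

fun arg_val :: "('v \<Rightarrow> bool) \<Rightarrow> 'v arg \<Rightarrow> bool" where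
  "arg_val \<alpha> (Var x) = \<alpha> x"
| "arg_val \<alpha> (Const b) = b"

fun rename_arg :: "('v \<Rightarrow> 'v) \<Rightarrow> 'v arg \<Rightarrow> 'v arg" where
  "rename_arg \<pi> (Var x) = Var (\<pi> x)"
| "rename_arg \<pi> (Const b) = Const b"

type_synonym 'v application = "constraint \<times> 'v arg list"

definition application_over :: "constraint set \<Rightarrow> 'v set \<Rightarrow> 'v application \<Rightarrow> bool" where
  "application_over \<C> X = (\<lambda>(C, as). C \<in> \<C> \<and> length as = arity C \<and>
     (\<forall>x. Var x \<in> set as \<longrightarrow> x \<in> X))"

definition satisfies :: "('v \<Rightarrow> bool) \<Rightarrow> 'v application set \<Rightarrow> bool" where
  "satisfies \<alpha> S \<longleftrightarrow> (\<forall>(C, as)\<in>S. holds C (map (arg_val \<alpha>) as))"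

definition equivalent :: "'v application set \<Rightarrow> 'v application set \<Rightarrow> bool" where
  "equivalent S U \<longleftrightarrow> (\<forall>\<alpha>. satisfies \<alpha> S \<longleftrightarrow> satisfies \<alpha> U)"

definition rename :: "('v \<Rightarrow> 'v) \<Rightarrow> 'v application set \<Rightarrow> 'v application set" where
  "rename \<pi> S = (\<lambda>(C, as). (C, map (rename_arg \<pi>) as)) ` S"

definition iso_instance ::
    "constraint set \<Rightarrow> 'v set \<Rightarrow> 'v application set \<Rightarrow> 'v application set \<Rightarrow> bool" where
  "iso_instance \<C> X S U \<longleftrightarrow> finite X \<and> finite S \<and> finite U \<and>
     (\<forall>A\<in>S \<union> U. application_over \<C> X A)"

definition isomorphic :: "'v set \<Rightarrow> 'v application set \<Rightarrow> 'v application set \<Rightarrow> bool" where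
  "isomorphic X S U \<longleftrightarrow> (\<exists>\<pi>. \<pi> permutes X \<and> equivalent (rename \<pi> S) U)"


section \<open>Vertex-colored graph isomorphism\<close>

definition colored_graph :: "'v set \<Rightarrow> 'v set set \<Rightarrow> bool" where
  "colored_graph V E \<longleftrightarrow> finite V \<and> (\<forall>e\<in>E. \<exists>v\<in>V. \<exists>w\<in>V. v \<noteq> w \<and> e = {v, w})"

definition colored_graph_iso ::
    "'v set \<Rightarrow> 'v set set \<Rightarrow> ('v \<Rightarrow> nat) \<Rightarrow> 'w set \<Rightarrow> 'w set set \<Rightarrow> ('w \<Rightarrow> nat) \<Rightarrow> bool" where
  "colored_graph_iso V\<^sub>1 E\<^sub>1 \<chi>\<^sub>1 V\<^sub>2 E\<^sub>2 \<chi>\<^sub>2 \<longleftrightarrow>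
     (\<exists>\<pi>. bij_betw \<pi> V\<^sub>1 V\<^sub>2 \<and>
          (\<forall>v\<in>V\<^sub>1. \<forall>w\<in>V\<^sub>1. {v, w} \<in> E\<^sub>1 \<longleftrightarrow> {\<pi> v, \<pi> w} \<in> E\<^sub>2) \<and>
          (\<forall>v\<in>V\<^sub>1. \<chi>\<^sub>1 v = \<chi>\<^sub>2 (\<pi> v)))"


section \<open>The decision problems as sets of bit strings\<close>

text \<open>Instances are written over the four letters \<open>0\<close>, \<open>1\<close>, \<open>(\<close>, \<open>)\<close>, each of which is two
  bits long. Numbers are in binary, least significant bit first and without leading zeros.\<close>

definition enc_bit :: "bool \<Rightarrow> bool list" where
  "enc_bit b = [False, b]"

definition bracket :: "bool list \<Rightarrow> bool list" where
  "bracket w = [True, False] @ w @ [True, True]"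

definition enc_bits :: "bool list \<Rightarrow> bool list" where
  "enc_bits bs = bracket (concat (map enc_bit bs))"

fun binary :: "nat \<Rightarrow> bool list" where
  "binary n = (if n = 0 then [] else odd n # binary (n div 2))"

declare binary.simps [simp del]

definition enc_nat :: "nat \<Rightarrow> bool list" where
  "enc_nat n = enc_bits (binary n)"

definition enc_list :: "('a \<Rightarrow> bool list) \<Rightarrow> 'a list \<Rightarrow> bool list" where
  "enc_list enc xs = bracket (concat (map enc xs))"

text \<open>A constraint is written as its truth table, of length \<open>2 ^ arity C\<close>.\<close>

definition enc_constraint :: "constraint \<Rightarrow> bool list" where
  "enc_constraint C = enc_bits (map (holds C) (List.n_lists (arity C) [False, True]))"

fun enc_arg :: "nat arg \<Rightarrow> bool list" where
  "enc_arg (Var x) = enc_nat x"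
| "enc_arg (Const b) = enc_bit b"

definition enc_application :: "nat application \<Rightarrow> bool list" where
  "enc_application = (\<lambda>(C, as). bracket (enc_constraint C @ enc_list enc_arg as))"

definition enc_edge :: "nat \<times> nat \<Rightarrow> bool list" where
  "enc_edge = (\<lambda>(v, w). bracket (enc_nat v @ enc_nat w))"

text \<open>Finite sets are given by lists of their elements, in any order and possibly with
  repetitions. A string that does not encode an instance belongs to neither language.\<close>

definition ISO\<^sub>c :: "constraint set \<Rightarrow> bool list set" where
  "ISO\<^sub>c \<C> =
     {bracket (enc_list enc_nat xs @ enc_list enc_application ss @ enc_list enc_application us)
      | xs ss us. iso_instance \<C> (set xs) (set ss) (set us) \<and>
                  isomorphic (set xs) (set ss) (set us)}"

definition edge_set :: "(nat \<times> nat) list \<Rightarrow> nat set set" where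
  "edge_set es = (\<lambda>(v, w). {v, w}) ` set es"

definition enc_graph :: "nat list \<Rightarrow> (nat \<times> nat) list \<Rightarrow> (nat \<Rightarrow> nat) \<Rightarrow> bool list" where
  "enc_graph vs es \<chi> =
     bracket (enc_list (\<lambda>v. bracket (enc_nat v @ enc_nat (\<chi> v))) vs @ enc_list enc_edge es)"

definition VCGI :: "bool list set" where
  "VCGI =
     {bracket (enc_graph vs\<^sub>1 es\<^sub>1 \<chi>\<^sub>1 @ enc_graph vs\<^sub>2 es\<^sub>2 \<chi>\<^sub>2)
      | vs\<^sub>1 es\<^sub>1 \<chi>\<^sub>1 vs\<^sub>2 es\<^sub>2 \<chi>\<^sub>2.
        colored_graph (set vs\<^sub>1) (edge_set es\<^sub>1) \<and> colored_graph (set vs\<^sub>2) (edge_set es\<^sub>2) \<and>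
        colored_graph_iso (set vs\<^sub>1) (edge_set es\<^sub>1) \<chi>\<^sub>1 (set vs\<^sub>2) (edge_set es\<^sub>2) \<chi>\<^sub>2}"

end

theory Submission
  imports Defs
begin

text \<open>
  Let \<open>K\<close> bound the arities. A set \<open>S\<close> of constraint applications is determined by the lists of at
  most \<open>K\<close> literals that are consistent with it: an assignment whose restrictions to the variables of
  each application extend to satisfying assignments of \<open>S\<close> satisfies \<open>S\<close>. There are polynomially many
  such lists, and for Schaefer constraints each of them is tested in polynomial time, by unit
  propagation (followed, for 2CNF, by a look-ahead of one literal) or by Gaussian elimination.
  Joining a vertex for each consistent list to the vertices of its literals, and each literal to its
  opposite, with literal vertices colored by sign and list vertices by a third color, gives a graph
  whose isomorphisms induce exactly the permutations of the variables that map one family of lists to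
  the other.

  Polynomial running time is established for programs that replace a binary tree on top of a
  stack by another one. Such programs compose, and they can iterate over a list as long as the
  intermediate values stay polynomially bounded; the Turing machine runs them with one tape for
  each stack, its control states being the continuations of the program.
\<close>

section \<open>A stack language and its execution by Turing machines\<close>

text \<open>Equivalence is semantic, while a graph is built from syntax; so each set of applications
  has to be replaced by an invariant that depends on its satisfying assignments only. The Schaefer
  condition enters in computing this invariant: the literals of a list are added as unit clauses,
  and a single literal is at once Horn, anti-Horn, bijunctive and an XOR-clause, so the enlarged
  formula stays in the tractable class. The constants 0 and 1 are absorbed in the same way.

  Lists are used instead of sets of literals because all words over the literals are easily
  enumerated. The price is that several list vertices have the same neighbors, and an isomorphism
  may permute these freely; as consistency depends on the set of members only, no information is
  lost.

  Since \<C> is fixed and finite, its clause forms and the bound \<open>K\<close> are constants of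
  the program, and never have to be computed from the input.\<close>

datatype stack = Work | AuxA | AuxB | AuxC

text \<open>\<open>Pop\<close> has one branch for each of top bit true, top bit false, and empty stack; \<open>Loop\<close> iterates
  its body as long as it pops a true bit. \<open>Put\<close> is the second half of the machine's execution of
  \<open>Push\<close> and has no semantics of its own.\<close>

datatype cmd = Skip | Push stack bool | Put stack bool | Out bool | Seq cmd cmd
  | Pop stack cmd cmd cmd | Loop stack cmd

type_synonym store = "(stack \<Rightarrow> bool list) \<times> bool list"

inductive exec :: "cmd \<Rightarrow> store \<Rightarrow> nat \<Rightarrow> store \<Rightarrow> bool" where
  Skip: "exec Skip x 1 x"
| Push: "exec (Push s b) (\<sigma>, v) 2 (\<sigma>(s := b # \<sigma> s), v)"
| Out: "exec (Out b) (\<sigma>, v) 1 (\<sigma>, v @ [b])"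
| Seq: "exec c x t y \<Longrightarrow> exec d y u z \<Longrightarrow> exec (Seq c d) x (Suc (t + u)) z"
| PopT: "\<sigma> s = True # r \<Longrightarrow> exec c (\<sigma>(s := r), v) t y \<Longrightarrow> exec (Pop s c d e) (\<sigma>, v) (Suc t) y"
| PopF: "\<sigma> s = False # r \<Longrightarrow> exec d (\<sigma>(s := r), v) t y \<Longrightarrow> exec (Pop s c d e) (\<sigma>, v) (Suc t) y"
| PopE: "\<sigma> s = [] \<Longrightarrow> exec e (\<sigma>, v) t y \<Longrightarrow> exec (Pop s c d e) (\<sigma>, v) (Suc t) y"
| LoopT: "\<sigma> s = True # r \<Longrightarrow> exec c (\<sigma>(s := r), v) t y \<Longrightarrow> exec (Loop s c) y u z \<Longrightarrow>
    exec (Loop s c) (\<sigma>, v) (Suc (t + u)) z"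
| LoopF: "\<sigma> s = False # r \<Longrightarrow> exec (Loop s c) (\<sigma>, v) 1 (\<sigma>(s := r), v)"
| LoopE: "\<sigma> s = [] \<Longrightarrow> exec (Loop s c) (\<sigma>, v) 1 (\<sigma>, v)"

text \<open>One unit of time lengthens a stack by at most one bit. So a time bound for a program is
  also a size bound for its result, which is what makes time bounds compose.\<close>

lemma exec_length:
  "exec c x t y \<Longrightarrow> length (fst y s) \<le> length (fst x s) + t"
  by (induction rule: exec.induct) (fastforce split: if_splits)+

text \<open>Number 1 is skipped because tape 1 receives the output; \<open>Work\<close> is tape 0,
  where the input is written.\<close>

fun pos :: "stack \<Rightarrow> nat" where
  "pos Work = 0" | "pos AuxA = 2" | "pos AuxB = 3" | "pos AuxC = 4"

definition act_at :: "nat \<Rightarrow> nat \<times> move \<Rightarrow> nat list \<Rightarrow> (nat \<times> move) list" where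
  "act_at i a rs = (map (\<lambda>r. (r, Stay)) rs)[i := a]"

definition idle :: "nat list \<Rightarrow> (nat \<times> move) list" where
  "idle rs = map (\<lambda>r. (r, Stay)) rs"

text \<open>The control states of the machine are the continuations, i.e. the lists of commands that
  remain to be executed.\<close>

fun next_ctl :: "cmd list \<Rightarrow> nat list \<Rightarrow> cmd list \<times> (nat \<times> move) list" where
  "next_ctl [] rs = ([], idle rs)"
| "next_ctl (Skip # k) rs = (k, idle rs)"
| "next_ctl (Push s b # k) rs = (Put s b # k, act_at (pos s) (rs ! pos s, Move_Left) rs)"
| "next_ctl (Put s b # k) rs = (k, act_at (pos s) (bit_symbol b, Stay) rs)"
| "next_ctl (Out b # k) rs = (k, act_at 1 (bit_symbol b, Move_Right) rs)"
| "next_ctl (Seq c d # k) rs = (c # d # k, idle rs)"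
| "next_ctl (Pop s c d e # k) rs =
    (if rs ! pos s = 2 then (c # k, act_at (pos s) (0, Move_Right) rs)
     else if rs ! pos s = 1 then (d # k, act_at (pos s) (0, Move_Right) rs)
     else (e # k, idle rs))"
| "next_ctl (Loop s c # k) rs =
    (if rs ! pos s = 2 then (c # Loop s c # k, act_at (pos s) (0, Move_Right) rs)
     else if rs ! pos s = 1 then (k, act_at (pos s) (0, Move_Right) rs)
     else (k, idle rs))"

text \<open>The continuations that occur while \<open>c\<close> runs in front of \<open>k\<close>.
  The body of a loop runs in front of the loop itself, so an unbounded number of iterations passes
  through finitely many continuations.\<close>

fun ctls :: "cmd \<Rightarrow> cmd list \<Rightarrow> cmd list set" where
  "ctls (Seq c d) k = insert (Seq c d # k) (ctls c (d # k) \<union> ctls d k)"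
| "ctls (Pop s c d e) k = insert (Pop s c d e # k) (ctls c k \<union> ctls d k \<union> ctls e k)"
| "ctls (Loop s c) k = insert (Loop s c # k) (ctls c (Loop s c # k))"
| "ctls (Push s b) k = {Push s b # k, Put s b # k}"
| "ctls c k = {c # k}"

lemma ctls_self: "c # k \<in> ctls c k"
  by (cases c) auto

lemma finite_ctls: "finite (ctls c k)"
  by (induction c k rule: ctls.induct) auto

text \<open>The way out of \<open>ctls c k\<close> leads to \<open>k\<close>, once \<open>c\<close>
  is finished; for \<open>k = []\<close> the addition of the empty continuation therefore closes the
  set of states.\<close>

lemma ctls_closed: "q \<in> ctls c k \<Longrightarrow> fst (next_ctl q rs) \<in> insert k (ctls c k)"
proof (induction c arbitrary: k q)
  case (Seq c d)
  then show ?case using ctls_self[of d k] ctls_self[of c "d # k"] by fastforce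
next
  case (Pop s c d e)
  then show ?case using ctls_self[of c k] ctls_self[of d k] ctls_self[of e k] by (auto split: if_splits) blast+
next
  case (Loop s c)
  then show ?case using ctls_self[of c "Loop s c # k"] by (auto split: if_splits)
qed auto

definition ctl_step :: "cmd list \<times> tape list \<Rightarrow> cmd list \<times> tape list" where
  "ctl_step = (\<lambda>(k, ts). let (k', acts) = next_ctl k (map read_tape ts) in (k', map2 act_tape acts ts))"

text \<open>A stack occupies the cells from the head to the right, its top being under the head.\<close>

definition stack_tape :: "int \<Rightarrow> bool list \<Rightarrow> tape" where
  "stack_tape h w = (h, \<lambda>i. word_cells w (i - h))"

fun tapes_of :: "(stack \<Rightarrow> int) \<Rightarrow> store \<Rightarrow> tape list" where
  "tapes_of h (\<sigma>, v) =
    [stack_tape (h Work) (\<sigma> Work), (int (length v), word_cells v), stack_tape (h AuxA) (\<sigma> AuxA),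
     stack_tape (h AuxB) (\<sigma> AuxB), stack_tape (h AuxC) (\<sigma> AuxC)]"

lemma read_stack_tape [simp]:
  "read_tape (stack_tape h w) = (case w of [] \<Rightarrow> 0 | b # _ \<Rightarrow> bit_symbol b)"
  by (auto simp: stack_tape_def word_cells_def split: list.split)

lemma act_stay [simp]: "act_tape (read_tape p, Stay) p = p"
  by (cases p) auto

lemma word_cells_Cons: "word_cells (b # w) i = (if i = 0 then bit_symbol b else word_cells w (i - 1))"
  by (auto simp: word_cells_def nth_Cons' nat_diff_distrib')

text \<open>The popped cell is overwritten by a blank, so that the cells to the left of the head
  stay blank, as \<open>stack_tape\<close> demands.\<close>

lemma act_pop [simp]: "act_tape (0, Move_Right) (stack_tape h (b # w)) = stack_tape (h + 1) w"
  by (auto simp: stack_tape_def word_cells_Cons fun_eq_iff diff_diff_eq word_cells_def[of w "-1"])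

text \<open>A transition writes before it moves. Hence a push takes two steps: the old top is
  rewritten while the head moves left, then the new bit is written in place. The empty stack needs
  no special treatment, as its blank is rewritten likewise.\<close>

lemma act_push [simp]:
  "act_tape (bit_symbol b, Stay)
     (act_tape (case w of [] \<Rightarrow> 0 | b # _ \<Rightarrow> bit_symbol b, Move_Left) (stack_tape h w)) =
   stack_tape (h - 1) (b # w)"
  by (cases w) (auto simp: stack_tape_def word_cells_Cons fun_eq_iff diff_diff_eq2 word_cells_def[of "[]"])

lemma act_out [simp]:
  "act_tape (bit_symbol b, Move_Right) (int (length v), word_cells v) =
     (int (length v) + 1, word_cells (v @ [b]))"
  by (auto simp: word_cells_def fun_eq_iff nth_append)

lemma map2_idle: "map2 act_tape (idle (map read_tape ts)) ts = ts"
  by (induction ts) (auto simp: idle_def)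

lemma map2_act_at:
  "i < length ts \<Longrightarrow>
    map2 act_tape (act_at i a (map read_tape ts)) ts = ts[i := act_tape a (ts ! i)]"
  by (rule nth_equalityI) (auto simp: act_at_def nth_list_update)

lemma tapes_of_length [simp]: "length (tapes_of h x) = 5"
  by (cases x) auto

lemma pos_less [simp]: "pos s < 5"
  by (cases s) auto

lemma tapes_of_nth [simp]: "tapes_of h (\<sigma>, v) ! pos s = stack_tape (h s) (\<sigma> s)"
  by (cases s) auto

lemma tapes_of_update:
  "(tapes_of h (\<sigma>, v))[pos s := stack_tape j w] = tapes_of (h(s := j)) (\<sigma>(s := w), v)"
  by (cases s) auto

lemma bit_symbol_simps [simp]: "bit_symbol True = 2" "bit_symbol False = Suc 0"
  by (auto simp: bit_symbol_def)

lemma ctl_step_pop: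
  assumes "\<sigma> s = b # r"
  shows "map2 act_tape (act_at (pos s) (0, Move_Right) (map read_tape (tapes_of h (\<sigma>, v))))
    (tapes_of h (\<sigma>, v)) = tapes_of (h(s := h s + 1)) (\<sigma>(s := r), v)"
  using assms by (simp add: map2_act_at tapes_of_update del: tapes_of.simps)

text \<open>Pushes and pops make the heads of the stacks drift, so their final positions are only
  claimed to exist. The output tape is different: its contents are anchored at cell 0, as the
  definition of the computed word requires.\<close>

lemma exec_ctl_step:
  "exec c x t y \<Longrightarrow> \<exists>h'. (ctl_step ^^ t) (c # k, tapes_of h x) = (k, tapes_of h' y)"
proof (induction arbitrary: h k rule: exec.induct)
  case (Skip x)
  then show ?case by (auto simp: ctl_step_def map2_idle)
next
  case (Push s b \<sigma> v)
  have 1: "ctl_step (Push s b # k, tapes_of h (\<sigma>, v)) =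
      (Put s b # k, (tapes_of h (\<sigma>, v))[pos s := act_tape (case \<sigma> s of [] \<Rightarrow> 0 | b # _ \<Rightarrow> bit_symbol b, Move_Left)
        (stack_tape (h s) (\<sigma> s))])"
    by (simp add: ctl_step_def map2_act_at del: tapes_of.simps)
  have 2: "ctl_step (Put s b # k, (tapes_of h (\<sigma>, v))[pos s := p]) =
      (k, (tapes_of h (\<sigma>, v))[pos s := act_tape (bit_symbol b, Stay) p])" for p
    using map2_act_at[of "pos s" "(tapes_of h (\<sigma>, v))[pos s := p]" "(bit_symbol b, Stay)"]
    by (simp add: ctl_step_def del: tapes_of.simps)
  have "(ctl_step ^^ 2) (Push s b # k, tapes_of h (\<sigma>, v)) =
      (k, tapes_of (h(s := h s - 1)) (\<sigma>(s := b # \<sigma> s), v))"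
    by (simp add: numeral_2_eq_2 1 2 tapes_of_update del: tapes_of.simps act_tape.simps)
  then show ?case by blast
next
  case (Out b \<sigma> v)
  have "ctl_step (Out b # k, tapes_of h (\<sigma>, v)) = (k, tapes_of h (\<sigma>, v @ [b]))"
    using map2_act_at[of 1 "tapes_of h (\<sigma>, v)" "(bit_symbol b, Move_Right)"]
    by (simp add: ctl_step_def del: tapes_of.simps act_tape.simps) (simp del: act_tape.simps)
  then show ?case by (auto simp del: tapes_of.simps)
next
  case (Seq c x t y d u z)
  obtain h1 where 1: "(ctl_step ^^ t) (c # d # k, tapes_of h x) = (d # k, tapes_of h1 y)"
    using Seq.IH(1) by blast
  obtain h2 where 2: "(ctl_step ^^ u) (d # k, tapes_of h1 y) = (k, tapes_of h2 z)"
    using Seq.IH(2) by blast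
  have "ctl_step (Seq c d # k, tapes_of h x) = (c # d # k, tapes_of h x)"
    by (simp add: ctl_step_def map2_idle)
  then have "(ctl_step ^^ Suc (u + t)) (Seq c d # k, tapes_of h x) = (k, tapes_of h2 z)"
    by (simp only: funpow_Suc_right funpow_add o_apply 1 2)
  then show ?case by (metis add.commute)
next
  case (PopT \<sigma> s r c v t y d e)
  obtain h1 where 1: "(ctl_step ^^ t) (c # k, tapes_of (h(s := h s + 1)) (\<sigma>(s := r), v)) = (k, tapes_of h1 y)"
    using PopT.IH by blast
  have "ctl_step (Pop s c d e # k, tapes_of h (\<sigma>, v)) =
      (c # k, tapes_of (h(s := h s + 1)) (\<sigma>(s := r), v))"
    using ctl_step_pop[where \<sigma> = \<sigma> and s = s, OF PopT.hyps(1)] PopT.hyps(1)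
    by (simp add: ctl_step_def del: tapes_of.simps)
  then show ?case using 1 by (auto simp only: funpow_Suc_right o_apply)
next
  case (PopF \<sigma> s r d v t y c e)
  obtain h1 where 1: "(ctl_step ^^ t) (d # k, tapes_of (h(s := h s + 1)) (\<sigma>(s := r), v)) = (k, tapes_of h1 y)"
    using PopF.IH by blast
  have "ctl_step (Pop s c d e # k, tapes_of h (\<sigma>, v)) =
      (d # k, tapes_of (h(s := h s + 1)) (\<sigma>(s := r), v))"
    using ctl_step_pop[where \<sigma> = \<sigma> and s = s, OF PopF.hyps(1)] PopF.hyps(1)
    by (simp add: ctl_step_def del: tapes_of.simps)
  then show ?case using 1 by (auto simp only: funpow_Suc_right o_apply)
next
  case (PopE \<sigma> s e v t y c d)
  obtain h1 where 1: "(ctl_step ^^ t) (e # k, tapes_of h (\<sigma>, v)) = (k, tapes_of h1 y)"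
    using PopE.IH by blast
  have "ctl_step (Pop s c d e # k, tapes_of h (\<sigma>, v)) = (e # k, tapes_of h (\<sigma>, v))"
    using PopE.hyps(1) by (simp add: ctl_step_def map2_idle del: tapes_of.simps)
  then show ?case using 1 by (auto simp only: funpow_Suc_right o_apply)
next
  case (LoopT \<sigma> s r c v t y u z)
  obtain h1 where 1: "(ctl_step ^^ t) (c # Loop s c # k, tapes_of (h(s := h s + 1)) (\<sigma>(s := r), v)) =
      (Loop s c # k, tapes_of h1 y)"
    using LoopT.IH(1) by blast
  obtain h2 where 2: "(ctl_step ^^ u) (Loop s c # k, tapes_of h1 y) = (k, tapes_of h2 z)"
    using LoopT.IH(2) by blast
  have "ctl_step (Loop s c # k, tapes_of h (\<sigma>, v)) =
      (c # Loop s c # k, tapes_of (h(s := h s + 1)) (\<sigma>(s := r), v))"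
    using ctl_step_pop[where \<sigma> = \<sigma> and s = s, OF LoopT.hyps(1)] LoopT.hyps(1)
    by (simp add: ctl_step_def del: tapes_of.simps)
  then have "(ctl_step ^^ Suc (u + t)) (Loop s c # k, tapes_of h (\<sigma>, v)) = (k, tapes_of h2 z)"
    by (simp only: funpow_Suc_right funpow_add o_apply 1 2)
  then show ?case by (metis add.commute)
next
  case (LoopF \<sigma> s r c v)
  have "ctl_step (Loop s c # k, tapes_of h (\<sigma>, v)) = (k, tapes_of (h(s := h s + 1)) (\<sigma>(s := r), v))"
    using ctl_step_pop[where \<sigma> = \<sigma> and s = s, OF LoopF.hyps(1)] LoopF.hyps(1)
    by (simp add: ctl_step_def del: tapes_of.simps)
  then show ?case by (auto simp del: tapes_of.simps)
next
  case (LoopE \<sigma> s c v)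
  then have "ctl_step (Loop s c # k, tapes_of h (\<sigma>, v)) = (k, tapes_of h (\<sigma>, v))"
    by (simp add: ctl_step_def map2_idle del: tapes_of.simps)
  then show ?case by (auto simp del: tapes_of.simps)
qed

lemma next_ctl_acts:
  assumes "length rs = 5" "\<forall>r\<in>set rs. r < 3"
  shows "length (snd (next_ctl k rs)) = 5 \<and> (\<forall>(s, m)\<in>set (snd (next_ctl k rs)). s < 3)"
proof -
  define ok where "ok as \<longleftrightarrow> length as = 5 \<and> (\<forall>(s, m)\<in>set as. s < 3)" for as :: "(nat \<times> move) list"
  have idle: "ok (idle rs)"
    using assms by (auto simp: idle_def ok_def)
  have at: "ok (act_at i (r, m) rs)" if "r < 3" for i r m
    using assms that set_update_subset_insert[of "map (\<lambda>r. (r, Stay)) rs" i "(r, m)"]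
    by (auto simp: act_at_def ok_def)
  have bit: "bit_symbol b < 3" for b by (cases b) auto
  have nth: "rs ! pos s < 3" for s using assms by simp
  have "ok (snd (next_ctl k rs))"
    by (cases "(k, rs)" rule: next_ctl.cases) (simp_all add: idle at bit nth)
  then show ?thesis by (simp add: ok_def)
qed

definition clear_store :: "bool list \<Rightarrow> store" where
  "clear_store w = ((\<lambda>s. if s = Work then w else []), [])"

lemma exec_polytime:
  assumes "\<And>w. \<exists>t\<le>poly p (length w). \<exists>\<sigma>. exec c (clear_store w) t (\<sigma>, f w)"
  shows "polytime_computable f"
proof -
  define S where "S = insert [] (ctls c [])"
  have "finite S" by (simp add: S_def finite_ctls)
  then obtain code where code: "bij_betw code S {0..<card S}"
    using ex_bij_betw_finite_nat by blast
  define dec where "dec = inv_into S code"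
  have dec: "dec (code k) = k" if "k \<in> S" for k
    using code that by (simp add: dec_def bij_betw_def inv_into_f_f)
  have code_less: "code k < card S" if "k \<in> S" for k
    using bij_betwE[OF code] that by auto
  have dec_S: "dec q \<in> S" if "q < card S" for q
    using code that by (simp add: dec_def bij_betw_def inv_into_into)
  have S_next: "fst (next_ctl k rs) \<in> S" if "k \<in> S" for k rs
    using that ctls_closed[of k c "[]" rs] by (auto simp: S_def idle_def)
  define T where "T = \<lparr>tapes = 5, states = card S, symbols = 3, start = code [c], final = code [],
    delta = (\<lambda>q rs. let (k, acts) = next_ctl (dec q) rs in (code k, acts))\<rparr>"
  have "[c] \<in> S" "[] \<in> S" by (auto simp: S_def ctls_self)
  have "wf_tm T"
    unfolding wf_tm_def T_def
    using next_ctl_acts code_less dec_S S_next \<open>[c] \<in> S\<close> \<open>[] \<in> S\<close>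
    by (fastforce simp: Let_def case_prod_beta)
  have step: "tm_step T (code k, ts) = map_prod code id (ctl_step (k, ts)) \<and> fst (ctl_step (k, ts)) \<in> S"
    if "k \<in> S" for k ts
  proof (cases "k = []")
    case True
    then show ?thesis using that \<open>[] \<in> S\<close> by (simp add: T_def ctl_step_def map2_idle)
  next
    case False
    then have "code k \<noteq> code []"
      using that \<open>[] \<in> S\<close> code by (auto simp: bij_betw_def inj_on_def)
    then show ?thesis using that S_next
      by (simp add: T_def ctl_step_def dec case_prod_beta Let_def)
  qed
  have steps: "(tm_step T ^^ n) (code k, ts) = map_prod code id ((ctl_step ^^ n) (k, ts)) \<and>
      fst ((ctl_step ^^ n) (k, ts)) \<in> S" if "k \<in> S" for n k ts
    using that
  proof (induction n)
    case (Suc n)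
    obtain k' ts' where k': "(ctl_step ^^ n) (k, ts) = (k', ts')" by fastforce
    then show ?case using Suc step[of k' ts'] by (cases "ctl_step (k', ts')") (simp del: tm_step.simps)
  qed simp
  have halt: "(tm_step T ^^ n) (code [], ts) = (code [], ts)" for n ts
    by (induction n) (auto simp: T_def)
  have "computes_within T w (f w) (poly p (length w))" for w
  proof -
    obtain t \<sigma> where t: "t \<le> poly p (length w)" "exec c (clear_store w) t (\<sigma>, f w)"
      using assms by blast
    obtain h where h: "(ctl_step ^^ t) ([c], tapes_of (\<lambda>_. 0) (clear_store w)) = ([], tapes_of h (\<sigma>, f w))"
      using exec_ctl_step[OF t(2)] by blast
    have init: "init_config T w = (code [c], tapes_of (\<lambda>_. 0) (clear_store w))"
      by (simp add: init_config_def T_def clear_store_def stack_tape_def numeral_eq_Suc)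
    have "(tm_step T ^^ t) (init_config T w) = (code [], tapes_of h (\<sigma>, f w))"
      using steps[OF \<open>[c] \<in> S\<close>] h init by simp
    \<comment> \<open>The configuration is inspected after exactly \<open>poly p (length w)\<close>
      steps. The final state is stationary, so the remaining steps change nothing.\<close>
    moreover have "poly p (length w) = (poly p (length w) - t) + t" using t by simp
    ultimately have "(tm_step T ^^ poly p (length w)) (init_config T w) = (code [], tapes_of h (\<sigma>, f w))"
      using halt by (metis funpow_add o_apply)
    then show ?thesis by (simp add: computes_within_def T_def)
  qed
  then show ?thesis using \<open>wf_tm T\<close> polytime_computable_def by blast
qed

section \<open>Programs on binary trees\<close>

datatype tree = Lf | Nd tree tree

text \<open>Preorder words form a prefix code: trees lie on a stack one after the other without
  separators, and the end of the top tree is found by counting the subtrees still missing.\<close>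

fun code :: "tree \<Rightarrow> bool list" where
  "code Lf = [False]"
| "code (Nd x y) = True # code x @ code y"

definition sz :: "tree \<Rightarrow> nat" where
  "sz x = length (code x)"

lemma sz_simps [simp]: "sz Lf = 1" "sz (Nd x y) = Suc (sz x + sz y)"
  by (auto simp: sz_def)

lemma sz_pos: "0 < sz x"
  by (cases x) auto

section \<open>Time bounds for moving, copying and exchanging trees\<close>

definition run :: "cmd \<Rightarrow> store \<Rightarrow> nat \<Rightarrow> store \<Rightarrow> bool" where
  "run c x n y \<longleftrightarrow> (\<exists>t\<le>n. exec c x t y)"

fun st :: "bool list \<Rightarrow> bool list \<Rightarrow> bool list \<Rightarrow> bool list \<Rightarrow> stack \<Rightarrow> bool list" where
  "st w a b c Work = w" | "st w a b c AuxA = a" | "st w a b c AuxB = b" | "st w a b c AuxC = c"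

lemma st_upd [simp]:
  "(st w a b c)(Work := x) = st x a b c" "(st w a b c)(AuxA := x) = st w x b c"
  "(st w a b c)(AuxB := x) = st w a x c" "(st w a b c)(AuxC := x) = st w a b x"
  by (auto simp: fun_eq_iff split: if_splits elim: st.elims) (metis st.simps stack.exhaust)+

lemma run_mono: "run c x n y \<Longrightarrow> n \<le> m \<Longrightarrow> run c x m y"
  unfolding run_def by (meson order_trans)

lemma run_Skip: "1 \<le> n \<Longrightarrow> run Skip x n x"
  unfolding run_def using exec.Skip by blast

lemma run_Out: "1 \<le> n \<Longrightarrow> run (Out b) (\<sigma>, v) n (\<sigma>, v @ [b])"
  unfolding run_def using exec.Out by blast

lemma run_Push: "\<sigma>' = \<sigma>(s := b # \<sigma> s) \<Longrightarrow> 2 \<le> n \<Longrightarrow> run (Push s b) (\<sigma>, v) n (\<sigma>', v)"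
  unfolding run_def using exec.Push by blast

lemma run_Seq: "run c x n y \<Longrightarrow> run d y m z \<Longrightarrow> Suc (n + m) \<le> l \<Longrightarrow> run (Seq c d) x l z"
  unfolding run_def by (meson add_mono Suc_le_mono order_trans exec.Seq)

lemma run_PopT: "\<sigma> s = True # r \<Longrightarrow> run c (\<sigma>(s := r), v) n y \<Longrightarrow> Suc n \<le> l \<Longrightarrow> run (Pop s c d e) (\<sigma>, v) l y"
  unfolding run_def by (meson Suc_le_mono order_trans exec.PopT)

lemma run_PopF: "\<sigma> s = False # r \<Longrightarrow> run d (\<sigma>(s := r), v) n y \<Longrightarrow> Suc n \<le> l \<Longrightarrow> run (Pop s c d e) (\<sigma>, v) l y"
  unfolding run_def by (meson Suc_le_mono order_trans exec.PopF)

lemma run_PopE: "\<sigma> s = [] \<Longrightarrow> run e (\<sigma>, v) n y \<Longrightarrow> Suc n \<le> l \<Longrightarrow> run (Pop s c d e) (\<sigma>, v) l y"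
  unfolding run_def by (meson Suc_le_mono order_trans exec.PopE)

lemma run_LoopT:
  "\<sigma> s = True # r \<Longrightarrow> run c (\<sigma>(s := r), v) n y \<Longrightarrow> run (Loop s c) y m z \<Longrightarrow> Suc (n + m) \<le> l \<Longrightarrow>
    run (Loop s c) (\<sigma>, v) l z"
  unfolding run_def by (meson add_mono Suc_le_mono order_trans exec.LoopT)

lemma run_LoopF: "\<sigma> s = False # r \<Longrightarrow> \<sigma>' = \<sigma>(s := r) \<Longrightarrow> 1 \<le> l \<Longrightarrow> run (Loop s c) (\<sigma>, v) l (\<sigma>', v)"
  unfolding run_def using exec.LoopF by blast

text \<open>A word is stored on an auxiliary stack with each bit preceded by a true mark, above a false
  mark, so that its end can be recognized when it is moved back.\<close>

definition marked :: "bool list \<Rightarrow> bool list" where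
  "marked u = concat (map (\<lambda>b. [True, b]) (rev u))"

lemma marked_simps [simp]: "marked [] = []" "marked (u @ [b]) = True # b # marked u"
  "marked (u @ w) = marked w @ marked u" "marked (b # u) = marked u @ [True, b]"
  by (auto simp: marked_def)

definition push_bit :: "stack \<Rightarrow> bool \<Rightarrow> cmd" where
  "push_bit s b = Seq (Push s b) (Push s True)"

definition emit :: "bool \<Rightarrow> bool \<Rightarrow> bool \<Rightarrow> cmd" where
  "emit fa fc b = Seq (if fa then push_bit AuxA b else Skip) (if fc then push_bit AuxC b else Skip)"

definition onto :: "bool \<Rightarrow> bool list \<Rightarrow> bool list \<Rightarrow> bool list" where
  "onto f u a = (if f then marked u @ a else a)"

lemma run_emit:
  "11 \<le> n \<Longrightarrow> run (emit fa fc b) (st w a d c, v) n (st w (onto fa [b] a) d (onto fc [b] c), v)"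
  unfolding emit_def push_bit_def onto_def
  by (rule run_Seq[where n = 5 and m = 5 and y = "(st w (if fa then True # b # a else a) d c, v)"])
    (auto intro!: run_Seq[where n = 2 and m = 2] run_Push run_Skip)

text \<open>\<open>AuxB\<close> counts in unary the subtrees still to be read. The enclosing loop
  takes one off; a node bit puts two back and a leaf bit none, while the bit is copied to the stacks
  selected by the flags.\<close>

definition scan_body :: "bool \<Rightarrow> bool \<Rightarrow> cmd" where
  "scan_body fa fc = Pop Work
    (Seq (emit fa fc True) (Seq (Push AuxB True) (Push AuxB True))) (emit fa fc False) Skip"

text \<open>In continuation form: the behavior of the loop after \<open>x\<close> is a hypothesis.
  In the node case the two induction hypotheses can then be chained, although both subtrees are read
  by one and the same loop.\<close>

lemma run_scan_loop:
  "run (Loop AuxB (scan_body fa fc)) (st w (onto fa (code x) a) d (onto fc (code x) c), v) n z \<Longrightarrow>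
   run (Loop AuxB (scan_body fa fc)) (st (code x @ w) a (True # d) c, v) (n + 30 * sz x) z"
proof (induction x arbitrary: w a d c n)
  case Lf
  show ?case
    by (rule run_LoopT[where n = 12], simp, unfold scan_body_def, rule run_PopF[where n = 11],
        simp, simp, rule run_emit, simp, simp, rule Lf[unfolded scan_body_def, simplified], simp)
next
  case (Nd x y)
  let ?L = "Loop AuxB (scan_body fa fc)"
  have o: "onto f (code y) (onto f (code x) (onto f [True] a)) = onto f (code (Nd x y)) a" for f a
    by (simp add: onto_def)
  have "run ?L (st (code x @ code y @ w) (onto fa [True] a) (True # True # d) (onto fc [True] c), v)
      (n + 30 * sz y + 30 * sz x) z"
    by (rule Nd.IH(1), rule Nd.IH(2), unfold o, rule Nd.prems)
  moreover have "run (scan_body fa fc) (st (code (Nd x y) @ w) a d c, v) 20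
      (st (code x @ code y @ w) (onto fa [True] a) (True # True # d) (onto fc [True] c), v)"
    unfolding scan_body_def
    by (rule run_PopT[where n = 18 and r = "code x @ code y @ w"], simp,
        rule run_Seq[where n = 11 and m = 5], simp, rule run_emit, simp,
        rule run_Seq[where n = 2 and m = 2], rule run_Push, simp, simp, rule run_Push) simp_all
  ultimately show ?case
    by (intro run_LoopT[where n = 20 and m = "n + 30 * sz y + 30 * sz x"]) auto
qed

text \<open>The counter starts with one true bit, for the single tree to be read, above a false bit.
  The loop stops at the latter, so \<open>AuxB\<close> may hold anything underneath.\<close>

definition take_tree :: "bool \<Rightarrow> bool \<Rightarrow> cmd" where
  "take_tree fa fc = Seq (if fa then Push AuxA False else Skip) (Seq (if fc then Push AuxC False else Skip)
    (Seq (Push AuxB False) (Seq (Push AuxB True) (Loop AuxB (scan_body fa fc)))))"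

definition saved :: "bool \<Rightarrow> tree \<Rightarrow> bool list \<Rightarrow> bool list" where
  "saved f x a = (if f then marked (code x) @ False # a else a)"

lemma saved_False: "saved False x a = a"
  by (simp add: saved_def)

lemma run_take_tree:
  "run (take_tree fa fc) (st (code x @ w) a d c, v) (50 * sz x) (st w (saved fa x a) d (saved fc x c), v)"
proof -
  let ?a = "if fa then False # a else a" and ?c = "if fc then False # c else c"
  have loop: "run (Loop AuxB (scan_body fa fc)) (st (code x @ w) ?a (True # False # d) ?c, v) (1 + 30 * sz x)
      (st w (onto fa (code x) ?a) d (onto fc (code x) ?c), v)"
    by (rule run_scan_loop, rule run_LoopF) auto
  have o: "onto f (code x) (if f then False # a else a) = saved f x a" for f a
    by (simp add: onto_def saved_def)
  show ?thesis
    unfolding take_tree_def o[symmetric]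
    apply (rule run_Seq[where n = 2 and m = "13 + 30 * sz x" and y = "(st (code x @ w) ?a d c, v)"])
      apply (auto intro!: run_Push run_Skip)[1]
     apply (rule run_Seq[where n = 2 and m = "10 + 30 * sz x" and y = "(st (code x @ w) ?a d ?c, v)"])
       apply (auto intro!: run_Push run_Skip)[1]
      apply (rule run_Seq[where n = 2 and m = "6 + 30 * sz x"])
        apply (rule run_Push, rule refl, simp)
       apply (rule run_Seq[where n = 2 and m = "1 + 30 * sz x"])
         apply (rule run_Push, rule refl, simp)
        apply (simp only: st.simps st_upd)
        apply (rule loop)
    using sz_pos[of x] by linarith+
qed

definition restore :: "stack \<Rightarrow> cmd" where
  "restore s = Loop s (Pop s (Push Work True) (Push Work False) Skip)"

text \<open>The stored copy has the last bit of \<open>u\<close> on top, hence the induction from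
  the end; moving it back reverses it a second time and so rebuilds the original order.\<close>

lemma run_restore_aux:
  assumes "s = AuxA \<or> s = AuxC" "\<sigma> s = marked u @ False # r"
  shows "run (restore s) (\<sigma>, v) (1 + 5 * length u) (\<sigma>(s := r, Work := u @ \<sigma> Work), v)"
  using assms(2)
proof (induction u arbitrary: \<sigma> rule: rev_induct)
  case Nil
  then show ?case using assms(1) unfolding restore_def
    by (intro run_LoopF[where r = r]) auto
next
  case (snoc b u)
  let ?\<sigma> = "\<sigma>(s := marked u @ False # r, Work := b # \<sigma> Work)"
  have upd: "?\<sigma>(s := r, Work := u @ ?\<sigma> Work) = \<sigma>(s := r, Work := (u @ [b]) @ \<sigma> Work)"
    by auto
  have "run (restore s) (?\<sigma>, v) (1 + 5 * length u) (?\<sigma>(s := r, Work := u @ ?\<sigma> Work), v)"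
    by (rule snoc.IH) (use assms(1) in auto)
  then have "run (restore s) (?\<sigma>, v) (1 + 5 * length u) (\<sigma>(s := r, Work := (u @ [b]) @ \<sigma> Work), v)"
    unfolding upd .
  note loop = this
  have "run (Pop s (Push Work True) (Push Work False) Skip) (\<sigma>(s := b # marked u @ False # r), v) 3 (?\<sigma>, v)"
  proof (cases b)
    case True
    then show ?thesis
      using assms(1) by (intro run_PopT[where n = 2 and r = "marked u @ False # r"] run_Push) auto
  next
    case False
    then show ?thesis
      using assms(1) by (intro run_PopF[where n = 2 and r = "marked u @ False # r"] run_Push) auto
  qed
  note body = this
  show ?case
    unfolding restore_def
    by (rule run_LoopT[OF _ body loop[unfolded restore_def]]) (use snoc.prems in simp_all)
qed

lemma run_restore:
  "run (restore AuxA) (st w (saved True x a) d c, v) (6 * sz x) (st (code x @ w) a d c, v)"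
  "run (restore AuxC) (st w a d (saved True x c), v) (6 * sz x) (st (code x @ w) a d c, v)"
  using run_mono[OF run_restore_aux[of AuxA "st w (saved True x a) d c" "code x" a v], of "6 * sz x"]
    run_mono[OF run_restore_aux[of AuxC "st w a d (saved True x c)" "code x" c v], of "6 * sz x"]
    sz_pos[of x]
  by (simp_all add: saved_def sz_def Suc_leI)

definition drop_tree where "drop_tree = take_tree False False"

definition dup where "dup = Seq (take_tree True True) (Seq (restore AuxA) (restore AuxC))"

definition swap where
  "swap = Seq (take_tree True False) (Seq (take_tree False True) (Seq (restore AuxA) (restore AuxC)))"

lemma run_drop: "run drop_tree (st (code x @ w) a d c, v) (50 * sz x) (st w a d c, v)"
  using run_take_tree[of False False x w a d c v] by (simp add: drop_tree_def saved_def)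

lemma run_dup: "run dup (st (code x @ w) a d c, v) (100 * sz x) (st (code x @ code x @ w) a d c, v)"
  unfolding dup_def
  by (rule run_Seq[OF run_take_tree run_Seq[OF run_restore(1) run_restore(2) order_refl]])
    (use sz_pos[of x] in linarith)

lemma run_swap:
  "run swap (st (code x @ code y @ w) a d c, v) (100 * (sz x + sz y)) (st (code y @ code x @ w) a d c, v)"
  unfolding swap_def
proof (rule run_Seq[OF run_take_tree run_Seq[OF run_take_tree _ order_refl]])
  show "run (Seq (restore AuxA) (restore AuxC))
      (st w (saved False y (saved True x a)) d (saved True y (saved False x c)), v)
      (Suc (6 * sz x + 6 * sz y)) (st (code y @ code x @ w) a d c, v)"
    unfolding saved_False by (rule run_Seq[OF run_restore(1) run_restore(2) order_refl])
qed (insert sz_pos[of x] sz_pos[of y], simp)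

subsection \<open>Polynomial bounds\<close>

text \<open>The base is at least 2, so constants and sums are absorbed by a larger exponent. The
  bound \<open>(n + 2) ^ k\<close> is monotone even if \<open>f\<close> is not, which composition of
  time bounds relies on.\<close>

definition pb :: "(nat \<Rightarrow> nat) \<Rightarrow> bool" where
  "pb f \<longleftrightarrow> (\<exists>k. \<forall>n. f n \<le> (n + 2) ^ k)"

lemma pb_const: "pb (\<lambda>n. c)"
proof -
  have "c \<le> (n + 2) ^ c" for n
    using power_mono[of 2 "n + 2" c] less_exp[of c] by linarith
  then show ?thesis unfolding pb_def by blast
qed

lemma pb_id: "pb (\<lambda>n. n)"
  unfolding pb_def by (rule exI[of _ 1]) simp

lemma pb_add:
  assumes "pb f" "pb g"
  shows "pb (\<lambda>n. f n + g n)"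
proof -
  obtain k l where kl: "\<And>n. f n \<le> (n + 2) ^ k" "\<And>n. g n \<le> (n + 2) ^ l"
    using assms unfolding pb_def by blast
  have "f n + g n \<le> (n + 2) ^ Suc (k + l)" for n
  proof -
    have "(n + 2) ^ k \<le> (n + 2) ^ (k + l)" "(n + 2) ^ l \<le> (n + 2) ^ (k + l)"
      by (rule power_increasing; simp)+
    then have "f n + g n \<le> 2 * (n + 2) ^ (k + l)" using kl[of n] by linarith
    also have "\<dots> \<le> (n + 2) ^ Suc (k + l)" by simp
    finally show ?thesis .
  qed
  then show ?thesis unfolding pb_def by blast
qed

lemma pb_mult:
  assumes "pb f" "pb g"
  shows "pb (\<lambda>n. f n * g n)"
proof -
  obtain k l where "\<And>n. f n \<le> (n + 2) ^ k" "\<And>n. g n \<le> (n + 2) ^ l"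
    using assms unfolding pb_def by blast
  then have "f n * g n \<le> (n + 2) ^ (k + l)" for n
    unfolding power_add by (rule mult_mono) auto
  then show ?thesis unfolding pb_def by blast
qed

lemma pb_power: "pb f \<Longrightarrow> pb (\<lambda>n. f n ^ k)"
  by (induction k) (auto intro: pb_const pb_mult)

lemma pb_Suc: "pb f \<Longrightarrow> pb (\<lambda>n. Suc (f n))"
  using pb_add[OF pb_const[of 1]] by simp

lemmas pb_intros = pb_const pb_id pb_add pb_mult pb_power pb_Suc

subsection \<open>Polynomial-time programs on the work stack\<close>

text \<open>The rest of the work stack, the other stacks and the output are arbitrary and come back
  unchanged, so the program may be used as a part of others. Argument and result are families of
  trees over a common index, with one program for all indices.\<close>

definition ptm :: "('a \<Rightarrow> tree) \<Rightarrow> ('a \<Rightarrow> tree) \<Rightarrow> bool" where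
  "ptm i r \<longleftrightarrow> (\<exists>p c. pb p \<and> (\<forall>x w a d e v.
     run c (st (code (i x) @ w) a d e, v) (p (sz (i x))) (st (code (r x) @ w) a d e, v)))"

lemma ptmI:
  "pb p \<Longrightarrow> (\<And>x w a d e v. run c (st (code (i x) @ w) a d e, v) (p (sz (i x))) (st (code (r x) @ w) a d e, v))
    \<Longrightarrow> ptm i r"
  unfolding ptm_def by blast

definition computes :: "cmd \<Rightarrow> nat \<Rightarrow> ('a \<Rightarrow> tree) \<Rightarrow> ('a \<Rightarrow> tree) \<Rightarrow> bool" where
  "computes c k i r \<longleftrightarrow>
    (\<forall>x w a d e v. run c (st (code (i x) @ w) a d e, v) ((sz (i x) + 2) ^ k) (st (code (r x) @ w) a d e, v)) \<and>
    (\<forall>x. sz (r x) \<le> (sz (i x) + 2) ^ k)"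

lemma computesD:
  assumes "computes c k i r"
  shows "run c (st (code (i x) @ w) a d e, v) ((sz (i x) + 2) ^ k) (st (code (r x) @ w) a d e, v)"
    "sz (r x) \<le> (sz (i x) + 2) ^ k"
  using assms unfolding computes_def by blast+

lemma ptmE:
  assumes "ptm i r"
  obtains c k where "computes c k i r"
proof -
  obtain p c where p: "pb p" and c:
    "\<And>x w a d e v. run c (st (code (i x) @ w) a d e, v) (p (sz (i x))) (st (code (r x) @ w) a d e, v)"
    using assms unfolding ptm_def by blast
  obtain k where k: "\<And>n. p n + n \<le> (n + 2) ^ k"
    using pb_add[OF p pb_id] unfolding pb_def by blast
  have le: "p n \<le> (n + 2) ^ k" for n
    using k[of n] by linarith
  have "sz (r x) \<le> (sz (i x) + 2) ^ k" for x
  proof -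
    \<comment> \<open>Run with nothing else on the stacks, the program leaves a work stack whose
      length is exactly the size of the result; its initial length plus the time bounds it.\<close>
    obtain t where t: "t \<le> p (sz (i x))" "exec c (st (code (i x) @ []) [] [] [], []) t (st (code (r x) @ []) [] [] [], [])"
      using c[of x "[]" "[]" "[]" "[]" "[]"] unfolding run_def by blast
    have "sz (r x) \<le> sz (i x) + t"
      using exec_length[OF t(2), of Work] by (simp add: sz_def)
    then show ?thesis using k[of "sz (i x)"] t by linarith
  qed
  then show ?thesis using that run_mono[OF c le] unfolding computes_def by blast
qed

lemma ptm_reindex: "ptm i r \<Longrightarrow> ptm (\<lambda>x. i (f x)) (\<lambda>x. r (f x))"
  unfolding ptm_def by meson

lemma ptm_id: "ptm i i"
  by (rule ptmI[where p = "\<lambda>_. 1" and c = Skip]) (auto intro: pb_const run_Skip)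

lemma ptm_comp:
  assumes "ptm i m" "ptm m r"
  shows "ptm i r"
proof -
  obtain c k where "computes c k i m" by (rule ptmE[OF assms(1)])
  note c = computesD[OF this]
  obtain c' k' where "computes c' k' m r" by (rule ptmE[OF assms(2)])
  note c' = computesD[OF this]
  have le: "(sz (m x) + 2) ^ k' \<le> ((sz (i x) + 2) ^ k + 2) ^ k'" for x
    using c(2) by (intro power_mono) auto
  show ?thesis
    by (rule ptmI[where p = "\<lambda>n. Suc ((n + 2) ^ k + ((n + 2) ^ k + 2) ^ k')" and c = "Seq c c'"])
      (intro pb_intros, rule run_Seq[OF c(1) run_mono[OF c'(1) le] order_refl])
qed

lemma ptm_Lf: "ptm i (\<lambda>_. Lf)"
  by (rule ptmI[where p = "\<lambda>n. 50 * n + 3" and c = "Seq drop_tree (Push Work False)"])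
    (intro pb_intros, auto intro!: run_Seq[OF run_drop run_Push[OF refl order_refl]] run_Seq[OF run_drop run_Push])

text \<open>The right subtree is computed first, because in preorder the left one must lie above it;
  the root bit is pushed last.\<close>

lemma ptm_Nd:
  assumes "ptm i f" "ptm i g"
  shows "ptm i (\<lambda>x. Nd (f x) (g x))"
proof -
  obtain c k where "computes c k i f" by (rule ptmE[OF assms(1)])
  note c = computesD[OF this]
  obtain c' k' where "computes c' k' i g" by (rule ptmE[OF assms(2)])
  note c' = computesD[OF this]
  let ?q = "\<lambda>n. Suc (100 * n + Suc ((n + 2) ^ k' + Suc (100 * ((n + 2) ^ k' + n) + Suc ((n + 2) ^ k + 2))))"
  show ?thesis
  proof (rule ptmI[where p = ?q and c = "Seq dup (Seq c' (Seq swap (Seq c (Push Work True))))"])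
    show "pb ?q" by (intro pb_intros)
    fix x w a d e v
    have swap: "run swap (st (code (g x) @ code (i x) @ w) a d e, v) (100 * ((sz (i x) + 2) ^ k' + sz (i x)))
        (st (code (i x) @ code (g x) @ w) a d e, v)"
      using c'(2) by (intro run_mono[OF run_swap]) auto
    have push: "run (Push Work True) (st (code (f x) @ code (g x) @ w) a d e, v) 2
        (st (code (Nd (f x) (g x)) @ w) a d e, v)"
      by (rule run_Push) auto
    show "run (Seq dup (Seq c' (Seq swap (Seq c (Push Work True))))) (st (code (i x) @ w) a d e, v)
        (?q (sz (i x))) (st (code (Nd (f x) (g x)) @ w) a d e, v)"
      by (rule run_Seq[OF run_dup run_Seq[OF c'(1) run_Seq[OF swap run_Seq[OF c(1) push order_refl] order_refl] order_refl] order_refl])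
  qed
qed

fun car :: "tree \<Rightarrow> tree" where "car Lf = Lf" | "car (Nd x y) = x"
fun cdr :: "tree \<Rightarrow> tree" where "cdr Lf = Lf" | "cdr (Nd x y) = y"

lemma ptm_car: "ptm i (\<lambda>x. car (i x))"
proof (rule ptmI[where p = "\<lambda>n. 200 * n + 200" and
      c = "Pop Work (Seq (take_tree True False) (Seq drop_tree (restore AuxA))) (Push Work False) Skip"])
  show "pb (\<lambda>n. 200 * n + 200)" by (intro pb_intros)
  fix x w a d e v
  have "run (Seq (take_tree True False) (Seq drop_tree (restore AuxA))) (st (code y @ code z @ w) a d e, v)
      (Suc (50 * sz y + Suc (50 * sz z + 6 * sz y))) (st (code y @ w) a d e, v)" for y z
    by (rule run_Seq[OF run_take_tree[of True False, unfolded saved_False] run_Seq[OF run_drop run_restore(1) order_refl] order_refl])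
  note seq = this
  show "run (Pop Work (Seq (take_tree True False) (Seq drop_tree (restore AuxA))) (Push Work False) Skip)
      (st (code (i x) @ w) a d e, v) (200 * sz (i x) + 200) (st (code (car (i x)) @ w) a d e, v)"
  proof (cases "i x")
    case Lf
    then show ?thesis by (auto intro!: run_PopF[where n = 2] run_Push)
  next
    case (Nd y z)
    show ?thesis
      unfolding Nd by (rule run_PopT[where r = "code y @ code z @ w", OF _ _ order_refl, THEN run_mono])
        (simp, simp, rule seq, simp)
  qed
qed

lemma ptm_cdr: "ptm i (\<lambda>x. cdr (i x))"
proof (rule ptmI[where p = "\<lambda>n. 50 * n + 200" and c = "Pop Work drop_tree (Push Work False) Skip"])
  show "pb (\<lambda>n. 50 * n + 200)" by (intro pb_intros)
  fix x w a d e v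
  show "run (Pop Work drop_tree (Push Work False) Skip)
      (st (code (i x) @ w) a d e, v) (50 * sz (i x) + 200) (st (code (cdr (i x)) @ w) a d e, v)"
  proof (cases "i x")
    case (Nd y z)
    then show ?thesis using run_drop[of y "code z @ w" a d e v]
      by (auto intro!: run_PopT[where n = "50 * sz y"])
  qed (auto intro!: run_PopF[where n = 2] run_Push)
qed

lemma ptm_if:
  assumes "ptm i t" "ptm i f" "ptm i g"
  shows "ptm i (\<lambda>x. if t x \<noteq> Lf then f x else g x)"
proof -
  obtain c k where "computes c k i t" by (rule ptmE[OF assms(1)])
  note c = computesD[OF this]
  obtain cf kf where "computes cf kf i f" by (rule ptmE[OF assms(2)])
  note cf = computesD[OF this]
  obtain cg kg where "computes cg kg i g" by (rule ptmE[OF assms(3)])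
  note cg = computesD[OF this]
  \<comment> \<open>The test value is removed here: a leaf is the single bit that \<open>Pop\<close>
    has consumed, whereas after a node bit two subtrees remain to be dropped.\<close>
  let ?br = "Pop Work (Seq drop_tree (Seq drop_tree cf)) cg Skip"
  let ?b = "\<lambda>n. 50 * (n + 2) ^ k + ((n + 2) ^ kf + (n + 2) ^ kg + 20)"
  let ?q = "\<lambda>n. Suc (100 * n + Suc ((n + 2) ^ k + ?b n))"
  show ?thesis
  proof (rule ptmI[where p = ?q and c = "Seq dup (Seq c ?br)"])
    show "pb ?q" by (intro pb_intros)
    fix x w a d e v
    have "run ?br (st (code (t x) @ code (i x) @ w) a d e, v) (?b (sz (i x)))
        (st (code (if t x \<noteq> Lf then f x else g x) @ w) a d e, v)"
    proof (cases "t x")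
      case Lf
      then show ?thesis
        by (auto intro!: run_PopF[OF _ _ order_refl, THEN run_mono] cg(1))
    next
      case (Nd y z)
      have "50 * (sz y + sz z) \<le> 50 * (sz (i x) + 2) ^ k"
        using c(2)[of x] Nd by simp
      then have "run ?br (st (True # code y @ code z @ code (i x) @ w) a d e, v) (?b (sz (i x)))
        (st (code (f x) @ w) a d e, v)"
        by (intro run_PopT[OF _ _ order_refl, THEN run_mono])
          (auto intro!: run_Seq[OF run_drop run_Seq[OF run_drop cf(1) order_refl] order_refl])
      then show ?thesis using Nd by simp
    qed
    note br = this
    show "run (Seq dup (Seq c ?br)) (st (code (i x) @ w) a d e, v) (?q (sz (i x)))
        (st (code (if t x \<noteq> Lf then f x else g x) @ w) a d e, v)"
      by (rule run_Seq[OF run_dup run_Seq[OF c(1) br order_refl] order_refl])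
  qed
qed

subsection \<open>Polynomial-time functions on encoded data\<close>

class data =
  fixes tree_of :: "'a \<Rightarrow> tree"

instantiation tree :: data begin
definition tree_of_tree :: "tree \<Rightarrow> tree" where "tree_of_tree x = x"
instance ..
end

text \<open>Both truth values have trees of the same size, so that the size of a list of bits depends on
  its length only.\<close>

instantiation bool :: data begin
definition tree_of_bool :: "bool \<Rightarrow> tree" where
  "tree_of_bool b = (if b then Nd (Nd Lf Lf) Lf else Nd Lf (Nd Lf Lf))"
instance ..
end

instantiation prod :: (data, data) data begin
fun tree_of_prod :: "'a \<times> 'b \<Rightarrow> tree" where "tree_of_prod (x, y) = Nd (tree_of x) (tree_of y)"
instance ..
end

instantiation list :: (data) data begin
fun tree_of_list :: "'a list \<Rightarrow> tree" where
  "tree_of_list [] = Lf"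
| "tree_of_list (x # xs) = Nd (tree_of x) (tree_of xs)"
instance ..
end

definition ds :: "'a :: data \<Rightarrow> nat" where
  "ds x = sz (tree_of x)"

lemma ds_simps [simp]:
  "ds ([] :: 'a :: data list) = 1" "ds (x # xs) = Suc (ds x + ds xs)" "ds (x, y) = Suc (ds x + ds y)" "ds (b :: bool) = 5"
  by (auto simp: ds_def tree_of_bool_def)

definition ptime :: "('a :: data \<Rightarrow> 'b :: data) \<Rightarrow> bool" where
  "ptime f \<longleftrightarrow> ptm tree_of (\<lambda>x. tree_of (f x))"

named_theorems pt

lemma pt_id [pt]: "ptime (\<lambda>x. x)"
  unfolding ptime_def by (rule ptm_id)

lemma pt_comp: "ptime f \<Longrightarrow> ptime g \<Longrightarrow> ptime (\<lambda>x. f (g x))"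
  unfolding ptime_def by (rule ptm_comp, assumption, rule ptm_reindex)

lemma ptm_const: "ptm i (\<lambda>_. c)"
  by (induction c) (auto intro: ptm_Lf ptm_Nd)

lemma pt_const [pt]: "ptime (\<lambda>_. c)"
  unfolding ptime_def by (rule ptm_const)

lemma pt_Pair [pt]: "ptime f \<Longrightarrow> ptime g \<Longrightarrow> ptime (\<lambda>x. (f x, g x))"
  unfolding ptime_def by (simp add: ptm_Nd)

lemma pt_Cons [pt]: "ptime f \<Longrightarrow> ptime g \<Longrightarrow> ptime (\<lambda>x. f x # g x)"
  unfolding ptime_def by (simp add: ptm_Nd)

lemma pt_car [pt]: "ptime f \<Longrightarrow> ptime (\<lambda>x. car (f x))"
  unfolding ptime_def tree_of_tree_def by (rule ptm_comp, assumption, rule ptm_car)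

lemma pt_cdr [pt]: "ptime f \<Longrightarrow> ptime (\<lambda>x. cdr (f x))"
  unfolding ptime_def tree_of_tree_def by (rule ptm_comp, assumption, rule ptm_cdr)

lemma pt_fst [pt]:
  assumes "ptime f"
  shows "ptime (\<lambda>x. fst (f x))"
proof -
  have "tree_of (fst p) = car (tree_of p)" for p :: "'b \<times> 'c"
    by (cases p) auto
  then show ?thesis
    using assms unfolding ptime_def by (simp add: ptm_comp[OF _ ptm_car])
qed

lemma pt_snd [pt]:
  assumes "ptime f"
  shows "ptime (\<lambda>x. snd (f x))"
proof -
  have "tree_of (snd p) = cdr (tree_of p)" for p :: "'b \<times> 'c"
    by (cases p) auto
  then show ?thesis
    using assms unfolding ptime_def by (simp add: ptm_comp[OF _ ptm_cdr])
qed

lemma pt_tl [pt]: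
  assumes "ptime f"
  shows "ptime (\<lambda>x. tl (f x))"
proof -
  have "tree_of (tl p) = cdr (tree_of p)" for p :: "'b list"
    by (cases p) auto
  then show ?thesis
    using assms unfolding ptime_def by (simp add: ptm_comp[OF _ ptm_cdr])
qed

text \<open>On the empty list \<open>hd\<close> returns a fixed though unspecified value, which can
  be built into the program as a constant. Its unknown size appears again in the bounds for the
  parser.\<close>

lemma pt_hd [pt]:
  assumes "ptime f"
  shows "ptime (\<lambda>x. hd (f x))"
proof -
  have "tree_of (hd p) = (if tree_of p \<noteq> Lf then car (tree_of p) else tree_of (hd [] :: 'b))" for p :: "'b list"
    by (cases p) auto
  moreover have "ptm tree_of (\<lambda>x. if tree_of (f x) \<noteq> Lf then car (tree_of (f x)) else tree_of (hd [] :: 'b))"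
    using assms unfolding ptime_def by (intro ptm_if ptm_const ptm_comp[OF _ ptm_car])
  ultimately show ?thesis
    unfolding ptime_def by simp
qed

lemma pt_if [pt]:
  assumes "ptime b" "ptime f" "ptime g"
  shows "ptime (\<lambda>x. if b x then f x else g x)"
proof -
  have "tree_of (if b x then f x else g x) = (if car (tree_of (b x)) \<noteq> Lf then tree_of (f x) else tree_of (g x))" for x
    by (auto simp: tree_of_bool_def)
  moreover have "ptm tree_of (\<lambda>x. if car (tree_of (b x)) \<noteq> Lf then tree_of (f x) else tree_of (g x))"
    using assms unfolding ptime_def by (intro ptm_if ptm_comp[OF _ ptm_car])
  ultimately show ?thesis
    unfolding ptime_def by simp
qed

lemma ptm_tree_eq_Lf:
  assumes "ptm i f"
  shows "ptm i (\<lambda>x. tree_of (f x = Lf))"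
proof -
  have "ptm i (\<lambda>x. if f x \<noteq> Lf then tree_of False else tree_of True)"
    using assms by (intro ptm_if ptm_const)
  moreover have "tree_of (f x = Lf) = (if f x \<noteq> Lf then tree_of False else tree_of True)" for x
    by simp
  ultimately show ?thesis by presburger
qed

lemma pt_eq_Lf [pt]: "ptime f \<Longrightarrow> ptime (\<lambda>x. f x = Lf)"
  unfolding ptime_def tree_of_tree_def by (rule ptm_tree_eq_Lf)

lemma pt_null [pt]:
  assumes "ptime f"
  shows "ptime (\<lambda>x. f x = [])"
proof -
  have "(f x = []) = (tree_of (f x) = Lf)" for x
    by (cases "f x") auto
  then show ?thesis
    using ptm_tree_eq_Lf[of tree_of "\<lambda>x. tree_of (f x)"] assms unfolding ptime_def by simp
qed

lemma pt_not [pt]: "ptime b \<Longrightarrow> ptime (\<lambda>x. \<not> b x)"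
  using pt_if[OF _ pt_const[of False] pt_const[of True], of b] by (simp only: if_bool_eq_conj) simp

lemma pt_conj [pt]: "ptime a \<Longrightarrow> ptime b \<Longrightarrow> ptime (\<lambda>x. a x \<and> b x)"
  using pt_if[OF _ _ pt_const[of False], of a b] by (simp add: if_bool_eq_disj)

lemma pt_disj [pt]: "ptime a \<Longrightarrow> ptime b \<Longrightarrow> ptime (\<lambda>x. a x \<or> b x)"
  using pt_if[OF _ pt_const[of True], of a b] by (simp only: if_bool_eq_conj) (simp add: disj_commute imp_conv_disj)

lemma pt_bool_eq:
  assumes "ptime a" "ptime (b :: 'a :: data \<Rightarrow> bool)"
  shows "ptime (\<lambda>x. a x = b x)"
proof -
  have "ptime (\<lambda>x. if a x then b x else \<not> b x)"
    using assms by (intro pt)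
  moreover have "(\<lambda>x. if a x then b x else \<not> b x) = (\<lambda>x. a x = b x)"
    by auto
  ultimately show ?thesis by simp
qed

lemma ptime_size:
  assumes "ptime f"
  obtains q where "pb q" "\<And>x. ds (f x) \<le> q (ds x)"
proof -
  obtain c k where "computes c k tree_of (\<lambda>x. tree_of (f x))"
    using ptmE[OF assms[unfolded ptime_def]] .
  from computesD(2)[OF this] have "ds (f x) \<le> (ds x + 2) ^ k" for x
    by (simp add: ds_def)
  then show ?thesis
    using that[of "\<lambda>n. (n + 2) ^ k"] pb_power[OF pb_add[OF pb_id pb_const], of 2 k] by simp
qed

text \<open>The list is its own loop counter: the node bit of a cons cell continues the loop, and
  the leaf of the empty list ends it. In the body the first element is lifted over the rest of the
  list, the rest waits on \<open>AuxC\<close>, and a pushed node bit completes the tree of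
  \<open>(y, x, s)\<close>, the argument of \<open>c\<close>.\<close>

lemma run_fold_loop:
  fixes l :: "'b :: data list" and s :: "'c :: data"
  defines "body c \<equiv> Seq (take_tree True False) (Seq (take_tree False True) (Seq (restore AuxA)
    (Seq (Push Work True) (Seq c (restore AuxC)))))"
  assumes c: "\<And>y s w a d e v. y \<in> set l \<Longrightarrow>
      run c (st (code (tree_of (y, x, s)) @ w) a d e, v) ((ds (y, x, s) + 2) ^ k)
        (st (code (tree_of (x, g y s)) @ w) a d e, v)"
    and B: "\<And>n. ds (fold g (take n l) s) \<le> B"
    and L: "ds l \<le> L"
  shows "run (Loop Work (body c)) (st (code (tree_of l) @ code (tree_of (x, s)) @ w) a d e, v)
    (ds l * (120 * L + (L + ds x + B + 4) ^ k + 20))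
    (st (code (tree_of (x, fold g l s)) @ w) a d e, v)"
  using c B L
proof (induction l arbitrary: s)
  case Nil
  then show ?case by (auto intro!: run_LoopF)
next
  case (Cons y l)
  let ?T = "120 * L + (L + ds x + B + 4) ^ k + 20"
  let ?s = "\<lambda>s. code (tree_of (x, s)) @ w"
  have s: "ds s \<le> B"
    using Cons.prems(2)[of 0] by simp
  have IH: "run (Loop Work (body c)) (st (code (tree_of l) @ code (tree_of (x, g y s)) @ w) a d e, v)
      (ds l * ?T) (st (code (tree_of (x, fold g l (g y s))) @ w) a d e, v)"
  proof (rule Cons.IH)
    show "ds (fold g (take n l) (g y s)) \<le> B" for n
      using Cons.prems(2)[of "Suc n"] by simp
  qed (use Cons.prems in auto)
  have c: "run c (st (code (tree_of (y, x, s)) @ w) a d e', v) ((L + ds x + B + 4) ^ k)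
      (st (code (tree_of (x, g y s)) @ w) a d e', v)" for e'
    by (rule run_mono[OF Cons.prems(1)]) (use s Cons.prems(3) in \<open>auto intro!: power_mono\<close>)
  have push: "run (Push Work True) (st (code (tree_of y) @ ?s s) a d e', v) 2
      (st (code (tree_of (y, x, s)) @ w) a d e', v)" for e'
    by (rule run_Push) auto
  have "run (body c) (st (code (tree_of y) @ code (tree_of l) @ ?s s) a d e, v)
      (Suc (50 * ds y + Suc (50 * ds l + Suc (6 * ds y + Suc (2 + Suc ((L + ds x + B + 4) ^ k + 6 * ds l))))))
      (st (code (tree_of l) @ ?s (g y s)) a d e, v)"
    unfolding body_def ds_def
    by (rule run_Seq[OF run_take_tree[of True False, unfolded saved_False]
        run_Seq[OF run_take_tree[of False True, unfolded saved_False]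
        run_Seq[OF run_restore(1) run_Seq[OF push run_Seq[OF c[unfolded ds_def] run_restore(2) order_refl] order_refl] order_refl] order_refl] order_refl])
  then have "run (body c) (st (code (tree_of y) @ code (tree_of l) @ ?s s) a d e, v) (?T - 1)
      (st (code (tree_of l) @ ?s (g y s)) a d e, v)"
    by (rule run_mono) (use Cons.prems(3) in simp)
  note step = this
  have "run (Loop Work (body c)) (st (code (tree_of (y # l)) @ ?s s) a d e, v) (ds (y # l) * ?T)
      (st (code (tree_of (x, fold g l (g y s))) @ w) a d e, v)"
  proof (rule run_LoopT[OF _ _ IH])
    show "st (code (tree_of (y # l)) @ ?s s) a d e Work = True # code (tree_of y) @ code (tree_of l) @ ?s s"
      by simp
    show "run (body c) ((st (code (tree_of (y # l)) @ ?s s) a d e)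
        (Work := code (tree_of y) @ code (tree_of l) @ ?s s), v) (?T - 1)
        (st (code (tree_of l) @ ?s (g y s)) a d e, v)"
      using step by simp
    have "Suc (?T - 1 + ds l * ?T) = Suc (ds l) * ?T"
      by simp
    also have "\<dots> \<le> ds (y # l) * ?T"
      by (intro mult_right_mono) auto
    finally show "Suc (?T - 1 + ds l * ?T) \<le> ds (y # l) * ?T" .
  qed
  then show ?case by simp
qed

lemma pt_fold_bounded:
  fixes g :: "'a :: data \<Rightarrow> 'b :: data \<Rightarrow> 'c :: data \<Rightarrow> 'c"
  assumes g: "ptime (\<lambda>p. g (fst (snd p)) (fst p) (snd (snd p)))"
    and l: "ptime l" and s: "ptime s"
    and q: "pb q" "\<And>x n. ds (fold (g x) (take n (l x)) (s x)) \<le> q (ds x)"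
  shows "ptime (\<lambda>x. fold (g x) (l x) (s x))"
proof -
  define F where "F x = (l x, x, s x)" for x
  define R where "R x = (x, fold (g x) (l x) (s x))" for x
  have "ptime (\<lambda>p :: 'b \<times> 'a \<times> 'c. (fst (snd p), g (fst (snd p)) (fst p) (snd (snd p))))"
    using g by (intro pt)
  then obtain c k where "computes c k tree_of
      (\<lambda>p :: 'b \<times> 'a \<times> 'c. tree_of (fst (snd p), g (fst (snd p)) (fst p) (snd (snd p))))"
    unfolding ptime_def by (rule ptmE)
  note c = computesD(1)[OF this]
  obtain m where m: "\<And>n. q n \<le> (n + 2) ^ m"
    using q(1) unfolding pb_def by blast
  define body where "body = Seq (take_tree True False) (Seq (take_tree False True) (Seq (restore AuxA)
    (Seq (Push Work True) (Seq c (restore AuxC)))))"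
  let ?T = "\<lambda>n. Suc (n * (120 * n + (n + n + (n + 2) ^ m + 4) ^ k + 20))"
  have "ptm (\<lambda>x. tree_of (F x)) (\<lambda>x. tree_of (R x))"
  \<comment> \<open>Popping the root bit of \<open>F x\<close> uncovers the tree of
    \<open>l x\<close> above that of \<open>(x, s x)\<close>, just the layout that the loop
    expects.\<close>
  proof (rule ptmI[where p = ?T and c = "Pop Work (Loop Work body) Skip Skip"])
    show "pb ?T" by (intro pb_intros)
    fix x w a d e v
    let ?B = "(ds (F x) + 2) ^ m"
    have le: "ds x \<le> ds (F x)" "ds (l x) \<le> ds (F x)"
      by (auto simp: F_def)
    have B: "ds (fold (g x) (take n (l x)) (s x)) \<le> ?B" for n
      by (rule order_trans[OF q(2) order_trans[OF m power_mono]]) (use le in auto)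
    have "run (Loop Work body) (st (code (tree_of (l x)) @ code (tree_of (x, s x)) @ w) a d e, v)
        (ds (l x) * (120 * ds (F x) + (ds (F x) + ds x + ?B + 4) ^ k + 20))
        (st (code (tree_of (R x)) @ w) a d e, v)"
      unfolding body_def R_def
    proof (rule run_fold_loop[OF _ B le(2)])
      fix y :: 'b and s :: 'c and w a d e v
      show "run c (st (code (tree_of (y, x, s)) @ w) a d e, v) ((ds (y, x, s) + 2) ^ k)
          (st (code (tree_of (x, g x y s)) @ w) a d e, v)"
        using c[of "(y, x, s)" w a d e v] by (simp add: ds_def)
    qed
    then have "run (Loop Work body) (st (code (tree_of (l x)) @ code (tree_of (x, s x)) @ w) a d e, v)
        (ds (F x) * (120 * ds (F x) + (ds (F x) + ds (F x) + ?B + 4) ^ k + 20))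
        (st (code (tree_of (R x)) @ w) a d e, v)"
      by (rule run_mono) (intro mult_mono add_mono power_mono le order_refl; simp)
    then show "run (Pop Work (Loop Work body) Skip Skip) (st (code (tree_of (F x)) @ w) a d e, v)
        (?T (sz (tree_of (F x)))) (st (code (tree_of (R x)) @ w) a d e, v)"
      by (intro run_PopT[OF _ _ order_refl]) (auto simp: ds_def F_def)
  qed
  moreover have "ptm tree_of (\<lambda>x. tree_of (F x))"
    using pt_Pair[OF l pt_Pair[OF pt_id s]] unfolding ptime_def F_def .
  ultimately have "ptime R"
    unfolding ptime_def by (rule ptm_comp[rotated])
  from pt_snd[OF this] show ?thesis
    by (simp add: R_def)
qed

lemma length_le_ds: "length xs \<le> ds xs"
  by (induction xs) auto

lemma ds_mem: "x \<in> set xs \<Longrightarrow> ds x \<le> ds xs"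
  by (induction xs) auto

lemma pt_fold:
  fixes g :: "'a :: data \<Rightarrow> 'b :: data \<Rightarrow> 'c :: data \<Rightarrow> 'c"
  assumes g: "ptime (\<lambda>p. g (fst (snd p)) (fst p) (snd (snd p)))"
    and l: "ptime l" and s: "ptime s"
    and q: "pb q" "\<And>x y s. y \<in> set (l x) \<Longrightarrow> ds (g x y s) \<le> ds s + q (ds x)"
  shows "ptime (\<lambda>x. fold (g x) (l x) (s x))"
proof -
  obtain ql where ql: "pb ql" "\<And>x. ds (l x) \<le> ql (ds x)"
    using ptime_size[OF l] by blast
  obtain qs where qs: "pb qs" "\<And>x. ds (s x) \<le> qs (ds x)"
    using ptime_size[OF s] by blast
  have fold: "ds (fold (g x) xs s) \<le> ds s + length xs * q (ds x)" if "set xs \<subseteq> set (l x)" for x xs s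
    using that
  proof (induction xs arbitrary: s)
    case (Cons y xs)
    then have "ds (fold (g x) xs (g x y s)) \<le> ds (g x y s) + length xs * q (ds x)"
      by simp
    also have "\<dots> \<le> ds s + q (ds x) + length xs * q (ds x)"
      using q(2)[of y x s] Cons.prems by simp
    finally show ?case by simp
  qed simp
  show ?thesis
  proof (rule pt_fold_bounded[OF g l s])
    show "pb (\<lambda>n. qs n + ql n * q n)"
      using q(1) ql(1) qs(1) by (intro pb_intros)
    fix x n
    have "ds (fold (g x) (take n (l x)) (s x)) \<le> ds (s x) + length (take n (l x)) * q (ds x)"
      by (rule fold) (rule set_take_subset)
    also have "\<dots> \<le> qs (ds x) + ql (ds x) * q (ds x)"
      using length_le_ds[of "l x"] ql(2)[of x] by (intro add_mono mult_mono qs) auto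
    finally show "ds (fold (g x) (take n (l x)) (s x)) \<le> qs (ds x) + ql (ds x) * q (ds x)" .
  qed
qed

subsection \<open>List functions\<close>

lemma ds_append: "ds (xs @ ys) + 1 = ds xs + ds ys"
  by (induction xs) auto

lemma ds_append_le: "ds (xs @ ys) \<le> Suc (ds xs + ds ys)"
  using ds_append[of xs ys] by linarith

lemma ds_rev [simp]: "ds (rev xs) = ds xs"
proof (induction xs)
  case (Cons x xs)
  then show ?case using ds_append[of "rev xs" "[x]"] by simp
qed simp

lemma ds_tl_le: "ds (tl xs) \<le> ds xs"
  by (cases xs) auto

text \<open>The growth in one step is bounded by the size of \<open>H x y\<close> for some
  polynomial-time \<open>H\<close>, which spares explicit polynomials. The multiplicative growth
  that repeated doubling would cause is excluded, since the state enters with factor one.\<close>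

lemma pt_fold_incr:
  fixes g :: "'a :: data \<Rightarrow> 'b :: data \<Rightarrow> 'c :: data \<Rightarrow> 'c" and H :: "'a \<Rightarrow> 'b \<Rightarrow> 'd :: data"
  assumes g: "ptime (\<lambda>p. g (fst (snd p)) (fst p) (snd (snd p)))"
    and l: "ptime l" and s: "ptime s"
    and H: "ptime (\<lambda>p. H (snd p) (fst p))" "\<And>x y s. ds (g x y s) \<le> ds s + ds (H x y) + c"
  shows "ptime (\<lambda>x. fold (g x) (l x) (s x))"
proof -
  obtain ql where ql: "pb ql" "\<And>x. ds (l x) \<le> ql (ds x)"
    using ptime_size[OF l] by blast
  obtain q where q: "pb q" "\<And>p. ds (H (snd p) (fst p)) \<le> q (ds p)"
    using ptime_size[OF H(1)] by blast
  obtain k where k: "\<And>n. q n \<le> (n + 2) ^ k"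
    using q(1) unfolding pb_def by blast
  show ?thesis
  proof (rule pt_fold[OF g l s])
    show "pb (\<lambda>n. (Suc (ql n + n) + 2) ^ k + c)"
      using ql(1) by (intro pb_intros)
    fix x y s
    assume "y \<in> set (l x)"
    then have "ds (y, x) \<le> Suc (ql (ds x) + ds x)"
      using ds_mem[of y "l x"] ql(2)[of x] by simp
    then have "(ds (y, x) + 2) ^ k \<le> (Suc (ql (ds x) + ds x) + 2) ^ k"
      by (intro power_mono) auto
    then show "ds (g x y s) \<le> ds s + ((Suc (ql (ds x) + ds x) + 2) ^ k + c)"
      using H(2)[of x y s] q(2)[of "(y, x)"] k[of "ds (y, x)"] by simp
  qed
qed

lemma pt_rev [pt]: "ptime l \<Longrightarrow> ptime (\<lambda>x. rev (l x))"
  unfolding rev_conv_fold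
  by (rule pt_fold_incr[where H = "\<lambda>x y. y" and c = 1]) (intro pt | simp)+

lemma append_conv_fold: "xs @ ys = fold Cons (rev xs) ys"
  by (simp flip: foldr_conv_fold) (induction xs; simp)

lemma pt_append [pt]: "ptime l \<Longrightarrow> ptime m \<Longrightarrow> ptime (\<lambda>x. l x @ m x)"
  unfolding append_conv_fold
  by (rule pt_fold_incr[where H = "\<lambda>x y. y" and c = 1]) (intro pt | simp)+

lemma pt_map [pt]:
  assumes "ptime (\<lambda>p. f (snd p) (fst p))" "ptime l"
  shows "ptime (\<lambda>x. map (f x) (l x))"
proof -
  have "ptime (\<lambda>p. f (fst (snd p)) (fst p))"
    using pt_comp[OF assms(1), of "\<lambda>p. (fst p, fst (snd p))"] by (simp add: pt)
  then have "ptime (\<lambda>x. rev (fold (\<lambda>y s. f x y # s) (l x) []))"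
    using assms by (intro pt_rev pt_fold_incr[where H = f and c = 1] pt) auto
  moreover have "rev (fold (\<lambda>y s. f x y # s) (l x) []) = map (f x) (l x)" for x
  proof -
    have "fold (\<lambda>y s. f x y # s) l s = rev (map (f x) l) @ s" for l s
      by (induction l arbitrary: s) auto
    then show ?thesis by simp
  qed
  ultimately show ?thesis by simp
qed

lemma pt_concat [pt]: "ptime l \<Longrightarrow> ptime (\<lambda>x. concat (l x))"
  unfolding concat_conv_foldr foldr_conv_fold
  by (rule pt_fold_incr[where H = "\<lambda>x y. y" and c = 1]) (intro pt | assumption | simp add: ds_append_le add.commute)+

lemma filter_conv_fold: "filter P l = rev (fold (\<lambda>y s. if P y then y # s else s) l [])"
proof -
  have "fold (\<lambda>y s. if P y then y # s else s) l s = rev (filter P l) @ s" for s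
    by (induction l arbitrary: s) auto
  then show ?thesis by simp
qed

lemma pt_reorder:
  assumes "ptime (\<lambda>p. f (snd p) (fst p))"
  shows "ptime (\<lambda>p. f (fst (snd p)) (fst p))"
  using pt_comp[OF assms, of "\<lambda>p. (fst p, fst (snd p))"] by (simp add: pt)

lemma pt_filter [pt]:
  assumes "ptime (\<lambda>p. b (snd p) (fst p))" "ptime l"
  shows "ptime (\<lambda>x. filter (b x) (l x))"
  unfolding filter_conv_fold
  by (intro pt_rev pt_fold_incr[where H = "\<lambda>x y. y" and c = 1] pt pt_reorder assms) simp

lemma ball_conv_fold: "(\<forall>y\<in>set l. P y) = fold (\<lambda>y s. s \<and> P y) l True"
proof -
  have "fold (\<lambda>y s. s \<and> P y) l s = (s \<and> (\<forall>y\<in>set l. P y))" for s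
    by (induction l arbitrary: s) auto
  then show ?thesis by simp
qed

lemma pt_ball [pt]:
  assumes "ptime (\<lambda>p. b (snd p) (fst p))" "ptime l"
  shows "ptime (\<lambda>x. \<forall>y\<in>set (l x). b x y)"
  unfolding ball_conv_fold
  by (intro pt_fold_incr[where H = "\<lambda>x y. y" and c = 1] pt pt_reorder assms) simp

lemma pt_bex [pt]:
  assumes "ptime (\<lambda>p. b (snd p) (fst p))" "ptime l"
  shows "ptime (\<lambda>x. \<exists>y\<in>set (l x). b x y)"
  using pt_not[OF pt_ball[OF pt_not[OF assms(1)] assms(2)]] by simp

lemma funpow_conv_fold: "(f ^^ length l) s = fold (\<lambda>_. f) l s"
  by (induction l arbitrary: s) (simp_all add: funpow_Suc_right del: funpow.simps(2))

lemma zip_conv_fold: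
  "zip xs ys = rev (fst (fold (\<lambda>x s. if snd s = [] then s else ((x, hd (snd s)) # fst s, tl (snd s))) xs ([], ys)))"
proof -
  have "fst (fold (\<lambda>x s. if snd s = [] then s else ((x, hd (snd s)) # fst s, tl (snd s))) xs (zs, ys)) =
      rev (zip xs ys) @ zs" for zs
  proof (induction xs arbitrary: zs ys)
    case (Cons x xs)
    then show ?case by (cases ys) auto
  qed simp
  then show ?thesis by simp
qed

lemma ds_hd_tl: "xs \<noteq> [] \<Longrightarrow> ds xs = Suc (ds (hd xs) + ds (tl xs))"
  by (cases xs) auto

lemma ds_prod: "ds p = Suc (ds (fst p) + ds (snd p))"
  by (cases p) auto

lemma pt_zip [pt]:
  assumes "ptime l" "ptime m"
  shows "ptime (\<lambda>x. zip (l x) (m x))"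
  unfolding zip_conv_fold
  by (intro pt_rev pt_fst pt_fold_incr[where H = "\<lambda>x y. y" and c = 1] pt assms) (auto simp: ds_hd_tl ds_prod)

section \<open>Equality tests, membership and removal of duplicates\<close>

class eqdata = data +
  assumes ptm_eq: "ptm (\<lambda>p :: 'a \<times> 'a. Nd (tree_of (fst p)) (tree_of (snd p))) (\<lambda>p. tree_of (fst p = snd p))"

lemma eqdata_iff:
  "ptm (\<lambda>p :: 'a \<times> 'a. Nd (tree_of (fst p)) (tree_of (snd p))) (\<lambda>p. tree_of (fst p = snd p)) \<longleftrightarrow>
    ptime (\<lambda>p :: 'a :: data \<times> 'a. fst p = snd p)"
proof -
  have "tree_of p = Nd (tree_of (fst p)) (tree_of (snd p))" for p :: "'a \<times> 'a"
    by (cases p) simp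
  then show ?thesis unfolding ptime_def by presburger
qed

lemmas pt_eq_class = ptm_eq[unfolded eqdata_iff]

lemma pt_eq [pt]:
  fixes f g :: "'a :: data \<Rightarrow> 'b :: eqdata"
  assumes "ptime f" "ptime g"
  shows "ptime (\<lambda>x. f x = g x)"
  using pt_comp[OF pt_eq_class pt_Pair[OF assms]] by simp

instance bool :: eqdata
  by standard (unfold eqdata_iff, intro pt_bool_eq pt)

instance prod :: (eqdata, eqdata) eqdata
proof (standard, unfold eqdata_iff)
  have "ptime (\<lambda>p :: ('a \<times> 'b) \<times> ('a \<times> 'b). fst (fst p) = fst (snd p) \<and> snd (fst p) = snd (snd p))"
    by (intro pt)
  then show "ptime (\<lambda>p :: ('a \<times> 'b) \<times> ('a \<times> 'b). fst p = snd p)"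
    by (simp add: prod_eq_iff)
qed

lemma list_eq_fold:
  "(xs = ys) = (let r = fold (\<lambda>x s. (fst s \<and> snd s \<noteq> [] \<and> x = hd (snd s), tl (snd s))) xs (True, ys)
     in fst r \<and> snd r = [])"
proof -
  let ?g = "\<lambda>x s. (fst s \<and> snd s \<noteq> [] \<and> x = hd (snd s), tl (snd s))"
  have "(let r = fold ?g xs (b, ys) in fst r \<and> snd r = []) = (b \<and> xs = ys)" for b
  proof (induction xs arbitrary: b ys)
    case (Cons x xs)
    then show ?case by (cases ys) auto
  qed auto
  then show ?thesis by simp
qed

instance list :: (eqdata) eqdata
proof (standard, unfold eqdata_iff)
  have "ptime (\<lambda>p :: 'a list \<times> 'a list.
      let r = fold (\<lambda>x s. (fst s \<and> snd s \<noteq> [] \<and> x = hd (snd s), tl (snd s))) (fst p) (True, snd p)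
      in fst r \<and> snd r = [])"
    unfolding Let_def
    by (intro pt pt_fold_incr[where H = "\<lambda>x y. y" and c = 1]) (auto simp: ds_prod intro: le_SucI trans_le_add1 ds_tl_le)
  then show "ptime (\<lambda>p :: 'a list \<times> 'a list. fst p = snd p)"
    by (simp only: list_eq_fold[symmetric])
qed

lemma pt_mem [pt]:
  fixes f :: "'a :: data \<Rightarrow> 'b :: eqdata"
  assumes "ptime f" "ptime l"
  shows "ptime (\<lambda>x. f x \<in> set (l x))"
proof -
  have "ptime (\<lambda>x. \<exists>y\<in>set (l x). y = f x)"
    using pt_comp[OF assms(1) pt_snd[OF pt_id]] assms(2) by (intro pt)
  then show ?thesis by simp
qed

lemma remdups_conv_fold: "remdups l = fold (\<lambda>x s. if x \<in> set s then s else x # s) (rev l) []"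
proof -
  have "remdups l = foldr (\<lambda>x s. if x \<in> set s then s else x # s) l []"
  proof (induction l)
    case (Cons x l)
    then show ?case by (simp flip: Cons.IH)
  qed simp
  then show ?thesis by (simp flip: foldr_conv_fold)
qed

lemma pt_remdups [pt]:
  fixes l :: "'a :: data \<Rightarrow> 'b :: eqdata list"
  assumes "ptime l"
  shows "ptime (\<lambda>x. remdups (l x))"
  unfolding remdups_conv_fold
  by (intro pt_fold_incr[where H = "\<lambda>x y. y" and c = 1] pt assms) auto

subsection \<open>From programs on trees to functions on words\<close>

text \<open>The raw input has no end mark, so here the branch of \<open>Pop\<close> for the empty
  stack is essential. The loop stays alive through a bit on \<open>AuxB\<close>, renewed for every
  bit found. The word ends up reversed on \<open>AuxA\<close>, ready for a list to be built from its
  last element to its first.\<close>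

definition read_word :: cmd where
  "read_word = Seq (Push AuxB True) (Loop AuxB (Pop Work
    (Seq (Push AuxA True) (Push AuxB True)) (Seq (Push AuxA False) (Push AuxB True)) Skip))"

fun push_word :: "bool list \<Rightarrow> cmd" where
  "push_word [] = Skip"
| "push_word (b # u) = Seq (push_word u) (Push Work b)"

definition build_list :: cmd where
  "build_list = Seq (Push Work False) (Seq (Push AuxB True) (Loop AuxB (Pop AuxA
    (Seq (push_word (True # code (tree_of True))) (Push AuxB True))
    (Seq (push_word (True # code (tree_of False))) (Push AuxB True)) Skip)))"

definition pop_bit :: cmd where
  "pop_bit = Pop Work Skip Skip Skip"

text \<open>The tree of either truth value has a code of five bits, the second of which is the value
  itself: one bit is skipped, one is written, three are skipped.\<close>

definition write_word :: cmd where
  "write_word = Loop Work (Seq pop_bit (Seq (Pop Work (Out True) (Out False) Skip) (Seq pop_bit (Seq pop_bit pop_bit))))"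

lemma run_push_word:
  "run (push_word u) (st w a b c, v) (4 * length u + 1) (st (u @ w) a b c, v)"
proof (induction u)
  case (Cons x u)
  then show ?case
    by (auto intro!: run_Seq[OF Cons run_Push[where n = 2]])
qed (auto intro: run_Skip)

lemma run_read_loop:
  assumes "body = Pop Work (Seq (Push AuxA True) (Push AuxB True)) (Seq (Push AuxA False) (Push AuxB True)) Skip"
  shows "run (Loop AuxB body) (st w a [True] [], v) (10 * length w + 10) (st [] (rev w @ a) [] [], v)"
proof (induction w arbitrary: a)
  case Nil
  have "run (Loop AuxB body) (st [] a [] [], v) 1 (st [] a [] [], v)"
    unfolding run_def using exec.LoopE[of "st [] a [] []" AuxB body v] by auto
  note stop = this
  show ?case
    by (simp, rule run_LoopT[OF _ _ stop, where r = "[]" and n = 2])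
      (auto simp: assms intro!: run_PopE[where n = 1] run_Skip)
next
  case (Cons x w)
  have "run body (st (x # w) a [] [], v) 7 (st w (x # a) [True] [], v)"
  proof (cases x)
    case True
    then show ?thesis unfolding assms
      by (intro run_PopT[where n = 5 and r = w] run_Seq[OF run_Push[OF refl order_refl] run_Push[where n = 2]]) auto
  next
    case False
    then show ?thesis unfolding assms
      by (intro run_PopF[where n = 5 and r = w] run_Seq[OF run_Push[OF refl order_refl] run_Push[where n = 2]]) auto
  qed
  note step = this
  have "run (Loop AuxB body) (st (x # w) a [True] [], v) (10 * length (x # w) + 10) (st [] (rev w @ x # a) [] [], v)"
    by (rule run_LoopT[OF _ _ Cons, where r = "[]" and n = 7]) (use step in simp_all)
  then show ?case by simp
qed

lemma run_build_loop:
  assumes "body = Pop AuxA (Seq (push_word (True # code (tree_of True))) (Push AuxB True))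
    (Seq (push_word (True # code (tree_of False))) (Push AuxB True)) Skip"
  shows "run (Loop AuxB body) (st (code (tree_of u)) (rev w) [True] [], v) (40 * length w + 10)
    (st (code (tree_of (w @ u))) [] [] [], v)"
proof (induction w arbitrary: u rule: rev_induct)
  case Nil
  have "run (Loop AuxB body) (st (code (tree_of u)) [] [] [], v) 1 (st (code (tree_of u)) [] [] [], v)"
    unfolding run_def using exec.LoopE[of "st (code (tree_of u)) [] [] []" AuxB body v] by auto
  note stop = this
  show ?case
    by (simp, rule run_LoopT[OF _ _ stop, where r = "[]" and n = 2])
      (auto simp: assms intro!: run_PopE[where n = 1] run_Skip)
next
  case (snoc x w)
  have push: "run (Seq (push_word (True # code (tree_of x))) (Push AuxB True))
      (st (code (tree_of u)) (rev w) [] [], v) 30 (st (code (tree_of (x # u))) (rev w) [True] [], v)"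
    by (rule run_Seq[OF run_push_word run_Push[where n = 2]]) (auto simp: tree_of_bool_def)
  have "run body (st (code (tree_of u)) (x # rev w) [] [], v) 31 (st (code (tree_of (x # u))) (rev w) [True] [], v)"
  proof (cases x)
    case True
    then show ?thesis unfolding assms using push
      by (intro run_PopT[where n = 30 and r = "rev w"]) auto
  next
    case False
    then show ?thesis unfolding assms using push
      by (intro run_PopF[where n = 30 and r = "rev w"]) auto
  qed
  note step = this
  have "run (Loop AuxB body) (st (code (tree_of u)) (rev (w @ [x])) [True] [], v) (40 * length (w @ [x]) + 10)
      (st (code (tree_of (w @ x # u))) [] [] [], v)"
    by (rule run_LoopT[OF _ _ snoc, where r = "[]" and n = 31]) (use step in simp_all)
  then show ?case by simp
qed


lemma run_pop_bit: "run pop_bit (st (x # w) a b c, v) 2 (st w a b c, v)"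
  unfolding pop_bit_def
  using run_PopT[OF _ run_Skip[OF order_refl], of "st (x # w) a b c" Work w]
    run_PopF[OF _ run_Skip[OF order_refl], of "st (x # w) a b c" Work w]
  by (cases x) simp_all

lemma run_write_loop:
  assumes "body = Seq pop_bit (Seq (Pop Work (Out True) (Out False) Skip) (Seq pop_bit (Seq pop_bit pop_bit)))"
  shows "run (Loop Work body) (st (code (tree_of u)) a b c, v) (20 * length u + 1) (st [] a b c, v @ u)"
proof (induction u arbitrary: v)
  case Nil
  then show ?case by (auto intro!: run_LoopF)
next
  case (Cons x u)
  let ?w = "code (tree_of u)"
  obtain y z z' where xs: "code (tree_of x) = [True, x, y, z, z']"
    by (cases x) (auto simp: tree_of_bool_def)
  have out: "run (Pop Work (Out True) (Out False) Skip) (st (x # w) a b c, v) 2 (st w a b c, v @ [x])" for w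
  proof (cases x)
    case True
    then show ?thesis by (intro run_PopT[where n = 1 and r = w]) (auto intro: run_Out)
  next
    case False
    then show ?thesis by (intro run_PopF[where n = 1 and r = w]) (auto intro: run_Out)
  qed
  have step: "run body (st (code (tree_of x) @ ?w) a b c, v) 14 (st ?w a b c, v @ [x])"
    unfolding assms xs append.simps
    by (rule run_Seq[OF run_pop_bit run_Seq[OF out run_Seq[OF run_pop_bit run_Seq[OF run_pop_bit run_pop_bit order_refl] order_refl] order_refl]]) simp
  have "run (Loop Work body) (st (code (tree_of (x # u))) a b c, v) (20 * length (x # u) + 1) (st [] a b c, (v @ [x]) @ u)"
    by (rule run_LoopT[OF _ _ Cons, where r = "code (tree_of x) @ ?w" and n = 14]) (use step in simp_all)
  then show ?case by simp
qed

theorem ptime_polytime_computable: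
  fixes f :: "bool list \<Rightarrow> bool list"
  assumes "ptime f"
  shows "polytime_computable f"
proof -
  obtain c k where "computes c k tree_of (\<lambda>w. tree_of (f w))"
    using assms unfolding ptime_def by (rule ptmE)
  note c = computesD[OF this]
  have sz_bits: "sz (tree_of w) = 6 * length w + 1" for w :: "bool list"
    by (induction w) (auto simp: tree_of_bool_def)
  \<comment> \<open>The linear part pays for reading the word and building its tree. The tree of
    \<open>n\<close> bits has size \<open>6 * n + 1\<close>, so the main program takes
    \<open>(6 * n + 3) ^ k\<close> steps, and writing its result takes at most 20 times as
    many.\<close>
  let ?p = "[:60, 50:] + [:3, 6:] ^ k * 30 :: nat poly"
  let ?c = "Seq read_word (Seq build_list (Seq c write_word))"
  show ?thesis
  proof (rule exec_polytime)
    fix w :: "bool list"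
    let ?n = "length w" and ?s = "st [] [] [] []"
    have "clear_store w = (st w [] [] [], [])"
      unfolding clear_store_def by (auto simp: fun_eq_iff elim: st.elims) (metis st.simps stack.exhaust)
    have read: "run read_word (st w [] [] [], []) (10 * ?n + 13) (st [] (rev w) [] [], [])"
      unfolding read_word_def
      by (rule run_Seq[OF run_Push[where n = 2] run_read_loop[OF refl, of w "[]", simplified append_Nil2]]) auto
    have build: "run build_list (st [] (rev w) [] [], []) (40 * ?n + 16) (st (code (tree_of w)) [] [] [], [])"
      unfolding build_list_def
      by (rule run_Seq[OF run_Push[where n = 2] run_Seq[OF run_Push[where n = 2] run_build_loop[OF refl, of "[]" w, simplified append_Nil2]]]) auto
    have main: "run c (st (code (tree_of w)) [] [] [], []) ((6 * ?n + 3) ^ k) (st (code (tree_of (f w))) [] [] [], [])"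
      using c(1)[of w "[]" "[]" "[]" "[]" "[]"] by (simp add: sz_bits numeral_3_eq_3)
    have "6 * length (f w) + 1 \<le> (6 * ?n + 3) ^ k"
      using c(2)[of w] by (simp add: sz_bits numeral_3_eq_3)
    then have "20 * length (f w) + 1 \<le> 20 * (6 * ?n + 3) ^ k"
      by linarith
    then have wr: "run write_word (st (code (tree_of (f w))) [] [] [], []) (20 * (6 * ?n + 3) ^ k) (?s, f w)"
      unfolding write_word_def using run_mono[OF run_write_loop[OF refl, of "f w" "[]" "[]" "[]" "[]"]] by simp
    have "run ?c (st w [] [] [], []) (poly ?p ?n) (?s, f w)"
      by (rule run_Seq[OF read run_Seq[OF build run_Seq[OF main wr order_refl] order_refl]])
        (simp add: algebra_simps)
    then show "\<exists>t\<le>poly ?p ?n. \<exists>\<sigma>. exec ?c (clear_store w) t (\<sigma>, f w)"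
      unfolding run_def \<open>clear_store w = _\<close> by blast
  qed
qed

section \<open>Reading and writing instances\<close>

lemma pt_tree_of [pt]: "ptime f \<Longrightarrow> ptime (\<lambda>x. tree_of (f x))"
  unfolding ptime_def by (simp add: tree_of_tree_def)

text \<open>Along its right spine every tree is the tree of exactly one list of trees. Hence the
  parser may return an untyped tree, and decoding it is a total operation.\<close>

fun kids :: "tree \<Rightarrow> tree list" where
  "kids Lf = []"
| "kids (Nd x y) = x # kids y"

lemma tree_of_kids [simp]: "tree_of (kids t) = t"
  by (induction t) (auto simp: tree_of_tree_def)

lemma kids_tree_of [simp]: "kids (tree_of xs) = xs"
  by (induction xs) (auto simp: tree_of_tree_def)

lemma kids_tree_of_list: "kids (tree_of xs) = map tree_of xs"
  by (induction xs) auto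

text \<open>A list of trees is encoded by the tree from which \<open>kids\<close> produces it, so on
  encodings \<open>kids\<close> is the identity.\<close>

lemma pt_kids [pt]: "ptime f \<Longrightarrow> ptime (\<lambda>x. kids (f x))"
  unfolding ptime_def by (simp add: tree_of_tree_def)

text \<open>Words are read from the end, so that a closing bracket opens a new frame on the stack of
  unfinished bracket expressions.\<close>

definition token :: "bool \<Rightarrow> bool \<Rightarrow> tree list list \<Rightarrow> tree list list" where
  "token a b fs =
    (if a then if b then [] # fs else (tree_of (hd fs) # hd (tl fs)) # tl (tl fs)
     else (tree_of b # hd fs) # tl fs)"

definition parse_step :: "bool \<Rightarrow> bool list \<times> tree list list \<Rightarrow> bool list \<times> tree list list" where
  "parse_step a s = (if fst s = [] then ([a], snd s) else ([], token a (hd (fst s)) (snd s)))"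

definition parse :: "bool list \<Rightarrow> tree" where
  "parse w = hd (hd (snd (fold parse_step (rev w) ([], [[]]))))"

lemma ds_token: "ds (token a b fs) \<le> ds fs + 10 + 2 * ds (hd [] :: tree list)"
proof (cases fs)
  case (Cons f gs)
  then show ?thesis
    by (cases gs) (auto simp: token_def ds_def tree_of_tree_def tree_of_bool_def)
qed (auto simp: token_def ds_def tree_of_tree_def tree_of_bool_def)

lemma pt_parse [pt]: "ptime f \<Longrightarrow> ptime (\<lambda>x. parse (f x))"
proof -
  have "ptime parse"
    unfolding parse_def
  proof (intro pt pt_fold_incr[where H = "\<lambda>x y. y" and c = "20 + 2 * ds (hd [] :: tree list)"])
    show "ptime (\<lambda>p :: bool \<times> bool list \<times> bool list \<times> tree list list. parse_step (fst p) (snd (snd p)))"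
      unfolding parse_step_def token_def by (intro pt)
    show "ds (parse_step y s) \<le> ds s + ds y + (20 + 2 * ds (hd [] :: tree list))" for y s
      using ds_token[of y "hd (fst s)" "snd s"] by (cases s) (auto simp: parse_step_def)
  qed
  then show "ptime f \<Longrightarrow> ptime (\<lambda>x. parse (f x))" by (rule pt_comp)
qed

text \<open>The invariant that makes the parser compositional: read from the right, \<open>u\<close>
  puts \<open>ts\<close> in front of the current frame, leaves the outer frames alone and ends at a
  letter boundary.\<close>

definition reads :: "bool list \<Rightarrow> tree list \<Rightarrow> bool" where
  "reads u ts \<longleftrightarrow> (\<forall>f fs. foldr parse_step u ([], f # fs) = ([], (ts @ f) # fs))"

lemma reads_Nil: "reads [] []"
  by (simp add: reads_def)

lemma reads_append: "reads u ts \<Longrightarrow> reads w ss \<Longrightarrow> reads (u @ w) (ts @ ss)"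
  by (simp add: reads_def)

lemma reads_enc_bit: "reads (enc_bit b) [tree_of b]"
  by (simp add: reads_def enc_bit_def parse_step_def token_def)

lemma reads_bracket: "reads u ts \<Longrightarrow> reads (bracket u) [tree_of ts]"
  by (simp add: reads_def bracket_def parse_step_def token_def)

lemma reads_concat: "(\<And>x. x \<in> set xs \<Longrightarrow> reads (e x) [g x]) \<Longrightarrow> reads (concat (map e xs)) (map g xs)"
  by (induction xs) (auto intro: reads_Nil reads_append[of _ "[_]", simplified])

lemma tree_of_map: "tree_of (map tree_of xs) = tree_of xs"
  by (induction xs) (auto simp: tree_of_tree_def)

lemma reads_enc_bits: "reads (enc_bits bs) [tree_of bs]"
  unfolding enc_bits_def
  using reads_bracket[OF reads_concat[of bs enc_bit tree_of]] by (simp add: reads_enc_bit tree_of_map)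

lemma reads_enc_list:
  "(\<And>x. x \<in> set xs \<Longrightarrow> reads (e x) [tree_of (g x)]) \<Longrightarrow> reads (enc_list e xs) [tree_of (map g xs)]"
  unfolding enc_list_def
  using reads_bracket[OF reads_concat[of xs e "\<lambda>x. tree_of (g x)"]]
  by (simp add: tree_of_map[of "map g xs", unfolded map_map o_def])

lemma parse_reads: "reads u [t] \<Longrightarrow> parse u = t"
  by (simp add: reads_def parse_def foldr_conv_fold)

text \<open>The parser is a function, so a word is read as one tree only. Injectivity of the
  encodings of literals, literal lists and graphs is derived from this.\<close>

lemma reads_unique: "reads u [t] \<Longrightarrow> reads u [s] \<Longrightarrow> t = s"
  using parse_reads by blast

lemma tree_of_bool_inj [simp]: "tree_of (a :: bool) = tree_of b \<longleftrightarrow> a = b"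
  by (auto simp: tree_of_bool_def)

lemma tree_of_bits_inj [simp]: "tree_of (a :: bool list) = tree_of b \<longleftrightarrow> a = b"
proof (induction a arbitrary: b)
  case Nil
  show ?case by (cases b) auto
next
  case (Cons x a)
  then show ?case by (cases b) auto
qed

lemma tree_of_trees_inj [simp]: "tree_of (a :: tree list) = tree_of b \<longleftrightarrow> a = b"
proof
  assume eq: "tree_of a = tree_of b"
  have "kids (tree_of a) = kids (tree_of b)"
    by (simp only: eq)
  then show "a = b" by (simp only: kids_tree_of)
qed simp

section \<open>Instances with digit words in place of numbers\<close>

type_synonym name = "bool \<times> bool list"

text \<open>The reduction never calculates with numbers: a variable is known by its digits alone,
  and the tag keeps it apart from the constants.\<close>

fun bin_arg :: "nat arg \<Rightarrow> name" where
  "bin_arg (Var x) = (False, binary x)"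
| "bin_arg (Const b) = (True, [b])"

definition truth_table :: "constraint \<Rightarrow> bool list" where
  "truth_table C = map (holds C) (List.n_lists (arity C) [False, True])"

definition bin_app :: "nat application \<Rightarrow> bool list \<times> name list" where
  "bin_app = (\<lambda>(C, as). (truth_table C, map bin_arg as))"

type_synonym bin_inst = "bool list list \<times> (bool list \<times> name list) list \<times> (bool list \<times> name list) list"

definition enc_name :: "name \<Rightarrow> bool list" where
  "enc_name a = (if fst a then enc_bit (hd (snd a)) else enc_bits (snd a))"

definition enc_bin_app :: "bool list \<times> name list \<Rightarrow> bool list" where
  "enc_bin_app A = bracket (enc_bits (fst A) @ enc_list enc_name (snd A))"

definition enc_inst :: "bin_inst \<Rightarrow> bool list" where
  "enc_inst I = bracket (enc_list enc_bits (fst I) @ enc_list enc_bin_app (fst (snd I)) @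
     enc_list enc_bin_app (snd (snd I)))"

definition dec_bit :: "tree \<Rightarrow> bool" where
  "dec_bit t = (car t \<noteq> Lf)"

definition dec_bits :: "tree \<Rightarrow> bool list" where
  "dec_bits t = map dec_bit (kids t)"

text \<open>Arguments are encoded without a tag, so bits and words of bits are told apart by shape.
  The first child of a bit is a leaf or a node with two leaves; that of a nonempty word is itself
  the tree of a bit, which is neither.\<close>

definition is_bit :: "tree \<Rightarrow> bool" where
  "is_bit t \<longleftrightarrow> t \<noteq> Lf \<and> (car t = Lf \<or> car (car t) = Lf \<and> cdr (car t) = Lf)"

definition dec_name :: "tree \<Rightarrow> name" where
  "dec_name t = (if is_bit t then (True, [dec_bit t]) else (False, dec_bits t))"

definition dec_app :: "tree \<Rightarrow> bool list \<times> name list" where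
  "dec_app t = (dec_bits (car t), map dec_name (kids (car (cdr t))))"

definition dec_inst :: "tree \<Rightarrow> bin_inst" where
  "dec_inst t = (map dec_bits (kids (car t)), map dec_app (kids (car (cdr t))), map dec_app (kids (car (cdr (cdr t)))))"

lemma dec_bit_tree_of [simp]: "dec_bit (tree_of b) = b"
  by (simp add: dec_bit_def tree_of_bool_def)

lemma dec_bits_tree_of [simp]: "dec_bits (tree_of bs) = bs"
  by (simp add: dec_bits_def kids_tree_of_list o_def)

definition name_tree :: "name \<Rightarrow> tree" where
  "name_tree a = (if fst a then tree_of (hd (snd a)) else tree_of (snd a))"

lemma dec_name_tree: "dec_name (name_tree (bin_arg a)) = bin_arg a"
proof (cases a)
  case (Var x)
  have "\<not> is_bit (tree_of bs)" for bs :: "bool list"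
    by (cases bs) (auto simp: is_bit_def tree_of_bool_def)
  then show ?thesis by (simp add: Var dec_name_def name_tree_def)
next
  case (Const b)
  have "is_bit (tree_of b)"
    by (auto simp: is_bit_def tree_of_bool_def)
  then show ?thesis by (simp add: Const dec_name_def name_tree_def)
qed

lemma reads_enc_name: "reads (enc_name a) [name_tree a]"
  by (simp add: enc_name_def name_tree_def reads_enc_bit reads_enc_bits)

lemma tree_of_tree_id [simp]: "tree_of (t :: tree) = t"
  by (simp add: tree_of_tree_def)

definition app_tree :: "bool list \<times> name list \<Rightarrow> tree" where
  "app_tree A = tree_of [tree_of (fst A), tree_of (map name_tree (snd A))]"

lemma reads_enc_bin_app: "reads (enc_bin_app A) [app_tree A]"
proof -
  have "reads (enc_list enc_name (snd A)) [tree_of (map name_tree (snd A))]"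
    by (rule reads_enc_list) (simp add: reads_enc_name)
  from reads_bracket[OF reads_append[OF reads_enc_bits this]] show ?thesis
    by (simp add: enc_bin_app_def app_tree_def)
qed

lemma dec_app_tree: "dec_app (app_tree (bin_app A)) = bin_app A"
  by (cases A) (simp add: dec_app_def app_tree_def bin_app_def dec_name_tree o_def)

lemma dec_parse_inst:
  "dec_inst (parse (enc_inst (X, map bin_app ss, map bin_app us))) = (X, map bin_app ss, map bin_app us)"
proof -
  have app: "reads (enc_list enc_bin_app As) [tree_of (map app_tree As)]" for As
    by (rule reads_enc_list) (simp add: reads_enc_bin_app)
  have "reads (enc_list enc_bits X) [tree_of (map tree_of X :: tree list)]"
    by (rule reads_enc_list) (simp add: reads_enc_bits)
  from reads_bracket[OF reads_append[OF this reads_append[OF app[of "map bin_app ss"] app[of "map bin_app us"]]]]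
  have "parse (enc_inst (X, map bin_app ss, map bin_app us)) =
      tree_of [tree_of (map tree_of X), tree_of (map app_tree (map bin_app ss)), tree_of (map app_tree (map bin_app us))]"
    unfolding enc_inst_def by (intro parse_reads) simp
  then show ?thesis
    by (simp add: dec_inst_def dec_app_tree o_def)
qed

lemma enc_application_bin: "enc_application A = enc_bin_app (bin_app A)"
proof -
  have "enc_arg a = enc_name (bin_arg a)" for a
    by (cases a) (auto simp: enc_name_def enc_nat_def)
  then have "enc_arg = (\<lambda>a. enc_name (bin_arg a))"
    by auto
  then show ?thesis
    by (cases A) (simp add: enc_application_def enc_bin_app_def bin_app_def enc_constraint_def truth_table_def
        enc_list_def o_def)
qed

lemma enc_inst_bin:
  "bracket (enc_list enc_nat xs @ enc_list enc_application ss @ enc_list enc_application us) =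
    enc_inst (map binary xs, map bin_app ss, map bin_app us)"
  by (simp add: enc_inst_def enc_list_def o_def enc_application_bin[abs_def] enc_nat_def[abs_def])

lemma pt_bracket [pt]: "ptime f \<Longrightarrow> ptime (\<lambda>x. bracket (f x))"
  unfolding bracket_def by (intro pt)

lemma pt_enc_bit [pt]: "ptime f \<Longrightarrow> ptime (\<lambda>x. enc_bit (f x))"
  unfolding enc_bit_def by (intro pt)

lemma pt_enc_bits [pt]: "ptime f \<Longrightarrow> ptime (\<lambda>x. enc_bits (f x))"
  unfolding enc_bits_def by (intro pt | assumption)+

lemma pt_enc_list [pt]:
  assumes "ptime (\<lambda>p. e (snd p) (fst p))" "ptime l"
  shows "ptime (\<lambda>x. enc_list (e x) (l x))"
  unfolding enc_list_def by (intro pt assms)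

lemma pt_enc_inst [pt]: "ptime f \<Longrightarrow> ptime (\<lambda>x. enc_inst (f x))"
  unfolding enc_inst_def enc_bin_app_def enc_name_def by (intro pt | assumption)+

lemma pt_dec_inst [pt]: "ptime f \<Longrightarrow> ptime (\<lambda>x. dec_inst (f x))"
  unfolding dec_inst_def dec_app_def dec_name_def dec_bits_def dec_bit_def is_bit_def by (intro pt | assumption)+

section \<open>Satisfiability of Schaefer formulas\<close>

text \<open>A literal is a variable with its sign. The predicate \<open>tr\<close> says which truth values of the literals
  make a clause true: at least one true value for CNF, an odd number of true values for XOR-clauses.
  The predicate \<open>kc\<close> is the syntactic restriction, which depends on the signs only.\<close>

definition models :: "(bool list \<Rightarrow> bool) \<Rightarrow> ('v \<times> bool) list list \<Rightarrow> ('v \<Rightarrow> bool) \<Rightarrow> bool" where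
  "models tr F \<beta> \<longleftrightarrow> (\<forall>c\<in>set F. tr (map (\<lambda>l. \<beta> (fst l) = snd l) c))"

definition decides ::
    "(bool list \<Rightarrow> bool) \<Rightarrow> (bool list \<Rightarrow> bool) \<Rightarrow> (('v \<times> bool) list list \<Rightarrow> bool) \<Rightarrow> bool" where
  "decides tr kc D \<longleftrightarrow> (\<forall>F. (\<forall>c\<in>set F. kc (map snd c)) \<longrightarrow> D F = (\<exists>\<beta>. models tr F \<beta>))"

definition neg :: "'v \<times> bool \<Rightarrow> 'v \<times> bool" where
  "neg l = (fst l, \<not> snd l)"

lemma neg_simps [simp]: "neg (neg l) = l" "fst (neg l) = fst l" "snd (neg l) = (\<not> snd l)"
  by (auto simp: neg_def)

subsection \<open>Unit propagation\<close>

text \<open>Filtering the fixed list \<open>Ls\<close> instead of extending \<open>M\<close> keeps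
  the iterated value small. Nothing is lost with \<open>Ls = concat F\<close>, as derived literals
  occur in clauses. Repeated literals count once, so a clause listing the same literal twice still
  acts as a unit.\<close>

definition up_step :: "('v \<times> bool) list list \<Rightarrow> ('v \<times> bool) list \<Rightarrow> ('v \<times> bool) list \<Rightarrow> ('v \<times> bool) list" where
  "up_step F Ls M = filter (\<lambda>l. l \<in> set M \<or>
     (\<exists>c\<in>set F. l \<in> set c \<and> (\<forall>l'\<in>set c. l' = l \<or> neg l' \<in> set M))) Ls"

definition up :: "('v \<times> bool) list list \<Rightarrow> ('v \<times> bool) list" where
  "up F = fold (\<lambda>_. up_step F (concat F)) (concat F) []"

definition no_conflict :: "('v \<times> bool) list list \<Rightarrow> bool" where
  "no_conflict F \<longleftrightarrow> (\<forall>c\<in>set F. \<exists>l\<in>set c. neg l \<notin> set (up F))"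

text \<open>One test for all three classes of CNF: absence of a conflict settles the Horn and
  anti-Horn cases, and the look-ahead is what 2CNF requires. Every satisfiable formula passes both
  parts.\<close>

definition cnf_check :: "('v \<times> bool) list list \<Rightarrow> bool" where
  "cnf_check F \<longleftrightarrow> no_conflict F \<and> (\<forall>l\<in>set (concat F). no_conflict ([l] # F) \<or> no_conflict ([neg l] # F))"

definition derive1 :: "('v \<times> bool) list list \<Rightarrow> ('v \<times> bool) set \<Rightarrow> ('v \<times> bool) set" where
  "derive1 F M = M \<inter> set (concat F) \<union> {l. \<exists>c\<in>set F. l \<in> set c \<and> (\<forall>l'\<in>set c. l' = l \<or> neg l' \<in> M)}"

text \<open>The iterates form an increasing chain, and each step before stabilization adds an
  element of \<open>S\<close>; so at most \<open>card S\<close> steps are possible.\<close>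

lemma funpow_fixpoint:
  fixes f :: "'a set \<Rightarrow> 'a set"
  assumes "mono f" "\<And>X. f X \<subseteq> S" "finite S" "card S \<le> n"
  shows "f ((f ^^ n) {}) = (f ^^ n) {}"
proof -
  have inc: "(f ^^ m) {} \<subseteq> f ((f ^^ m) {})" for m
    by (induction m) (use assms(1) in \<open>auto simp: mono_def\<close>)
  have "f ((f ^^ m) {}) = (f ^^ m) {} \<or> m < card (f ((f ^^ m) {}))" for m
  proof (induction m)
    case 0
    show ?case
      using finite_subset[OF assms(2,3)] by (auto simp: card_gt_0_iff)
  next
    case (Suc m)
    show ?case
    proof (cases "f ((f ^^ Suc m) {}) = (f ^^ Suc m) {}")
      case False
      then have "(f ^^ Suc m) {} \<subset> f ((f ^^ Suc m) {})"
        using inc[of "Suc m"] by blast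
      then have "card ((f ^^ Suc m) {}) < card (f ((f ^^ Suc m) {}))"
        by (rule psubset_card_mono[OF finite_subset[OF assms(2,3)]])
      moreover have "m < card ((f ^^ Suc m) {})"
      proof (rule ccontr)
        assume "\<not> m < card ((f ^^ Suc m) {})"
        then have eq: "f ((f ^^ m) {}) = (f ^^ m) {}" using Suc by simp
        then have "(f ^^ Suc m) {} = (f ^^ m) {}" by simp
        then show False using eq False by simp
      qed
      ultimately show ?thesis by simp
    qed simp
  qed
  moreover have "card (f ((f ^^ n) {})) \<le> n"
    using card_mono[OF assms(3,2)] assms(4) by (rule order_trans)
  ultimately show ?thesis
    by (meson leD)
qed

lemma mono_derive1: "mono (derive1 F)"
  unfolding mono_def derive1_def by blast

lemma set_up_step: "set (up_step F (concat F) M) = derive1 F (set M)"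
  by (auto simp: up_step_def derive1_def)

lemma set_up: "set (up F) = (derive1 F ^^ length (concat F)) {}"
proof -
  have "set ((up_step F (concat F) ^^ n) []) = (derive1 F ^^ n) {}" for n
    by (induction n) (auto simp: set_up_step)
  then show ?thesis
    unfolding up_def funpow_conv_fold[symmetric] .
qed

lemma derive1_up: "derive1 F (set (up F)) = set (up F)"
  unfolding set_up
  by (rule funpow_fixpoint[OF mono_derive1, where S = "set (concat F)"])
    (simp_all only: card_length finite_set, auto simp: derive1_def)

lemma up_closed:
  "c \<in> set F \<Longrightarrow> l \<in> set c \<Longrightarrow> (\<And>l'. l' \<in> set c \<Longrightarrow> l' \<noteq> l \<Longrightarrow> neg l' \<in> set (up F)) \<Longrightarrow> l \<in> set (up F)"
  using derive1_up[of F] unfolding derive1_def by blast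

text \<open>Each derived literal comes from a clause whose other literals were refuted earlier. The
  hypothesis keeps their membership in \<open>up F\<close>, which the consistency argument
  uses.\<close>

lemma up_induct [consumes 1, case_names unit]:
  assumes "l \<in> set (up F)"
    and step: "\<And>c l. c \<in> set F \<Longrightarrow> l \<in> set c \<Longrightarrow>
      (\<And>l'. l' \<in> set c \<Longrightarrow> l' \<noteq> l \<Longrightarrow> neg l' \<in> set (up F) \<and> Q (neg l')) \<Longrightarrow> Q l"
  shows "Q l"
proof -
  have sub: "(derive1 F ^^ n) {} \<subseteq> {l \<in> set (up F). Q l}" for n
  proof (induction n)
    case (Suc n)
    have "derive1 F {l \<in> set (up F). Q l} \<subseteq> derive1 F (set (up F))"
      using mono_derive1 by (rule monoD) auto
    then have 1: "derive1 F {l \<in> set (up F). Q l} \<subseteq> set (up F)"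
      by (simp only: derive1_up)
    have "derive1 F {l \<in> set (up F). Q l} \<subseteq> {l. Q l}"
    proof
      fix l assume "l \<in> derive1 F {l \<in> set (up F). Q l}"
      then consider "Q l" | c where "c \<in> set F" "l \<in> set c"
          "\<forall>l'\<in>set c. l' = l \<or> neg l' \<in> {l \<in> set (up F). Q l}"
        unfolding derive1_def by blast
      then show "l \<in> {l. Q l}"
      proof cases
        case 2
        then show ?thesis using step[of c l] by blast
      qed simp
    qed
    then have "derive1 F {l \<in> set (up F). Q l} \<subseteq> {l \<in> set (up F). Q l}"
      using 1 by blast
    then show ?case
      using monoD[OF mono_derive1 Suc, of F] by simp
  qed simp
  show ?thesis
    using assms(1) sub[of "length (concat F)"] unfolding set_up by blast
qed

definition some_true :: "bool list \<Rightarrow> bool" where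
  "some_true bs \<longleftrightarrow> True \<in> set bs"

lemma models_some_true: "models some_true F \<beta> \<longleftrightarrow> (\<forall>c\<in>set F. \<exists>l\<in>set c. \<beta> (fst l) = snd l)"
  unfolding models_def some_true_def by auto

lemma up_sound:
  assumes "models some_true F \<beta>" "l \<in> set (up F)"
  shows "\<beta> (fst l) = snd l"
  using assms(2)
proof (induction rule: up_induct)
  case (unit c l)
  obtain l' where "l' \<in> set c" "\<beta> (fst l') = snd l'"
    using assms(1) unit(1) unfolding models_some_true by blast
  then show ?case using unit(3)[of l'] by (cases "l' = l") auto
qed

lemma models_no_conflict:
  assumes "models some_true F \<beta>"
  shows "no_conflict F"
  unfolding no_conflict_def
proof
  fix c assume "c \<in> set F"
  then obtain l where "l \<in> set c" "\<beta> (fst l) = snd l"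
    using assms unfolding models_some_true by blast
  moreover from this have "neg l \<notin> set (up F)"
    using up_sound[OF assms, of "neg l"] by auto
  ultimately show "\<exists>l\<in>set c. neg l \<notin> set (up F)" by blast
qed

lemma models_cnf_check:
  assumes "models some_true F \<beta>"
  shows "cnf_check F"
proof -
  have "no_conflict ([l] # F) \<or> no_conflict ([neg l] # F)" for l
  proof (cases "\<beta> (fst l) = snd l")
    case True
    then have "models some_true ([l] # F) \<beta>" using assms by (simp add: models_some_true)
    then show ?thesis using models_no_conflict by blast
  next
    case False
    then have "models some_true ([neg l] # F) \<beta>" using assms by (simp add: models_some_true)
    then show ?thesis using models_no_conflict by blast
  qed
  then show ?thesis
    using models_no_conflict[OF assms] unfolding cnf_check_def by blast
qed

text \<open>Had both \<open>l\<close> and its opposite been derived, the clause that produced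
  \<open>l\<close> would have all its literals refuted.\<close>

lemma up_consistent:
  assumes "no_conflict F" "l \<in> set (up F)"
  shows "neg l \<notin> set (up F)"
  using assms(2)
proof (induction rule: up_induct)
  case (unit c l)
  show ?case
  proof
    assume "neg l \<in> set (up F)"
    then have "\<forall>l'\<in>set c. neg l' \<in> set (up F)"
      using unit(3) by blast
    then show False
      using assms(1) unit(1) unfolding no_conflict_def by blast
  qed
qed

text \<open>After propagation a clause that is not yet true has two open literals: one because it is
  no conflict, a second because it is no unit. One of the two has sign \<open>d\<close>, so the
  value \<open>d\<close> for all open variables makes the clause true. Horn formulas have
  \<open>d = False\<close>, anti-Horn formulas \<open>d = True\<close>.\<close>

lemma no_conflict_models:
  assumes "no_conflict F"
    and signs: "\<And>c l l'. c \<in> set F \<Longrightarrow> l \<in> set c \<Longrightarrow> l' \<in> set c \<Longrightarrow> l \<noteq> l' \<Longrightarrow> snd l = d \<or> snd l' = d"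
  shows "\<exists>\<beta>. models some_true F \<beta>"
proof -
  let ?M = "set (up F)"
  define \<beta> where "\<beta> x = (if (x, d) \<in> ?M then d else if (x, \<not> d) \<in> ?M then \<not> d else d)" for x
  have in_M: "\<beta> (fst l) = snd l" if "l \<in> ?M" for l
  proof -
    have "(fst l, \<not> snd l) \<notin> ?M" "(fst l, snd l) \<in> ?M"
      using up_consistent[OF assms(1) that] that by (auto simp: neg_def)
    then show ?thesis by (cases l; cases "snd l = d") (auto simp: \<beta>_def)
  qed
  have unassigned: "\<beta> (fst l) = d" if "neg l \<notin> ?M" "l \<notin> ?M" for l
    using that by (cases l; cases "snd l = d") (auto simp: \<beta>_def neg_def)
  have "\<exists>l\<in>set c. \<beta> (fst l) = snd l" if c: "c \<in> set F" for c
  proof -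
    obtain l where l: "l \<in> set c" "neg l \<notin> ?M"
      using assms(1) c unfolding no_conflict_def by blast
    show ?thesis
    proof (cases "\<exists>l\<in>set c. l \<in> ?M")
      case True
      then show ?thesis using in_M by blast
    next
      case False
      then obtain l' where l': "l' \<in> set c" "l' \<noteq> l" "neg l' \<notin> ?M"
        using up_closed[OF c l(1)] l(1) by blast
      have "\<beta> (fst l) = d" "\<beta> (fst l') = d"
        using unassigned False l l' by blast+
      then show ?thesis
        using signs[OF c l(1) l'(1)] l' l(1) by metis
    qed
  qed
  then show ?thesis unfolding models_some_true by blast
qed

lemma two_le_length_filter:
  assumes "x \<in> set xs" "y \<in> set xs" "x \<noteq> y" "Q x" "Q y"
  shows "2 \<le> length (filter Q xs)"
proof -
  have "card {x, y} \<le> card (set (filter Q xs))"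
    by (rule card_mono) (use assms in auto)
  then show ?thesis using card_length[of "filter Q xs"] assms(3) by simp
qed

lemma decides_cnf:
  assumes "\<And>F :: ('v \<times> bool) list list. (\<forall>c\<in>set F. kc (map snd c)) \<Longrightarrow> cnf_check F \<Longrightarrow> \<exists>\<beta>. models some_true F \<beta>"
  shows "decides some_true kc (cnf_check :: ('v \<times> bool) list list \<Rightarrow> bool)"
  unfolding decides_def using assms models_cnf_check by blast

lemma decides_horn: "decides some_true (\<lambda>bs. length (filter id bs) \<le> 1)
    (cnf_check :: ('v \<times> bool) list list \<Rightarrow> bool)"
proof (rule decides_cnf)
  fix F :: "('v \<times> bool) list list"
  assume "\<forall>c\<in>set F. length (filter id (map snd c)) \<le> 1" and check: "cnf_check F"
  then have kc: "length (filter snd c) \<le> 1" if "c \<in> set F" for c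
    using that by (simp add: filter_map o_def)
  have "snd l = False \<or> snd l' = False" if "c \<in> set F" "l \<in> set c" "l' \<in> set c" "l \<noteq> l'" for c l l'
    using two_le_length_filter[of l c l' snd] kc that by fastforce
  then show "\<exists>\<beta>. models some_true F \<beta>"
    using check no_conflict_models[of F False] unfolding cnf_check_def by blast
qed

lemma decides_anti_horn: "decides some_true (\<lambda>bs. length (filter Not bs) \<le> 1)
    (cnf_check :: ('v \<times> bool) list list \<Rightarrow> bool)"
proof (rule decides_cnf)
  fix F :: "('v \<times> bool) list list"
  assume "\<forall>c\<in>set F. length (filter Not (map snd c)) \<le> 1" and check: "cnf_check F"
  then have kc: "length (filter (\<lambda>l. \<not> snd l) c) \<le> 1" if "c \<in> set F" for c
    using that by (simp add: filter_map o_def)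
  have "snd l = True \<or> snd l' = True" if "c \<in> set F" "l \<in> set c" "l' \<in> set c" "l \<noteq> l'" for c l l'
    using two_le_length_filter[of l c l' "\<lambda>l. \<not> snd l"] kc that by fastforce
  then show "\<exists>\<beta>. models some_true F \<beta>"
    using check no_conflict_models[of F True] unfolding cnf_check_def by blast
qed

text \<open>For 2CNF, a consistent partial assignment closed under unit propagation can be extended by any
  other one to the variables that it leaves open.\<close>

definition autark :: "('v \<times> bool) list list \<Rightarrow> ('v \<times> bool) set \<Rightarrow> bool" where
  "autark F A \<longleftrightarrow> (\<forall>l\<in>A. neg l \<notin> A) \<and> (\<forall>c\<in>set F. \<forall>l\<in>set c. neg l \<in> A \<longrightarrow> (\<exists>l'\<in>set c. l' \<in> A))"

text \<open>In a clause of at most two literals, refuting one turns the other into a unit, unless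
  that is refuted too; the latter would be a conflict.\<close>

lemma autark_up:
  assumes "no_conflict F" "\<And>c. c \<in> set F \<Longrightarrow> length c \<le> 2"
  shows "autark F (set (up F))"
  unfolding autark_def
proof (intro conjI ballI impI)
  fix c l assume c: "c \<in> set F" "l \<in> set c" "neg l \<in> set (up F)"
  obtain l1 where l1: "l1 \<in> set c" "neg l1 \<notin> set (up F)"
    using assms(1) c unfolding no_conflict_def by blast
  have "l' = l1 \<or> l' = l" if "l' \<in> set c" for l'
  proof (rule ccontr)
    assume "\<not> (l' = l1 \<or> l' = l)"
    moreover have "l1 \<noteq> l" using l1 c by auto
    ultimately have "card {l, l1, l'} = 3" by auto
    moreover have "card {l, l1, l'} \<le> card (set c)"
      by (rule card_mono) (use c l1 that in auto)
    ultimately show False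
      using card_length[of c] assms(2)[OF c(1)] by linarith
  qed
  then have "l1 \<in> set (up F)"
    using up_closed[OF c(1) l1(1)] c(3) by blast
  then show "\<exists>l'\<in>set c. l' \<in> set (up F)" using l1 by blast
qed (use up_consistent[OF assms(1)] in blast)

text \<open>\<open>A\<close> has precedence. Any clause that \<open>A\<close> touches is made true
  by \<open>A\<close> itself; in the others no literal is refuted by \<open>A\<close>, so the true
  literal supplied by \<open>B\<close> survives.\<close>

lemma autark_extend:
  assumes A: "autark F A" and B: "autark F B"
  shows "autark F (A \<union> {l \<in> B. neg l \<notin> A})"
  unfolding autark_def
proof (intro conjI ballI impI)
  fix l assume "l \<in> A \<union> {l \<in> B. neg l \<notin> A}"
  then show "neg l \<notin> A \<union> {l \<in> B. neg l \<notin> A}"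
    using A B unfolding autark_def by auto
next
  fix c l assume c: "c \<in> set F" "l \<in> set c" and l: "neg l \<in> A \<union> {l \<in> B. neg l \<notin> A}"
  show "\<exists>l'\<in>set c. l' \<in> A \<union> {l \<in> B. neg l \<notin> A}"
  proof (cases "neg l \<in> A")
    case True
    then show ?thesis using A c unfolding autark_def by blast
  next
    case False
    then obtain l' where l': "l' \<in> set c" "l' \<in> B"
      using l B c unfolding autark_def by blast
    then show ?thesis
      using A c(1) unfolding autark_def by blast
  qed
qed

lemma decides_bijunctive: "decides some_true (\<lambda>bs. length bs \<le> 2)
    (cnf_check :: ('v \<times> bool) list list \<Rightarrow> bool)"
proof (rule decides_cnf)
  fix F :: "('v \<times> bool) list list"
  assume "\<forall>c\<in>set F. length (map snd c) \<le> 2" and check: "cnf_check F"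
  then have kc: "length c \<le> 2" if "c \<in> set F" for c
    using that by simp
  \<comment> \<open>By the look-ahead one of \<open>l\<close> and \<open>neg l\<close> can be
    assumed without conflict, and propagation from it yields an assignment for \<open>F\<close> that
    decides \<open>l\<close>. These assignments are then merged, one literal at a time.\<close>
  have one: "\<exists>A. autark F A \<and> (l \<in> A \<or> neg l \<in> A)" if l: "l \<in> set (concat F)" for l
  proof -
    obtain l0 where l0: "l0 = l \<or> l0 = neg l" "no_conflict ([l0] # F)"
      using check l unfolding cnf_check_def by blast
    have "autark ([l0] # F) (set (up ([l0] # F)))"
      by (rule autark_up[OF l0(2)]) (use kc in auto)
    moreover have "l0 \<in> set (up ([l0] # F))"
      by (rule up_closed[of "[l0]"]) auto
    ultimately show ?thesis
      using l0(1) unfolding autark_def by (metis list.set_intros(2))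
  qed
  have all: "\<exists>A. autark F A \<and> (\<forall>l\<in>set ls. l \<in> A \<or> neg l \<in> A)" if "set ls \<subseteq> set (concat F)" for ls
    using that
  proof (induction ls)
    case Nil
    show ?case by (rule exI[of _ "{}"]) (simp add: autark_def)
  next
    case (Cons l ls)
    then obtain A where A: "autark F A" "\<forall>l\<in>set ls. l \<in> A \<or> neg l \<in> A" by auto
    obtain B where B: "autark F B" "l \<in> B \<or> neg l \<in> B"
      using one[of l] Cons.prems by auto
    show ?case
      by (rule exI[of _ "A \<union> {l \<in> B. neg l \<notin> A}"]) (use A B autark_extend[OF A(1) B(1)] in auto)
  qed
  obtain A where A: "autark F A" "\<forall>l\<in>set (concat F). l \<in> A \<or> neg l \<in> A"
    using all[of "concat F"] by blast
  define \<beta> where "\<beta> x \<longleftrightarrow> (x, True) \<in> A" for x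
  have \<beta>: "\<beta> (fst l) = snd l" if "l \<in> A" for l
  proof (cases "snd l")
    case True
    then have "l = (fst l, True)" by (metis prod.collapse)
    then show ?thesis using that True by (metis \<beta>_def)
  next
    case False
    then have "neg l = (fst l, True)" by (simp add: neg_def)
    moreover have "neg l \<notin> A" using A(1) that unfolding autark_def by blast
    ultimately show ?thesis using False by (simp add: \<beta>_def)
  qed
  have "\<exists>l\<in>set c. \<beta> (fst l) = snd l" if c: "c \<in> set F" for c
  proof -
    obtain l where l: "l \<in> set c"
      using check c unfolding cnf_check_def no_conflict_def by blast
    then have "l \<in> A \<or> neg l \<in> A" using A(2) c by auto
    then have "\<exists>l'\<in>set c. l' \<in> A"
      using A(1) c l unfolding autark_def by blast
    then show ?thesis using \<beta> by blast
  qed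
  then show "\<exists>\<beta>. models some_true F \<beta>" unfolding models_some_true by blast
qed

lemma ds_filter_le: "ds (filter Q xs) \<le> ds xs"
  by (induction xs) auto

lemma pt_neg [pt]: "ptime f \<Longrightarrow> ptime (\<lambda>x. neg (f x))"
  unfolding neg_def by (intro pt | assumption)+

lemma pt_up [pt]:
  fixes f :: "'a :: data \<Rightarrow> ('v :: eqdata \<times> bool) list list"
  assumes "ptime f"
  shows "ptime (\<lambda>x. up (f x))"
proof -
  have "ptime (up :: ('v \<times> bool) list list \<Rightarrow> _)"
    unfolding up_def
  proof (rule pt_fold_incr[where H = "\<lambda>F y. concat F" and c = 0])
    show "ptime (\<lambda>p :: ('v \<times> bool) \<times> ('v \<times> bool) list list \<times> ('v \<times> bool) list.
        up_step (fst (snd p)) (concat (fst (snd p))) (snd (snd p)))"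
      unfolding up_step_def by (intro pt)
    show "ds (up_step F (concat F) s) \<le> ds s + ds (concat F) + 0" for F :: "('v \<times> bool) list list" and s
      using ds_filter_le[of _ "concat F"] unfolding up_step_def by (simp add: trans_le_add2)
  qed (intro pt)+
  then show ?thesis using assms by (rule pt_comp)
qed

lemma pt_no_conflict [pt]:
  fixes f :: "'a :: data \<Rightarrow> ('v :: eqdata \<times> bool) list list"
  assumes "ptime f"
  shows "ptime (\<lambda>x. no_conflict (f x))"
proof -
  have "ptime (no_conflict :: ('v \<times> bool) list list \<Rightarrow> _)"
    unfolding no_conflict_def by (intro pt)
  then show ?thesis using assms by (rule pt_comp)
qed

lemma ptime_cnf_check: "ptime (cnf_check :: ('v :: eqdata \<times> bool) list list \<Rightarrow> bool)"
  unfolding cnf_check_def by (intro pt)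

subsection \<open>Linear systems over the two-element field\<close>

fun par :: "bool list \<Rightarrow> bool" where
  "par [] = False"
| "par (b # bs) = (b \<noteq> par bs)"

lemma par_conv_fold: "par bs = fold (\<lambda>b s. b \<noteq> s) bs False"
proof -
  have "fold (\<lambda>b s. b \<noteq> s) bs s = (par bs \<noteq> s)" for s
    by (induction bs arbitrary: s) auto
  then show ?thesis by simp
qed

lemma par_odd: "par bs \<longleftrightarrow> odd (length (filter id bs))"
  by (induction bs) auto

lemma par_xor: "par (map (\<lambda>v. f v \<noteq> g v) vs) = (par (map f vs) \<noteq> par (map g vs))"
  by (induction vs) auto

lemma pt_par [pt]: "ptime f \<Longrightarrow> ptime (\<lambda>x. par (f x))"
  unfolding par_conv_fold
  by (rule pt_fold_incr[where H = "\<lambda>x y. y" and c = 0]) (intro pt | assumption | simp)+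

text \<open>A row holds the coefficients of the variables followed by a constant, and asserts that their
  inner product with the assignment, extended by \<open>True\<close>, vanishes.\<close>

definition row :: "'v list \<Rightarrow> ('v \<times> bool) list \<Rightarrow> bool list" where
  "row vs c = map (\<lambda>v. par (map (\<lambda>l. fst l = v) c)) vs @ [\<not> par (map (\<lambda>l. \<not> snd l) c)]"

fun dot :: "bool list \<Rightarrow> bool list \<Rightarrow> bool" where
  "dot (a # r) (b # bs) = ((a \<and> b) \<noteq> dot r bs)"
| "dot _ _ = False"

definition row_sum :: "bool list \<Rightarrow> bool list \<Rightarrow> bool list" where
  "row_sum r s = map (\<lambda>p. fst p \<noteq> snd p) (zip r s)"

text \<open>The pivot row is added to itself too and becomes zero, so it need not be removed.\<close>

definition eliminate :: "bool list list \<Rightarrow> bool list list" where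
  "eliminate rs = map (\<lambda>r. if hd r \<and> r \<noteq> [] then row_sum (tl r) (tl (hd (filter hd rs))) else tl r) rs"

text \<open>Once all variables are eliminated, a row consists of its constant alone, and the system
  is solvable iff all these constants vanish.\<close>

definition affine_check :: "('v \<times> bool) list list \<Rightarrow> bool" where
  "affine_check F \<longleftrightarrow> (let vs = remdups (map fst (concat F)) in
     \<forall>r\<in>set (fold (\<lambda>_. eliminate) vs (map (row vs) F)). \<not> hd r)"

lemma dot_append: "length r = length bs \<Longrightarrow> dot (r @ [a]) (bs @ [b]) = (dot r bs \<noteq> (a \<and> b))"
  by (induction r bs rule: list_induct2) auto

lemma dot_map: "dot (map f vs) (map g vs) = par (map (\<lambda>v. f v \<and> g v) vs)"
  by (induction vs) auto

lemma dot_row_sum: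
  "length r = length bs \<Longrightarrow> length s = length bs \<Longrightarrow> dot (row_sum r s) bs = (dot r bs \<noteq> dot s bs)"
  unfolding row_sum_def
proof (induction r bs arbitrary: s rule: list_induct2)
  case (Cons a r b bs)
  then show ?case by (cases s) auto
qed simp

lemma par_indicator: "distinct vs \<Longrightarrow> par (map (\<lambda>v. v = x \<and> g v) vs) = (x \<in> set vs \<and> g x)"
  by (induction vs) auto

text \<open>Over the two-element field a negative literal is its variable plus one, so a clause is
  the sum of its variables plus the parity of its negative literals. It has to equal one; hence the
  negation in the constant of the row.\<close>

lemma dot_row:
  assumes "distinct vs" "fst ` set c \<subseteq> set vs"
  shows "dot (row vs c) (map \<beta> vs @ [True]) = (\<not> par (map (\<lambda>l. \<beta> (fst l) = snd l) c))"
proof -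
  have "par (map (\<lambda>l. \<beta> (fst l) = snd l) c) =
      (par (map (\<lambda>v. par (map (\<lambda>l. fst l = v) c) \<and> \<beta> v) vs) \<noteq> par (map (\<lambda>l. \<not> snd l) c))"
    using assms(2)
  proof (induction c)
    case Nil
    have "par (map (\<lambda>v. False) vs) = False" by (induction vs) auto
    then show ?case by simp
  next
    case (Cons l c)
    have "par (map (\<lambda>v. par (map (\<lambda>l. fst l = v) (l # c)) \<and> \<beta> v) vs) =
        par (map (\<lambda>v. (v = fst l \<and> \<beta> v) \<noteq> (par (map (\<lambda>l. fst l = v) c) \<and> \<beta> v)) vs)"
      by (rule arg_cong[of _ _ par], rule map_cong) auto
    also have "\<dots> = (\<beta> (fst l) \<noteq> par (map (\<lambda>v. par (map (\<lambda>l. fst l = v) c) \<and> \<beta> v) vs))"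
      unfolding par_xor par_indicator[OF assms(1)] using Cons.prems by simp
    finally show ?case using Cons by auto
  qed
  then show ?thesis
    by (simp add: row_def dot_append dot_map)
qed

lemma eliminate_length:
  assumes "\<forall>r\<in>set rs. length r = Suc n"
  shows "\<forall>r\<in>set (eliminate rs). length r = n"
proof -
  have "length (hd (filter hd rs)) = Suc n" if "r \<in> set rs" "hd r" for r
    using assms that hd_in_set[of "filter hd rs"] by (fastforce simp: filter_empty_conv)
  then show ?thesis using assms by (auto simp: eliminate_def row_sum_def)
qed

text \<open>The pivot row \<open>p\<close> has leading coefficient one, so it forces the eliminated
  variable to be \<open>dot (tl p) bs\<close>. Substituting this value into another row with that
  variable amounts to adding the pivot row.\<close>

lemma eliminate_solvable:
  assumes len: "\<forall>r\<in>set rs. length r = Suc (length bs)"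
  shows "(\<exists>b. \<forall>r\<in>set rs. \<not> dot r (b # bs)) \<longleftrightarrow> (\<forall>r\<in>set (eliminate rs). \<not> dot r bs)"
proof -
  have split: "dot r (b # bs) = ((hd r \<and> b) \<noteq> dot (tl r) bs)" "length (tl r) = length bs" "r \<noteq> []"
    if "r \<in> set rs" for r b
    using len that by (cases r; force)+
  show ?thesis
  proof (cases "\<exists>r\<in>set rs. hd r")
    case False
    then have "set (eliminate rs) = tl ` set rs" by (auto simp: eliminate_def)
    then show ?thesis using False split by auto
  next
    case True
    define p where "p = hd (filter hd rs)"
    have p: "p \<in> set rs" "hd p"
      using True hd_in_set[of "filter hd rs"] unfolding p_def by (auto simp: filter_empty_conv)
    have el: "(\<forall>r\<in>set (eliminate rs). \<not> dot r bs) \<longleftrightarrow>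
        (\<forall>r\<in>set rs. if hd r then dot (tl r) bs = dot (tl p) bs else \<not> dot (tl r) bs)"
    proof -
      have "set (eliminate rs) = (\<lambda>r. if hd r then row_sum (tl r) (tl p) else tl r) ` set rs"
        unfolding eliminate_def set_map p_def[symmetric] by (rule image_cong) (use split in auto)
      then have "(\<forall>r\<in>set (eliminate rs). \<not> dot r bs) \<longleftrightarrow>
          (\<forall>r\<in>set rs. \<not> dot (if hd r then row_sum (tl r) (tl p) else tl r) bs)"
        by (simp only: ball_simps)
      also have "\<dots> \<longleftrightarrow> (\<forall>r\<in>set rs. if hd r then dot (tl r) bs = dot (tl p) bs else \<not> dot (tl r) bs)"
        by (rule ball_cong) (use split(2) p dot_row_sum in auto)
      finally show ?thesis .
    qed
    have "(\<exists>b. \<forall>r\<in>set rs. \<not> dot r (b # bs)) \<longleftrightarrow>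
        (\<exists>b. \<forall>r\<in>set rs. (hd r \<and> b) = dot (tl r) bs)"
      using split by auto
    also have "\<dots> \<longleftrightarrow> (\<forall>r\<in>set rs. (hd r \<and> dot (tl p) bs) = dot (tl r) bs)"
      using p by metis
    also have "\<dots> \<longleftrightarrow> (\<forall>r\<in>set rs. if hd r then dot (tl r) bs = dot (tl p) bs else \<not> dot (tl r) bs)"
      by auto
    finally show ?thesis unfolding el .
  qed
qed

lemma ex_length_Suc:
  "(\<exists>bs. length bs = Suc n \<and> Q bs) \<longleftrightarrow> (\<exists>bs. length bs = n \<and> (\<exists>b. Q (b # bs)))"
  by (metis length_Suc_conv)

lemma eliminate_all:
  assumes "\<forall>r\<in>set rs. length r = Suc (length vs)"
  shows "(\<exists>bs. length bs = length vs \<and> (\<forall>r\<in>set rs. \<not> dot r (bs @ [True]))) \<longleftrightarrow>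
    (\<forall>r\<in>set (fold (\<lambda>_. eliminate) vs rs). \<not> hd r)"
  using assms
proof (induction vs arbitrary: rs)
  case Nil
  have "dot r [True] = hd r" if "r \<in> set rs" for r
    using Nil that by (cases r) (auto simp: length_Suc_conv)
  then show ?case by auto
next
  case (Cons v vs)
  have "(\<exists>bs. length bs = length (v # vs) \<and> (\<forall>r\<in>set rs. \<not> dot r (bs @ [True]))) \<longleftrightarrow>
      (\<exists>bs. length bs = length vs \<and> (\<exists>b. \<forall>r\<in>set rs. \<not> dot r (b # bs @ [True])))"
    using ex_length_Suc[of "length vs" "\<lambda>bs. \<forall>r\<in>set rs. \<not> dot r (bs @ [True])"] by simp
  also have "\<dots> \<longleftrightarrow> (\<exists>bs. length bs = length vs \<and> (\<forall>r\<in>set (eliminate rs). \<not> dot r (bs @ [True])))"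
  proof -
    have "(\<exists>b. \<forall>r\<in>set rs. \<not> dot r (b # bs @ [True])) \<longleftrightarrow> (\<forall>r\<in>set (eliminate rs). \<not> dot r (bs @ [True]))"
      if "length bs = length vs" for bs
      using eliminate_solvable[of rs "bs @ [True]"] Cons.prems that by simp
    then show ?thesis by (simp cong: conj_cong)
  qed
  also have "\<dots> \<longleftrightarrow> (\<forall>r\<in>set (fold (\<lambda>_. eliminate) vs (eliminate rs)). \<not> hd r)"
    by (rule Cons.IH) (rule eliminate_length, use Cons.prems in simp)
  finally show ?case by simp
qed

lemma map_surj_distinct:
  assumes "distinct vs" "length bs = length vs"
  shows "\<exists>\<beta>. map \<beta> vs = bs"
  using assms(2,1)
proof (induction bs vs rule: list_induct2)
  case (Cons b bs v vs)
  then obtain \<beta> where "map \<beta> vs = bs" by auto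
  then show ?case
    using Cons.prems by (intro exI[of _ "\<beta>(v := b)"]) auto
qed simp

lemma decides_affine: "decides par (\<lambda>_. True) (affine_check :: ('v \<times> bool) list list \<Rightarrow> bool)"
  unfolding decides_def
proof (intro allI impI)
  fix F :: "('v \<times> bool) list list"
  define vs where "vs = remdups (map fst (concat F))"
  have vs: "distinct vs" "fst ` set c \<subseteq> set vs" if "c \<in> set F" for c
    using that by (auto simp: vs_def)
  have "distinct vs" by (simp add: vs_def)
  have "(\<exists>\<beta>. models par F \<beta>) \<longleftrightarrow> (\<exists>\<beta>. \<forall>c\<in>set F. \<not> dot (row vs c) (map \<beta> vs @ [True]))"
    unfolding models_def using dot_row[OF vs] by simp
  also have "\<dots> \<longleftrightarrow> (\<exists>bs. length bs = length vs \<and> (\<forall>r\<in>set (map (row vs) F). \<not> dot r (bs @ [True])))"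
  proof
    assume "\<exists>\<beta>. \<forall>c\<in>set F. \<not> dot (row vs c) (map \<beta> vs @ [True])"
    then obtain \<beta> where "\<forall>c\<in>set F. \<not> dot (row vs c) (map \<beta> vs @ [True])" by blast
    then show "\<exists>bs. length bs = length vs \<and> (\<forall>r\<in>set (map (row vs) F). \<not> dot r (bs @ [True]))"
      by (intro exI[of _ "map \<beta> vs"]) simp
  next
    assume "\<exists>bs. length bs = length vs \<and> (\<forall>r\<in>set (map (row vs) F). \<not> dot r (bs @ [True]))"
    then obtain bs where bs: "length bs = length vs" "\<forall>c\<in>set F. \<not> dot (row vs c) (bs @ [True])"
      by auto
    then show "\<exists>\<beta>. \<forall>c\<in>set F. \<not> dot (row vs c) (map \<beta> vs @ [True])"
      using map_surj_distinct[OF \<open>distinct vs\<close> bs(1)] by blast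
  qed
  also have "\<dots> \<longleftrightarrow> affine_check F"
    unfolding affine_check_def Let_def vs_def[symmetric]
    by (rule eliminate_all) (auto simp: row_def)
  finally show "affine_check F = (\<exists>\<beta>. models par F \<beta>)" by simp
qed

lemma ds_map_le: "(\<And>x. ds (f x) \<le> ds x) \<Longrightarrow> ds (map f xs) \<le> ds xs"
  by (induction xs) (auto intro: add_mono)

lemma ds_bits: "ds (bs :: bool list) = 6 * length bs + 1"
  by (induction bs) auto

text \<open>A row loses its first entry, and an entry has the same size whether true or false. The
  system therefore never grows, however often it is reduced.\<close>

lemma ds_eliminate: "ds (eliminate rs) \<le> ds rs"
  unfolding eliminate_def by (rule ds_map_le) (auto simp: ds_bits row_sum_def)

lemma pt_eliminate [pt]: "ptime f \<Longrightarrow> ptime (\<lambda>x. eliminate (f x))"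
proof -
  have "ptime eliminate"
    unfolding eliminate_def row_sum_def by (intro pt)
  then show "ptime f \<Longrightarrow> ptime (\<lambda>x. eliminate (f x))" by (rule pt_comp)
qed

lemma ptime_affine_check: "ptime (affine_check :: ('v :: eqdata \<times> bool) list list \<Rightarrow> bool)"
  unfolding affine_check_def Let_def row_def
  by (intro pt pt_fold_incr[where H = "\<lambda>x y. y" and c = 0]) (simp add: ds_eliminate trans_le_add1)

section \<open>Constraint isomorphism as isomorphism of graphs\<close>

definition extendible :: "'v application set \<Rightarrow> ('v \<times> bool) list \<Rightarrow> bool" where
  "extendible S L \<longleftrightarrow> (\<exists>\<alpha>. satisfies \<alpha> S \<and> (\<forall>l\<in>set L. \<alpha> (fst l) = snd l))"

abbreviation relabel :: "('v \<Rightarrow> 'w) \<Rightarrow> ('v \<times> bool) list \<Rightarrow> ('w \<times> bool) list" where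
  "relabel \<pi> L \<equiv> map (map_prod \<pi> id) L"

definition small_lists :: "nat \<Rightarrow> 'v set \<Rightarrow> ('v \<times> bool) list set" where
  "small_lists K X = {L. set L \<subseteq> X \<times> UNIV \<and> length L \<le> K}"

lemma relabel_small: "\<pi> permutes X \<Longrightarrow> L \<in> small_lists K X \<Longrightarrow> relabel \<pi> L \<in> small_lists K X"
  by (force simp: small_lists_def permutes_in_image)

lemma relabel_inv:
  assumes "\<pi> permutes X"
  shows "relabel \<pi> (relabel (inv \<pi>) L) = L" "relabel (inv \<pi>) (relabel \<pi> L) = L"
  using permutes_inverses[OF assms] by (simp_all add: map_prod.comp o_def map_prod_def case_prod_beta)

lemma satisfies_rename: "satisfies \<alpha> (rename \<pi> S) = satisfies (\<alpha> \<circ> \<pi>) S"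
proof -
  have "arg_val \<alpha> (rename_arg \<pi> a) = arg_val (\<alpha> \<circ> \<pi>) a" for a
    by (cases a) auto
  then show ?thesis
    by (force simp: satisfies_def rename_def o_def)
qed

lemma satisfies_local:
  assumes over: "\<forall>A\<in>S. application_over \<C> X A" and K: "\<forall>C\<in>\<C>. arity C \<le> K"
    and ext: "\<And>L. L \<in> small_lists K X \<Longrightarrow> (\<forall>l\<in>set L. \<alpha> (fst l) = snd l) \<Longrightarrow> extendible S L"
  shows "satisfies \<alpha> S"
  unfolding satisfies_def
proof
  fix A assume "A \<in> S"
  obtain C as where A: "A = (C, as)" by fastforce
  \<comment> \<open>The values of \<alpha> on the variables of this one application. Constants
    contribute nothing, so there are at most as many literals as arguments; repeated variables give
    repeated literals.\<close>
  define L where "L = concat (map (\<lambda>a. case a of Var x \<Rightarrow> [(x, \<alpha> x)] | Const b \<Rightarrow> []) as)"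
  have "length L \<le> length as"
    unfolding L_def by (induction as) (auto split: arg.split)
  then have "L \<in> small_lists K X"
    using over K \<open>A \<in> S\<close> A by (fastforce simp: small_lists_def L_def application_over_def split: arg.splits)
  then have "extendible S L"
    by (rule ext) (auto simp: L_def split: arg.splits)
  then obtain \<beta> where \<beta>: "satisfies \<beta> S" "\<forall>l\<in>set L. \<beta> (fst l) = snd l"
    unfolding extendible_def by blast
  have "arg_val \<alpha> a = arg_val \<beta> a" if "a \<in> set as" for a
  proof (cases a)
    case (Var x)
    then have "(x, \<alpha> x) \<in> set L" using that by (force simp: L_def)
    then show ?thesis using \<beta>(2) Var by force
  qed simp
  then have "map (arg_val \<alpha>) as = map (arg_val \<beta>) as" by simp
  then show "case A of (C, as) \<Rightarrow> holds C (map (arg_val \<alpha>) as)"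
    using \<beta>(1) \<open>A \<in> S\<close> A by (auto simp: satisfies_def simp del: map_eq_conv)
qed

text \<open>Extendibility refers to the satisfying assignments only, which gives one direction. For
  the other, each of the two solution sets is recovered from its short extendible lists by
  \<open>satisfies_local\<close>.\<close>

lemma equivalent_rename_iff:
  assumes I: "iso_instance \<C> X S U" and K: "\<forall>C\<in>\<C>. arity C \<le> K" and \<pi>: "\<pi> permutes X"
  shows "equivalent (rename \<pi> S) U \<longleftrightarrow>
    (\<forall>L\<in>small_lists K X. extendible S L \<longleftrightarrow> extendible U (relabel \<pi> L))"
proof
  assume eq: "equivalent (rename \<pi> S) U"
  show "\<forall>L\<in>small_lists K X. extendible S L \<longleftrightarrow> extendible U (relabel \<pi> L)"
  proof (intro ballI iffI)
    fix L assume "extendible S L"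
    then obtain \<alpha> where \<alpha>: "satisfies \<alpha> S" "\<forall>l\<in>set L. \<alpha> (fst l) = snd l"
      unfolding extendible_def by blast
    have "(\<alpha> \<circ> inv \<pi>) \<circ> \<pi> = \<alpha>"
      using permutes_inverses(2)[OF \<pi>] by auto
    then have "satisfies (\<alpha> \<circ> inv \<pi>) (rename \<pi> S)"
      using \<alpha>(1) by (simp only: satisfies_rename)
    then have "satisfies (\<alpha> \<circ> inv \<pi>) U"
      using eq by (simp add: equivalent_def)
    then show "extendible U (relabel \<pi> L)"
      unfolding extendible_def using \<alpha>(2) permutes_inverses(2)[OF \<pi>]
      by (intro exI[of _ "\<alpha> \<circ> inv \<pi>"]) auto
  next
    fix L assume "extendible U (relabel \<pi> L)"
    then obtain \<alpha> where \<alpha>: "satisfies \<alpha> U" "\<forall>l\<in>set L. \<alpha> (\<pi> (fst l)) = snd l"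
      unfolding extendible_def by auto
    then have "satisfies (\<alpha> \<circ> \<pi>) S"
      using eq by (simp add: equivalent_def flip: satisfies_rename)
    then show "extendible S L"
      unfolding extendible_def using \<alpha>(2) by (intro exI[of _ "\<alpha> \<circ> \<pi>"]) auto
  qed
next
  assume ext: "\<forall>L\<in>small_lists K X. extendible S L \<longleftrightarrow> extendible U (relabel \<pi> L)"
  have over: "\<forall>A\<in>S. application_over \<C> X A" "\<forall>A\<in>U. application_over \<C> X A"
    using I by (auto simp: iso_instance_def)
  have "satisfies (\<alpha> \<circ> \<pi>) S = satisfies \<alpha> U" for \<alpha>
  proof
    assume sat: "satisfies (\<alpha> \<circ> \<pi>) S"
    show "satisfies \<alpha> U"
    proof (rule satisfies_local[OF over(2) K])
      fix L assume L: "L \<in> small_lists K X" "\<forall>l\<in>set L. \<alpha> (fst l) = snd l"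
      have "extendible S (relabel (inv \<pi>) L)"
        unfolding extendible_def using sat L(2) permutes_inverses(1)[OF \<pi>]
        by (intro exI[of _ "\<alpha> \<circ> \<pi>"]) auto
      moreover have "relabel (inv \<pi>) L \<in> small_lists K X"
        by (rule relabel_small[OF permutes_inv[OF \<pi>] L(1)])
      ultimately show "extendible U L"
        using ext relabel_inv(1)[OF \<pi>, of L] by metis
    qed
  next
    assume sat: "satisfies \<alpha> U"
    show "satisfies (\<alpha> \<circ> \<pi>) S"
    proof (rule satisfies_local[OF over(1) K])
      fix L assume L: "L \<in> small_lists K X" "\<forall>l\<in>set L. (\<alpha> \<circ> \<pi>) (fst l) = snd l"
      have "extendible U (relabel \<pi> L)"
        unfolding extendible_def using sat L(2) by (intro exI[of _ \<alpha>]) auto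
      then show "extendible S L" using ext L(1) by blast
    qed
  qed
  then show "equivalent (rename \<pi> S) U"
    by (simp add: equivalent_def satisfies_rename)
qed

text \<open>The graph has a vertex \<open>v l\<close> for every literal \<open>l\<close>, colored by its sign and joined to the opposite
  literal, and a vertex \<open>h L\<close> of a third color for every literal list \<open>L\<close> in \<open>N\<close>, joined to its members.\<close>

locale literal_graph =
  fixes v :: "'x \<times> bool \<Rightarrow> nat" and h :: "('x \<times> bool) list \<Rightarrow> nat" and \<chi> :: "nat \<Rightarrow> nat"
  assumes inj_v: "inj v" and inj_h: "inj h" and disjoint: "v l \<noteq> h L"
    and color_v: "\<chi> (v l) = of_bool (snd l)" and color_h: "\<chi> (h L) = 2"
begin

definition vertices :: "'x set \<Rightarrow> ('x \<times> bool) list set \<Rightarrow> nat set" where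
  "vertices X N = v ` (X \<times> UNIV) \<union> h ` N"

definition edges :: "'x set \<Rightarrow> ('x \<times> bool) list set \<Rightarrow> nat set set" where
  "edges X N = (\<lambda>x. {v (x, True), v (x, False)}) ` X \<union> {{h L, v l} | L l. L \<in> N \<and> l \<in> set L}"

lemma v_eq [simp]: "v l = v l' \<longleftrightarrow> l = l'"
  by (rule inj_eq[OF inj_v])

lemma h_eq [simp]: "h L = h L' \<longleftrightarrow> L = L'"
  by (rule inj_eq[OF inj_h])

lemma vh_neq [simp]: "v l \<noteq> h L" "h L \<noteq> v l"
  using disjoint by metis+

lemma edge_h_v: "{h L, v l} \<in> edges X N \<longleftrightarrow> L \<in> N \<and> l \<in> set L"
  by (simp add: edges_def doubleton_eq_iff image_iff del: split_paired_Ex)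

lemma edge_v_v: "{v l, v l'} \<in> edges X N \<longleftrightarrow> fst l \<in> X \<and> fst l = fst l' \<and> snd l \<noteq> snd l'"
  by (cases l; cases l') (auto simp: edges_def doubleton_eq_iff)

lemma edge_h_h: "{h L, h L'} \<notin> edges X N"
  by (auto simp: edges_def doubleton_eq_iff)

lemma permutation_graph_iso:
  assumes \<pi>: "\<pi> permutes X" and N: "N1 \<subseteq> small_lists K X" "N2 \<subseteq> small_lists K X"
    and eq: "\<forall>L\<in>small_lists K X. L \<in> N1 \<longleftrightarrow> relabel \<pi> L \<in> N2"
  shows "colored_graph_iso (vertices X N1) (edges X N1) \<chi> (vertices X N2) (edges X N2) \<chi>"
proof -
  let ?m = "map_prod \<pi> id"
  define f where "f w = (if w \<in> range v then v (?m (inv v w)) else h (map ?m (inv h w)))" for w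
  have f_v: "f (v l) = v (?m l)" for l
    by (simp add: f_def inv_f_f[OF inj_v])
  have f_h: "f (h L) = h (map ?m L)" for L
    using disjoint by (auto simp: f_def inv_f_f[OF inj_h])
  have m_inj: "inj ?m"
    using permutes_inj[OF \<pi>] by (intro prod.inj_map) auto
  have m_image: "?m ` (X \<times> UNIV) = X \<times> UNIV"
    using permutes_image[OF \<pi>] by (simp add: map_prod_surj_on)
  have N2: "N2 = map ?m ` N1"
  proof
    show "N2 \<subseteq> map ?m ` N1"
    proof
      fix L assume L: "L \<in> N2"
      then have "relabel (inv \<pi>) L \<in> small_lists K X"
        using N relabel_small[OF permutes_inv[OF \<pi>]] by blast
      then have "relabel (inv \<pi>) L \<in> N1"
        using eq L relabel_inv(1)[OF \<pi>, of L] by metis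
      then show "L \<in> map ?m ` N1"
        using relabel_inv(1)[OF \<pi>, of L] by (metis image_eqI)
    qed
  qed (use N eq in auto)
  have image: "f ` vertices X N1 = vertices X N2"
  proof -
    have "f ` vertices X N1 = v ` ?m ` (X \<times> UNIV) \<union> h ` map ?m ` N1"
      by (simp only: vertices_def image_Un image_image f_v f_h)
    then show ?thesis by (simp only: m_image N2 vertices_def)
  qed
  have inj_f: "inj_on f (vertices X N1)"
    unfolding inj_on_def vertices_def
    by (auto simp: f_v f_h inj_eq[OF m_inj] inj_eq[OF inj_mapI[OF m_inj]] simp del: map_prod_simp)
  have edge: "{w, w'} \<in> edges X N1 \<longleftrightarrow> {f w, f w'} \<in> edges X N2"
    if "w \<in> vertices X N1" "w' \<in> vertices X N1" for w w'
  proof -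
    have vv: "{v l, v l'} \<in> edges X N1 \<longleftrightarrow> {f (v l), f (v l')} \<in> edges X N2" for l l'
      using permutes_in_image[OF \<pi>] permutes_inj[OF \<pi>] by (auto simp: f_v edge_v_v inj_def)
    have hv: "{h L, v l} \<in> edges X N1 \<longleftrightarrow> {f (h L), f (v l)} \<in> edges X N2" if "L \<in> N1" for L l
    proof -
      have "map ?m L \<in> N2" using that by (simp add: N2)
      then show ?thesis
        using that by (simp only: f_v f_h edge_h_v set_map inj_image_mem_iff[OF m_inj])
    qed
    then have vh: "{v l, h L} \<in> edges X N1 \<longleftrightarrow> {f (v l), f (h L)} \<in> edges X N2" if "L \<in> N1" for L l
      using that by (simp add: insert_commute)
    have hh: "{h L, h L'} \<in> edges X N1 \<longleftrightarrow> {f (h L), f (h L')} \<in> edges X N2" for L L'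
      by (simp add: f_h edge_h_h)
    show ?thesis
      using that vv hv vh hh unfolding vertices_def by blast
  qed
  have "\<chi> w = \<chi> (f w)" if "w \<in> vertices X N1" for w
    using that by (auto simp: vertices_def f_v f_h color_v color_h)
  then show ?thesis
    unfolding colored_graph_iso_def bij_betw_def using image inj_f edge by blast
qed

text \<open>By the colors an isomorphism maps lists to lists and literals to literals of the same
  sign. It need not send the vertex of \<open>L\<close> to that of its relabeling, only to some list
  with the relabeled set of members, because lists with equal members have equal neighbors. Closure
  of both families under change of order and repetition, within length \<open>K\<close>, bridges
  this gap.\<close>

lemma graph_iso_permutation:
  assumes "finite X" and N: "N1 \<subseteq> small_lists K X" "N2 \<subseteq> small_lists K X"
    and cl: "\<And>L L'. L \<in> N1 \<Longrightarrow> set L' = set L \<Longrightarrow> length L' \<le> K \<Longrightarrow> L' \<in> N1"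
      "\<And>L L'. L \<in> N2 \<Longrightarrow> set L' = set L \<Longrightarrow> length L' \<le> K \<Longrightarrow> L' \<in> N2"
    and iso: "colored_graph_iso (vertices X N1) (edges X N1) \<chi> (vertices X N2) (edges X N2) \<chi>"
  shows "\<exists>\<pi>. \<pi> permutes X \<and> (\<forall>L\<in>small_lists K X. L \<in> N1 \<longleftrightarrow> relabel \<pi> L \<in> N2)"
proof -
  obtain f where f: "bij_betw f (vertices X N1) (vertices X N2)"
    and edge: "\<And>w w'. w \<in> vertices X N1 \<Longrightarrow> w' \<in> vertices X N1 \<Longrightarrow>
      {w, w'} \<in> edges X N1 \<longleftrightarrow> {f w, f w'} \<in> edges X N2"
    and color: "\<And>w. w \<in> vertices X N1 \<Longrightarrow> \<chi> w = \<chi> (f w)"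
    using iso unfolding colored_graph_iso_def by blast
  have mem_v: "v (x, b) \<in> vertices X N \<longleftrightarrow> x \<in> X" and mem_h: "h L \<in> vertices X N \<longleftrightarrow> L \<in> N" for x b L N
    by (auto simp: vertices_def)
  have f_mem: "f w \<in> vertices X N2" if "w \<in> vertices X N1" for w
    using bij_betwE[OF f] that by blast
  have f_v_ex: "\<exists>y\<in>X. f (v (x, b)) = v (y, b)" if "x \<in> X" for x b
    using f_mem[of "v (x, b)"] color[of "v (x, b)"] that
    by (cases b) (auto simp: mem_v vertices_def color_v color_h of_bool_def split: if_splits)
  have f_h_ex: "\<exists>L'\<in>N2. f (h L) = h L'" if "L \<in> N1" for L
    using f_mem[of "h L"] color[of "h L"] that
    by (auto simp: mem_h vertices_def color_v color_h of_bool_def split: if_splits)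
  define \<pi> where "\<pi> x = (if x \<in> X then SOME y. y \<in> X \<and> f (v (x, True)) = v (y, True) else x)" for x
  have \<pi>_True: "\<pi> x \<in> X \<and> f (v (x, True)) = v (\<pi> x, True)" if "x \<in> X" for x
    using someI_ex[of "\<lambda>y. y \<in> X \<and> f (v (x, True)) = v (y, True)"] f_v_ex[OF that, of True] that
    by (auto simp: \<pi>_def)
  have f_v: "f (v (x, b)) = v (\<pi> x, b)" if "x \<in> X" for x b
  proof (cases b)
    case False
    obtain y where y: "f (v (x, False)) = v (y, False)"
      using f_v_ex \<open>x \<in> X\<close> by blast
    \<comment> \<open>The edge between opposite literals forces their images to belong to the same
      variable.\<close>
    have "{v (x, True), v (x, False)} \<in> edges X N1"
      using that by (simp add: edge_v_v)
    then have "{v (\<pi> x, True), v (y, False)} \<in> edges X N2"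
      using edge[of "v (x, True)" "v (x, False)"] that \<pi>_True y by (simp add: mem_v)
    then show ?thesis using y False by (simp add: edge_v_v)
  qed (use \<pi>_True that in simp)
  have "inj_on \<pi> X"
  proof (rule inj_onI)
    fix x y assume xy: "x \<in> X" "y \<in> X" "\<pi> x = \<pi> y"
    then have "f (v (x, True)) = f (v (y, True))" by (simp add: f_v)
    then have "v (x, True) = v (y, True)"
      using bij_betw_imp_inj_on[OF f] xy by (auto dest: inj_onD simp: mem_v)
    then show "x = y" by simp
  qed
  then have "bij_betw \<pi> X X"
    using endo_inj_surj[OF \<open>finite X\<close>, of \<pi>] \<pi>_True by (auto simp: bij_betw_def)
  then have perm: "\<pi> permutes X"
    by (rule bij_imp_permutes) (simp add: \<pi>_def)
  let ?m = "map_prod \<pi> id"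
  have m_inj: "inj ?m"
    using permutes_inj[OF perm] by (intro prod.inj_map) auto
  have m_image: "?m ` (X \<times> UNIV) = X \<times> UNIV"
    using permutes_image[OF perm] by (simp add: map_prod_surj_on)
  have hub: "set L' = ?m ` set L" if L: "L \<in> N1" "f (h L) = h L'" "L' \<in> N2" for L L'
  proof -
    have adj: "l \<in> set L \<longleftrightarrow> ?m l \<in> set L'" if "l \<in> X \<times> UNIV" for l
    proof -
      obtain x b where l: "l = (x, b)" "x \<in> X" using \<open>l \<in> X \<times> UNIV\<close> by auto
      show ?thesis
        using edge[of "h L" "v l"] L l by (simp add: mem_v mem_h f_v edge_h_v)
    qed
    have sub: "set L \<subseteq> X \<times> UNIV" "set L' \<subseteq> ?m ` (X \<times> UNIV)"
      using N L unfolding m_image small_lists_def by blast+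
    show ?thesis
    proof
      show "set L' \<subseteq> ?m ` set L"
      proof
        fix y assume y: "y \<in> set L'"
        then obtain l where l: "y = ?m l" "l \<in> X \<times> UNIV"
          using sub(2) by (meson imageE subsetD)
        then show "y \<in> ?m ` set L"
          using adj[OF l(2)] y by simp
      qed
      show "?m ` set L \<subseteq> set L'"
        using adj sub(1) by (meson image_subsetI subsetD)
    qed
  qed
  have "L \<in> N1 \<longleftrightarrow> relabel \<pi> L \<in> N2" if L: "L \<in> small_lists K X" for L
  proof
    assume "L \<in> N1"
    then obtain L' where L': "L' \<in> N2" "f (h L) = h L'" using f_h_ex by blast
    show "relabel \<pi> L \<in> N2"
      by (rule cl(2)[OF L'(1)]) (use hub[OF \<open>L \<in> N1\<close> L'(2,1)] L in \<open>auto simp: small_lists_def\<close>)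
  next
    assume R: "relabel \<pi> L \<in> N2"
    then have "h (relabel \<pi> L) \<in> f ` vertices X N1"
      using bij_betw_imp_surj_on[OF f] by (simp add: mem_h)
    then obtain w where w: "w \<in> vertices X N1" "f w = h (relabel \<pi> L)" by auto
    \<comment> \<open>The preimage cannot be a literal vertex, since these are mapped to literal
      vertices.\<close>
    then obtain L0 where L0: "L0 \<in> N1" "w = h L0"
      using f_v by (auto simp: vertices_def)
    have "?m ` set L = ?m ` set L0"
      using hub[OF L0(1) _ R] w L0 by simp
    then have "set L = set L0"
      by (simp only: inj_image_eq_iff[OF m_inj])
    then show "L \<in> N1"
      using cl(1)[OF L0(1)] L by (simp add: small_lists_def)
  qed
  then show ?thesis using perm by blast
qed

lemma isomorphic_iff_graph_iso:
  assumes I: "iso_instance \<C> X S U" and K: "\<forall>C\<in>\<C>. arity C \<le> K"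
    and N1: "N1 = {L \<in> small_lists K X. extendible S L}"
    and N2: "N2 = {L \<in> small_lists K X. extendible U L}"
  shows "isomorphic X S U \<longleftrightarrow>
    colored_graph_iso (vertices X N1) (edges X N1) \<chi> (vertices X N2) (edges X N2) \<chi>"
proof -
  have "finite X" using I by (simp add: iso_instance_def)
  have iff: "equivalent (rename \<pi> S) U \<longleftrightarrow> (\<forall>L\<in>small_lists K X. L \<in> N1 \<longleftrightarrow> relabel \<pi> L \<in> N2)"
    if "\<pi> permutes X" for \<pi>
    using equivalent_rename_iff[OF I K that] relabel_small[OF that] by (auto simp: N1 N2)
  have sub: "N1 \<subseteq> small_lists K X" "N2 \<subseteq> small_lists K X"
    by (auto simp: N1 N2)
  have "\<exists>\<pi>. \<pi> permutes X \<and> (\<forall>L\<in>small_lists K X. L \<in> N1 \<longleftrightarrow> relabel \<pi> L \<in> N2)"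
    if "colored_graph_iso (vertices X N1) (edges X N1) \<chi> (vertices X N2) (edges X N2) \<chi>"
    by (rule graph_iso_permutation[OF \<open>finite X\<close> sub _ _ that])
      (auto simp: N1 N2 small_lists_def extendible_def)
  then show ?thesis
    unfolding isomorphic_def using iff permutation_graph_iso[OF _ sub] by blast
qed

end

section \<open>The reduction\<close>

type_synonym literal_name = "name \<times> bool"

text \<open>The position of an argument is stored in unary, as the length of a list.\<close>

definition pick :: "bool list \<Rightarrow> name list \<Rightarrow> name" where
  "pick i as = hd (fold (\<lambda>_. tl) i as)"

type_synonym table = "(bool list \<times> (bool list \<times> bool) list list) list"

text \<open>The clause form is looked up under the truth table, by which the input names the
  constraint. The table itself is part of the program.\<close>

definition app_clauses :: "table \<Rightarrow> bool list \<times> name list \<Rightarrow> literal_name list list" where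
  "app_clauses tab A = concat (map (\<lambda>e. if fst e = fst A
     then map (\<lambda>c. map (\<lambda>l. (pick (fst l) (snd A), snd l)) c) (snd e) else []) tab)"

text \<open>The names of the constants are treated as variables whose values are fixed by unit clauses.\<close>

definition query :: "table \<Rightarrow> (bool list \<times> name list) list \<Rightarrow> literal_name list \<Rightarrow> literal_name list list" where
  "query tab S L = concat (map (app_clauses tab) S) @
     [[((True, [True]), True)], [((True, [False]), False)]] @ map (\<lambda>l. [l]) L"

fun words :: "nat \<Rightarrow> 'a list \<Rightarrow> 'a list list" where
  "words 0 ls = [[]]"
| "words (Suc k) ls = [] # concat (map (\<lambda>L. map (\<lambda>l. l # L) ls) (words k ls))"

definition all_literals :: "bool list list \<Rightarrow> literal_name list" where
  "all_literals X = concat (map (\<lambda>x. [((False, x), True), ((False, x), False)]) X)"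

definition hubs :: "(literal_name list list \<Rightarrow> bool) \<Rightarrow> table \<Rightarrow> nat \<Rightarrow> bool list list \<Rightarrow>
    (bool list \<times> name list) list \<Rightarrow> literal_name list list" where
  "hubs D tab K X S = filter (\<lambda>L. D (query tab S L)) (words K (all_literals X))"

definition enc_literal :: "literal_name \<Rightarrow> bool list" where
  "enc_literal l = bracket (enc_bits (snd (fst l)) @ enc_bit (snd l))"

definition literal_word :: "literal_name \<Rightarrow> bool list" where
  "literal_word l = enc_bit False @ enc_literal l"

definition hub_word :: "literal_name list \<Rightarrow> bool list" where
  "hub_word L = enc_bit True @ enc_list enc_literal L"

text \<open>A vertex is the number whose binary digits are a word followed by the leading digit one.\<close>

definition enc_vertex :: "bool list \<Rightarrow> bool list" where
  "enc_vertex u = enc_bits (u @ [True])"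

text \<open>The color words \<open>[True]\<close>, \<open>[]\<close> and
  \<open>[False, True]\<close> are the binary numbers 1, 0 and 2, for positive literals, negative
  literals and lists.\<close>

definition enc_literal_graph :: "bool list list \<Rightarrow> literal_name list list \<Rightarrow> bool list" where
  "enc_literal_graph X H = bracket (
     bracket (concat (map (\<lambda>l. bracket (enc_vertex (literal_word l) @ enc_bits (if snd l then [True] else [])))
         (all_literals X)) @
       concat (map (\<lambda>L. bracket (enc_vertex (hub_word L) @ enc_bits [False, True])) H)) @
     bracket (concat (map (\<lambda>x. bracket (enc_vertex (literal_word ((False, x), True)) @
           enc_vertex (literal_word ((False, x), False)))) X) @
       concat (map (\<lambda>L. concat (map (\<lambda>l. bracket (enc_vertex (hub_word L) @ enc_vertex (literal_word l))) L)) H)))"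

text \<open>The first argument lists the truth tables of the constraints with their arities in unary.\<close>

definition valid :: "(bool list \<times> bool list) list \<Rightarrow> bin_inst \<Rightarrow> bool" where
  "valid ar I \<longleftrightarrow> (\<forall>x\<in>set (fst I). x = [] \<or> hd (rev x)) \<and>
     (\<forall>A\<in>set (fst (snd I) @ snd (snd I)).
        (\<exists>e\<in>set ar. fst e = fst A \<and> snd e = map (\<lambda>_. True) (snd A)) \<and>
        (\<forall>a\<in>set (snd A). if fst a then snd a = [True] \<or> snd a = [False] else snd a \<in> set (fst I)))"

text \<open>Decoding is total, so syntax is checked by encoding the decoded instance and comparing
  with the input. Whatever fails is sent to the empty word, which encodes no pair of graphs.\<close>

definition reduce :: "(literal_name list list \<Rightarrow> bool) \<Rightarrow> table \<Rightarrow> (bool list \<times> bool list) list \<Rightarrow> nat \<Rightarrow>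
    bool list \<Rightarrow> bool list" where
  "reduce D tab ar K w = (if enc_inst (dec_inst (parse w)) = w \<and> valid ar (dec_inst (parse w))
     then bracket (
       enc_literal_graph (fst (dec_inst (parse w)))
         (hubs D tab K (fst (dec_inst (parse w))) (fst (snd (dec_inst (parse w))))) @
       enc_literal_graph (fst (dec_inst (parse w)))
         (hubs D tab K (fst (dec_inst (parse w))) (snd (snd (dec_inst (parse w))))))
     else [])"

section \<open>Running time of the reduction\<close>

lemma pt_pick [pt]:
  assumes "ptime i" "ptime as"
  shows "ptime (\<lambda>x. pick (i x) (as x))"
  unfolding pick_def
  by (intro pt pt_fold_incr[where H = "\<lambda>x y. y" and c = 0] assms) (simp add: ds_tl_le trans_le_add1)

lemma pt_query [pt]:
  assumes "ptime S" "ptime L"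
  shows "ptime (\<lambda>x. query tab (S x) (L x))"
  unfolding query_def app_clauses_def by (intro pt assms)

lemma pt_all_literals [pt]: "ptime X \<Longrightarrow> ptime (\<lambda>x. all_literals (X x))"
  unfolding all_literals_def by (intro pt | assumption)+

text \<open>The length bound is a constant, so the recursion is unrolled into finitely many
  compositions of programs. This is where the bounded arity keeps the number of lists
  polynomial.\<close>

lemma pt_words [pt]:
  assumes "ptime ls"
  shows "ptime (\<lambda>x. words k (ls x))"
proof -
  have "ptime (words k :: 'b list \<Rightarrow> 'b list list)"
  proof (induction k)
    case (Suc k)
    show ?case
      unfolding words.simps by (intro pt Suc)
  qed (unfold words.simps, intro pt)
  then show ?thesis using assms by (rule pt_comp)
qed

lemma pt_hubs [pt]:
  assumes "ptime D" "ptime X" "ptime S"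
  shows "ptime (\<lambda>x. hubs D tab K (X x) (S x))"
proof -
  have "ptime (\<lambda>p. D (query tab (S (snd p)) (fst p)))"
    by (intro pt_comp[OF assms(1)] pt pt_comp[OF assms(3)])
  then show ?thesis
    unfolding hubs_def using assms(2) by (intro pt)
qed

lemma pt_enc_literal_graph [pt]:
  assumes "ptime X" "ptime H"
  shows "ptime (\<lambda>x. enc_literal_graph (X x) (H x))"
  unfolding enc_literal_graph_def enc_vertex_def literal_word_def hub_word_def enc_literal_def
  by (intro pt assms)

lemma ptime_reduce:
  assumes "ptime D"
  shows "ptime (reduce D tab ar K)"
proof -
  have valid: "ptime (valid ar)"
    unfolding valid_def by (intro pt)
  have "ptime (\<lambda>w. reduce D tab ar K w)"
    unfolding reduce_def by (intro pt pt_comp[OF valid] assms)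
  then show ?thesis by simp
qed

section \<open>Binary numerals and the numbering of vertices\<close>

fun unbin :: "bool list \<Rightarrow> nat" where
  "unbin [] = 0"
| "unbin (b # bs) = of_bool b + 2 * unbin bs"

lemma unbin_pos: "bs \<noteq> [] \<Longrightarrow> last bs \<Longrightarrow> 0 < unbin bs"
  by (induction bs) (auto split: if_splits)

lemma binary_unbin: "bs = [] \<or> last bs \<Longrightarrow> binary (unbin bs) = bs"
proof (induction bs)
  case (Cons b bs)
  then have "0 < unbin (b # bs)" by (intro unbin_pos) auto
  moreover have "bs = [] \<or> last bs" using Cons.prems by (auto split: if_splits)
  ultimately show ?case
    using Cons.IH by (subst binary.simps) (auto simp: of_bool_def)
qed (simp add: binary.simps)

lemma unbin_binary [simp]: "unbin (binary n) = n"
proof (induction n rule: less_induct)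
  case (less n)
  show ?case
  proof (cases "n = 0")
    case False
    have "unbin (binary n) = of_bool (odd n) + 2 * unbin (binary (n div 2))"
      by (subst binary.simps) (simp add: False)
    also have "\<dots> = of_bool (odd n) + 2 * (n div 2)"
      using less[of "n div 2"] False by simp
    also have "\<dots> = n"
      by (cases "odd n") auto
    finally show ?thesis .
  qed (simp add: binary.simps)
qed

lemma binary_eq [simp]: "binary m = binary n \<longleftrightarrow> m = n"
  by (metis unbin_binary)

lemma binary_nonzero: "n \<noteq> 0 \<Longrightarrow> binary n = odd n # binary (n div 2)"
  by (subst binary.simps) simp

lemma binary_zero: "binary 0 = []"
  by (subst binary.simps) simp

lemma binary_one: "binary 1 = [True]"
  by (simp add: binary_nonzero binary_zero)

lemma binary_two: "binary 2 = [False, True]"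
  by (simp add: binary_nonzero binary_zero)

lemma last_binary: "binary n = [] \<or> last (binary n)"
proof (induction n rule: less_induct)
  case (less n)
  show ?case
  proof (cases "n \<le> 1")
    case True
    then have "n = 0 \<or> n = 1" by auto
    then show ?thesis using binary_zero binary_one by auto
  next
    case False
    then have "n div 2 \<noteq> 0" "n div 2 < n" "n \<noteq> 0" by auto
    then show ?thesis using less[of "n div 2"] by (simp add: binary_nonzero)
  qed
qed

text \<open>The appended digit is the most significant one, so initial parts that differ only in
  trailing zeros still give different numbers.\<close>

lemma unbin_snoc_eq: "unbin (u @ [True]) = unbin (w @ [True]) \<longleftrightarrow> u = w"
  by (metis append1_eq_conv binary_unbin last_snoc)

definition literal_name :: "nat \<times> bool \<Rightarrow> literal_name" where
  "literal_name l = ((False, binary (fst l)), snd l)"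

definition literal_vertex :: "nat \<times> bool \<Rightarrow> nat" where
  "literal_vertex l = unbin (literal_word (literal_name l) @ [True])"

definition hub_vertex :: "(nat \<times> bool) list \<Rightarrow> nat" where
  "hub_vertex L = unbin (hub_word (map literal_name L) @ [True])"

definition vertex_color :: "nat \<Rightarrow> nat" where
  "vertex_color n = (if n \<in> range hub_vertex then 2 else of_bool (n \<in> literal_vertex ` {l. snd l}))"

lemma enc_vertex_nat: "enc_nat (unbin (u @ [True])) = enc_vertex u"
  by (simp add: enc_nat_def enc_vertex_def binary_unbin)

lemma reads_enc_literal: "reads (enc_literal l) [tree_of [tree_of (snd (fst l)), tree_of (snd l)]]"
  unfolding enc_literal_def
  using reads_bracket[OF reads_append[OF reads_enc_bits reads_enc_bit]] by simp

lemma enc_literal_inj: "enc_literal (literal_name l) = enc_literal (literal_name l') \<Longrightarrow> l = l'"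
  using reads_unique[OF reads_enc_literal[of "literal_name l"], of "tree_of [tree_of (snd (fst (literal_name l'))), tree_of (snd (literal_name l'))]"]
    reads_enc_literal[of "literal_name l'"]
  by (cases l; cases l') (simp add: literal_name_def)

lemma enc_list_literal_inj:
  assumes "enc_list enc_literal (map literal_name L) = enc_list enc_literal (map literal_name L')"
  shows "L = L'"
proof -
  let ?g = "\<lambda>l. [tree_of (snd (fst l)), tree_of (snd l)]"
  have r: "reads (enc_list enc_literal (map literal_name L)) [tree_of (map ?g (map literal_name L))]" for L
    by (rule reads_enc_list) (rule reads_enc_literal)
  have "tree_of (map ?g (map literal_name L)) = tree_of (map ?g (map literal_name L'))"
    using reads_unique[OF r[of L], of "tree_of (map ?g (map literal_name L'))"] r[of L'] assms by simp
  then have "kids (tree_of (map ?g (map literal_name L))) = kids (tree_of (map ?g (map literal_name L')))"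
    by (simp only:)
  then have "map (\<lambda>l. tree_of (?g (literal_name l))) L = map (\<lambda>l. tree_of (?g (literal_name l))) L'"
    by (simp only: kids_tree_of_list map_map o_def)
  moreover have "inj (\<lambda>l. tree_of (?g (literal_name l)))"
    by (rule injI) (auto simp: literal_name_def)
  ultimately show ?thesis
    by (simp add: inj_map_eq_map)
qed

interpretation literal_graph literal_vertex hub_vertex vertex_color
proof
  show v: "inj literal_vertex"
    unfolding inj_def literal_vertex_def unbin_snoc_eq literal_word_def by (simp add: enc_literal_inj)
  show "inj hub_vertex"
    unfolding inj_def hub_vertex_def unbin_snoc_eq hub_word_def by (simp add: enc_list_literal_inj)
  show disj: "literal_vertex l \<noteq> hub_vertex L" for l L
    unfolding literal_vertex_def hub_vertex_def unbin_snoc_eq literal_word_def hub_word_def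
    by (simp add: enc_bit_def)
  show "vertex_color (literal_vertex l) = of_bool (snd l)" for l
    using disj[of l] inj_image_mem_iff[OF v] by (auto simp: vertex_color_def)
  show "vertex_color (hub_vertex L) = 2" for L
    by (simp add: vertex_color_def)
qed

subsection \<open>Encoded graphs\<close>

lemma set_words: "set (words k ls) = {L. set L \<subseteq> set ls \<and> length L \<le> k}"
proof (induction k)
  case (Suc k)
  show ?case
  proof (rule set_eqI)
    fix L
    show "L \<in> set (words (Suc k) ls) \<longleftrightarrow> L \<in> {L. set L \<subseteq> set ls \<and> length L \<le> Suc k}"
      by (cases L) (auto simp: Suc)
  qed
qed auto

lemma words_map: "words k (map f ls) = map (map f) (words k ls)"
  by (induction k) (simp_all add: map_concat o_def)

definition nat_literals :: "nat list \<Rightarrow> (nat \<times> bool) list" where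
  "nat_literals xs = concat (map (\<lambda>x. [(x, True), (x, False)]) xs)"

lemma set_nat_literals: "set (nat_literals xs) = set xs \<times> UNIV"
  by (auto simp: nat_literals_def)

lemma all_literals_binary: "all_literals (map binary xs) = map literal_name (nat_literals xs)"
  by (simp add: all_literals_def nat_literals_def literal_name_def map_concat o_def)

definition graph_vertices :: "nat list \<Rightarrow> (nat \<times> bool) list list \<Rightarrow> nat list" where
  "graph_vertices xs H = map literal_vertex (nat_literals xs) @ map hub_vertex H"

definition graph_edges :: "nat list \<Rightarrow> (nat \<times> bool) list list \<Rightarrow> (nat \<times> nat) list" where
  "graph_edges xs H = map (\<lambda>x. (literal_vertex (x, True), literal_vertex (x, False))) xs @
     concat (map (\<lambda>L. map (\<lambda>l. (hub_vertex L, literal_vertex l)) L) H)"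

lemma set_graph_vertices: "set (graph_vertices xs H) = vertices (set xs) (set H)"
  by (simp add: graph_vertices_def vertices_def set_nat_literals)

lemma edge_set_graph_edges: "edge_set (graph_edges xs H) = edges (set xs) (set H)"
  by (force simp: edge_set_def graph_edges_def edges_def)

lemma colored_graph_literal_graph:
  assumes "\<forall>L\<in>set H. set L \<subseteq> set xs \<times> UNIV"
  shows "colored_graph (set (graph_vertices xs H)) (edge_set (graph_edges xs H))"
  unfolding colored_graph_def set_graph_vertices edge_set_graph_edges
proof
  show "finite (vertices (set xs) (set H))" by (simp add: vertices_def)
  show "\<forall>e\<in>edges (set xs) (set H).
      \<exists>v\<in>vertices (set xs) (set H). \<exists>w\<in>vertices (set xs) (set H). v \<noteq> w \<and> e = {v, w}"
  proof
    fix e assume "e \<in> edges (set xs) (set H)"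
    then consider x where "x \<in> set xs" "e = {literal_vertex (x, True), literal_vertex (x, False)}"
      | L l where "L \<in> set H" "l \<in> set L" "e = {hub_vertex L, literal_vertex l}"
      unfolding edges_def by blast
    then show "\<exists>v\<in>vertices (set xs) (set H). \<exists>w\<in>vertices (set xs) (set H). v \<noteq> w \<and> e = {v, w}"
    proof cases
      case 1
      then show ?thesis
        by (intro bexI[of _ "literal_vertex (x, True)"] bexI[of _ "literal_vertex (x, False)"])
          (auto simp: vertices_def)
    next
      case 2
      then show ?thesis
        using assms by (intro bexI[of _ "hub_vertex L"] bexI[of _ "literal_vertex l"]) (auto simp: vertices_def)
    qed
  qed
qed

lemma enc_nat_literal_vertex: "enc_nat (literal_vertex l) = enc_vertex (literal_word (literal_name l))"
  unfolding literal_vertex_def by (rule enc_vertex_nat)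

lemma enc_nat_hub_vertex: "enc_nat (hub_vertex L) = enc_vertex (hub_word (map literal_name L))"
  unfolding hub_vertex_def by (rule enc_vertex_nat)

lemma enc_literal_graph_binary:
  "enc_literal_graph (map binary xs) (map (map literal_name) H) =
    enc_graph (graph_vertices xs H) (graph_edges xs H) vertex_color"
proof -
  have lit: "enc_nat (vertex_color (literal_vertex l)) = enc_bits (if snd (literal_name l) then [True] else [])" for l
    by (cases "snd l") (simp_all add: color_v enc_nat_def[of "Suc 0"] enc_nat_def[of 0]
        binary_one[simplified] binary_zero literal_name_def)
  have hub: "enc_nat (vertex_color (hub_vertex L)) = enc_bits [False, True]" for L
    by (simp add: color_h enc_nat_def[of 2] binary_two)
  have concat: "concat (concat (xss :: bool list list list)) = concat (map concat xss)" for xss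
    by (induction xss) auto
  show ?thesis
    unfolding enc_literal_graph_def enc_graph_def enc_list_def graph_vertices_def graph_edges_def all_literals_binary
    by (simp add: lit hub map_concat o_def enc_edge_def enc_nat_literal_vertex enc_nat_hub_vertex concat)
      (simp add: literal_name_def)
qed

definition graph_tree :: "nat list \<Rightarrow> (nat \<times> nat) list \<Rightarrow> (nat \<Rightarrow> nat) \<Rightarrow> tree" where
  "graph_tree vs es \<chi> = tree_of [
     tree_of (map (\<lambda>v. [tree_of (binary v), tree_of (binary (\<chi> v))]) vs),
     tree_of (map (\<lambda>e. [tree_of (binary (fst e)), tree_of (binary (snd e))]) es)]"

lemma reads_enc_nat: "reads (enc_nat n) [tree_of (binary n)]"
  unfolding enc_nat_def by (rule reads_enc_bits)

lemma reads_enc_graph: "reads (enc_graph vs es \<chi>) [graph_tree vs es \<chi>]"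
proof -
  have pair: "reads (bracket (enc_nat m @ enc_nat n)) [tree_of [tree_of (binary m), tree_of (binary n)]]" for m n
    using reads_bracket[OF reads_append[OF reads_enc_nat[of m] reads_enc_nat[of n]]] by simp
  have "reads (enc_list (\<lambda>v. bracket (enc_nat v @ enc_nat (\<chi> v))) vs)
      [tree_of (map (\<lambda>v. [tree_of (binary v), tree_of (binary (\<chi> v))]) vs)]"
    by (rule reads_enc_list) (rule pair)
  moreover have "reads (enc_list enc_edge es) [tree_of (map (\<lambda>e. [tree_of (binary (fst e)), tree_of (binary (snd e))]) es)]"
    by (rule reads_enc_list) (simp only: enc_edge_def case_prod_beta pair)
  ultimately show ?thesis
    unfolding enc_graph_def graph_tree_def using reads_bracket[OF reads_append] by fastforce
qed

lemma tree_of_list_eq: "tree_of xs = tree_of ys \<Longrightarrow> map tree_of xs = map tree_of ys"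
  using kids_tree_of_list by metis

lemma graph_tree_eq:
  assumes "graph_tree vs es \<chi> = graph_tree vs' es' \<chi>'"
  shows "vs = vs' \<and> es = es' \<and> (\<forall>v\<in>set vs. \<chi> v = \<chi>' v)"
proof -
  have "tree_of (map (\<lambda>v. [tree_of (binary v), tree_of (binary (\<chi> v))]) vs) =
        tree_of (map (\<lambda>v. [tree_of (binary v), tree_of (binary (\<chi>' v))]) vs')"
    and "tree_of (map (\<lambda>e. [tree_of (binary (fst e)), tree_of (binary (snd e))]) es) =
        tree_of (map (\<lambda>e. [tree_of (binary (fst e)), tree_of (binary (snd e))]) es')"
    using assms by (simp_all add: graph_tree_def)
  from this[THEN tree_of_list_eq]
  have v: "map (\<lambda>v. tree_of [tree_of (binary v), tree_of (binary (\<chi> v))]) vs =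
        map (\<lambda>v. tree_of [tree_of (binary v), tree_of (binary (\<chi>' v))]) vs'"
    and e: "map (\<lambda>e. tree_of [tree_of (binary (fst e)), tree_of (binary (snd e))]) es =
        map (\<lambda>e. tree_of [tree_of (binary (fst e)), tree_of (binary (snd e))]) es'"
    by (simp_all only: map_map o_def)
  have "vs = vs' \<and> (\<forall>v\<in>set vs. \<chi> v = \<chi>' v)"
    using v
  proof (induction vs arbitrary: vs')
    case (Cons v vs)
    then show ?case by (cases vs') auto
  qed simp
  moreover have "inj (\<lambda>e. tree_of [tree_of (binary (fst e)), tree_of (binary (snd e))])"
    by (rule injI) (auto simp: prod_eq_iff)
  ultimately show ?thesis
    using e by (simp add: inj_map_eq_map)
qed

text \<open>Membership yields some pair of graphs with this encoding, and unique reading identifies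
  it with the given one. The colorings agree on the listed vertices only, and an isomorphism looks
  at no others.\<close>

lemma graph_pair_VCGI:
  assumes "colored_graph (set vs1) (edge_set es1)" "colored_graph (set vs2) (edge_set es2)"
  shows "bracket (enc_graph vs1 es1 \<chi> @ enc_graph vs2 es2 \<chi>) \<in> VCGI \<longleftrightarrow>
    colored_graph_iso (set vs1) (edge_set es1) \<chi> (set vs2) (edge_set es2) \<chi>"
proof
  assume "bracket (enc_graph vs1 es1 \<chi> @ enc_graph vs2 es2 \<chi>) \<in> VCGI"
  then obtain ws1 fs1 \<chi>1 ws2 fs2 \<chi>2 where
    eq: "bracket (enc_graph vs1 es1 \<chi> @ enc_graph vs2 es2 \<chi>) = bracket (enc_graph ws1 fs1 \<chi>1 @ enc_graph ws2 fs2 \<chi>2)"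
    and iso: "colored_graph_iso (set ws1) (edge_set fs1) \<chi>1 (set ws2) (edge_set fs2) \<chi>2"
    unfolding VCGI_def by blast
  have r: "reads (bracket (enc_graph vs es \<chi> @ enc_graph ws fs \<chi>')) [tree_of [graph_tree vs es \<chi>, graph_tree ws fs \<chi>']]"
    for vs es \<chi> ws fs \<chi>'
    using reads_bracket[OF reads_append[OF reads_enc_graph reads_enc_graph]] by simp
  have "tree_of [graph_tree vs1 es1 \<chi>, graph_tree vs2 es2 \<chi>] = tree_of [graph_tree ws1 fs1 \<chi>1, graph_tree ws2 fs2 \<chi>2]"
    using reads_unique[OF r r[of ws1 fs1 \<chi>1 ws2 fs2 \<chi>2, folded eq]] .
  then have *: "vs1 = ws1 \<and> es1 = fs1 \<and> (\<forall>v\<in>set vs1. \<chi> v = \<chi>1 v)" "vs2 = ws2 \<and> es2 = fs2 \<and> (\<forall>v\<in>set vs2. \<chi> v = \<chi>2 v)"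
    using graph_tree_eq by auto
  obtain f where f: "bij_betw f (set vs1) (set vs2)"
      "\<forall>v\<in>set vs1. \<forall>w\<in>set vs1. {v, w} \<in> edge_set es1 \<longleftrightarrow> {f v, f w} \<in> edge_set es2"
      "\<forall>v\<in>set vs1. \<chi>1 v = \<chi>2 (f v)"
    using iso * unfolding colored_graph_iso_def by blast
  have "\<chi> v = \<chi> (f v)" if "v \<in> set vs1" for v
    using * f(3) bij_betwE[OF f(1)] that by metis
  then show "colored_graph_iso (set vs1) (edge_set es1) \<chi> (set vs2) (edge_set es2) \<chi>"
    unfolding colored_graph_iso_def using f by blast
qed (use assms in \<open>unfold VCGI_def, blast\<close>)

subsection \<open>Correctness of the reduction\<close>

lemma holds_length: "holds C xs \<Longrightarrow> length xs = arity C"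
  using Rep_constraint[of C] unfolding holds_def arity_def by auto

text \<open>The length \<open>2 ^ arity C\<close> of the table reveals the arity, its entries give
  the values on words of that length, and elsewhere every constraint is false.\<close>

lemma truth_table_inj:
  assumes "truth_table C = truth_table C'"
  shows "C = C'"
proof -
  have "length (truth_table C) = length (truth_table C')" using assms by simp
  then have ar: "arity C = arity C'"
    by (simp add: truth_table_def length_n_lists)
  have "holds C xs = holds C' xs" for xs
  proof (cases "length xs = arity C")
    case True
    then have "xs \<in> set (List.n_lists (arity C) [False, True])"
      by (auto simp: set_n_lists)
    then show ?thesis
      using assms ar by (auto simp: truth_table_def)
  next
    case False
    then show ?thesis using holds_length ar by metis
  qed
  then have "Rep_constraint C = Rep_constraint C'"
    using ar by (auto simp: prod_eq_iff arity_def holds_def)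
  then show ?thesis by (simp add: Rep_constraint_inject)
qed

text \<open>The common core of the four cases. The assumptions on clauses with one literal allow
  \<open>query\<close> to add literals and to fix the constants without leaving the formulas on
  which \<open>D\<close> is reliable.\<close>

locale clause_language =
  fixes Cs :: "constraint list" and \<phi> :: "constraint \<Rightarrow> formula"
    and tr kc :: "bool list \<Rightarrow> bool" and D :: "literal_name list list \<Rightarrow> bool" and K :: nat
  assumes over: "C \<in> set Cs \<Longrightarrow> formula_over (arity C) (\<phi> C)"
    and holds_iff: "C \<in> set Cs \<Longrightarrow> length xs = arity C \<Longrightarrow>
      holds C xs \<longleftrightarrow> (\<forall>cl\<in>set (\<phi> C). tr (map (lit_true xs) cl))"
    and clause: "C \<in> set Cs \<Longrightarrow> cl \<in> set (\<phi> C) \<Longrightarrow> kc (map is_pos cl)"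
    and unit: "tr [b] = b" "kc [b]"
    and D: "decides tr kc D"
    and K: "C \<in> set Cs \<Longrightarrow> arity C \<le> K"
begin

definition tab :: table where
  "tab = map (\<lambda>C. (truth_table C, map (map (\<lambda>l. (replicate (lit_index l) True, is_pos l))) (\<phi> C))) Cs"

definition ar :: "(bool list \<times> bool list) list" where
  "ar = map (\<lambda>C. (truth_table C, replicate (arity C) True)) Cs"

lemma pick_nth: "i < length as \<Longrightarrow> pick (replicate i True) as = as ! i"
proof -
  have "fold (\<lambda>_. tl) (replicate i True) as = drop i as"
    by (induction i arbitrary: as) (auto simp: drop_Suc)
  then show "i < length as \<Longrightarrow> ?thesis" by (simp add: pick_def hd_drop_conv_nth)
qed

lemma set_app_clauses:
  assumes "C \<in> set Cs" "length as = arity C"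
  shows "set (app_clauses tab (bin_app (C, as))) =
    (\<lambda>cl. map (\<lambda>l. (bin_arg (as ! lit_index l), is_pos l)) cl) ` set (\<phi> C)"
proof -
  have pick: "map (\<lambda>l. (pick (replicate (lit_index l) True) (map bin_arg as), is_pos l)) cl =
      map (\<lambda>l. (bin_arg (as ! lit_index l), is_pos l)) cl" if "cl \<in> set (\<phi> C)" for cl
    using over[OF assms(1)] assms(2) that by (auto simp: formula_over_def pick_nth)
  have "{C' \<in> set Cs. truth_table C' = truth_table C} = {C}"
    using assms(1) truth_table_inj by auto
  moreover have "set (app_clauses tab (bin_app (C, as))) = (\<Union>C'\<in>{C' \<in> set Cs. truth_table C' = truth_table C}.
      (\<lambda>cl. map (\<lambda>l. (pick (replicate (lit_index l) True) (map bin_arg as), is_pos l)) cl) ` set (\<phi> C'))"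
    by (auto simp: app_clauses_def tab_def bin_app_def o_def)
  ultimately show ?thesis
    using pick by (simp only: UN_insert UN_empty Un_empty_right) (rule image_cong, simp_all)
qed

lemma app_clauses_holds:
  assumes "C \<in> set Cs" "length as = arity C"
  shows "(\<forall>c\<in>set (app_clauses tab (bin_app (C, as))). tr (map (\<lambda>l. \<beta> (fst l) = snd l) c)) \<longleftrightarrow>
    holds C (map (\<lambda>a. \<beta> (bin_arg a)) as)"
proof -
  have eq: "map (\<lambda>l. \<beta> (bin_arg (as ! lit_index l)) = is_pos l) cl = map (lit_true (map (\<lambda>a. \<beta> (bin_arg a)) as)) cl"
    if "cl \<in> set (\<phi> C)" for cl
  proof (rule map_cong)
    fix l assume "l \<in> set cl"
    then have "lit_index l < length as"
      using over[OF assms(1)] assms(2) that by (auto simp: formula_over_def)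
    then show "(\<beta> (bin_arg (as ! lit_index l)) = is_pos l) = lit_true (map (\<lambda>a. \<beta> (bin_arg a)) as) l"
      by (cases l) auto
  qed simp
  have "(\<forall>c\<in>set (app_clauses tab (bin_app (C, as))). tr (map (\<lambda>l. \<beta> (fst l) = snd l) c)) \<longleftrightarrow>
      (\<forall>cl\<in>set (\<phi> C). tr (map (\<lambda>l. \<beta> (bin_arg (as ! lit_index l)) = is_pos l) cl))"
    by (simp add: set_app_clauses[OF assms] o_def)
  also have "\<dots> \<longleftrightarrow> (\<forall>cl\<in>set (\<phi> C). tr (map (lit_true (map (\<lambda>a. \<beta> (bin_arg a)) as)) cl))"
    by (rule ball_cong[OF refl]) (simp only: eq)
  finally show ?thesis
    using holds_iff[OF assms(1), of "map (\<lambda>a. \<beta> (bin_arg a)) as"] assms(2) by simp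
qed

lemma models_query:
  assumes "\<forall>A\<in>set ss. application_over (set Cs) X A"
  shows "models tr (query tab (map bin_app ss) (map literal_name L)) \<beta> \<longleftrightarrow>
    \<beta> (True, [True]) \<and> \<not> \<beta> (True, [False]) \<and> satisfies (\<lambda>x. \<beta> (False, binary x)) (set ss) \<and>
    (\<forall>l\<in>set L. \<beta> (False, binary (fst l)) = snd l)"
proof (cases "\<beta> (True, [True]) \<and> \<not> \<beta> (True, [False])")
  case True
  have arg: "arg_val (\<lambda>x. \<beta> (False, binary x)) a = \<beta> (bin_arg a)" for a
  proof (cases a)
    case (Const b)
    then show ?thesis using True by (cases b) auto
  qed simp
  have "(\<forall>A\<in>set ss. \<forall>c\<in>set (app_clauses tab (bin_app A)). tr (map (\<lambda>l. \<beta> (fst l) = snd l) c)) \<longleftrightarrow>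
      satisfies (\<lambda>x. \<beta> (False, binary x)) (set ss)"
    unfolding satisfies_def arg
  proof (rule ball_cong)
    fix A assume "A \<in> set ss"
    moreover obtain C as where "A = (C, as)" by fastforce
    ultimately show "(\<forall>c\<in>set (app_clauses tab (bin_app A)). tr (map (\<lambda>l. \<beta> (fst l) = snd l) c)) =
        (case A of (C, as) \<Rightarrow> holds C (map (\<lambda>a. \<beta> (bin_arg a)) as))"
      using assms app_clauses_holds[of C as \<beta>] by (auto simp: application_over_def)
  qed simp
  then show ?thesis
    using True by (simp add: models_def query_def ball_Un unit literal_name_def)
next
  case False
  then show ?thesis by (auto simp: models_def query_def unit)
qed

lemma D_query:
  assumes "\<forall>A\<in>set ss. application_over (set Cs) X A"
  shows "D (query tab (map bin_app ss) (map literal_name L)) \<longleftrightarrow> extendible (set ss) L"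
proof -
  have "kc (map snd c)" if "c \<in> set (query tab (map bin_app ss) (map literal_name L))" for c
  proof -
    have "kc (map snd c)" if "A \<in> set ss" and c: "c \<in> set (app_clauses tab (bin_app A))" for A
    proof -
      obtain C as where A: "A = (C, as)" by fastforce
      then have C: "C \<in> set Cs" "length as = arity C"
        using that(1) assms by (auto simp: application_over_def)
      obtain cl where "cl \<in> set (\<phi> C)" "c = map (\<lambda>l. (bin_arg (as ! lit_index l), is_pos l)) cl"
        using c unfolding A set_app_clauses[OF C] by blast
      then show ?thesis using clause[OF C(1)] by (simp add: o_def)
    qed
    then show ?thesis
      using that by (auto simp: query_def unit)
  qed
  then have "D (query tab (map bin_app ss) (map literal_name L)) \<longleftrightarrow>
      (\<exists>\<beta>. models tr (query tab (map bin_app ss) (map literal_name L)) \<beta>)"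
    using D unfolding decides_def by blast
  also have "\<dots> \<longleftrightarrow> extendible (set ss) L"
    unfolding models_query[OF assms] extendible_def
  proof
    assume "\<exists>\<alpha>. satisfies \<alpha> (set ss) \<and> (\<forall>l\<in>set L. \<alpha> (fst l) = snd l)"
    then obtain \<alpha> where "satisfies \<alpha> (set ss)" "\<forall>l\<in>set L. \<alpha> (fst l) = snd l" by blast
    \<comment> \<open>A tagged name is true iff it is that of the constant 1, so the constant 0
      becomes false; an untagged name gets the value of the variable whose digits it holds.\<close>
    then show "\<exists>\<beta>. \<beta> (True, [True]) \<and> \<not> \<beta> (True, [False]) \<and> satisfies (\<lambda>x. \<beta> (False, binary x)) (set ss) \<and>
        (\<forall>l\<in>set L. \<beta> (False, binary (fst l)) = snd l)"
      by (intro exI[of _ "\<lambda>a. if fst a then snd a = [True] else \<alpha> (unbin (snd a))"]) simp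
  qed blast
  finally show ?thesis .
qed

definition nat_hubs :: "nat list \<Rightarrow> nat application list \<Rightarrow> (nat \<times> bool) list list" where
  "nat_hubs xs ss = filter (\<lambda>L. extendible (set ss) L) (words K (nat_literals xs))"

lemma hubs_binary:
  assumes "\<forall>A\<in>set ss. application_over (set Cs) X A"
  shows "hubs D tab K (map binary xs) (map bin_app ss) = map (map literal_name) (nat_hubs xs ss)"
  by (simp add: hubs_def nat_hubs_def all_literals_binary words_map filter_map o_def D_query[OF assms])

lemma set_nat_hubs: "set (nat_hubs xs ss) = {L \<in> small_lists K (set xs). extendible (set ss) L}"
  by (auto simp: nat_hubs_def set_words set_nat_literals small_lists_def)

lemma valid_binary:
  assumes "iso_instance (set Cs) (set xs) (set ss) (set us)"
  shows "valid ar (map binary xs, map bin_app ss, map bin_app us)"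
proof -
  have bin: "binary x = [] \<or> hd (rev (binary x))" for x
    using last_binary[of x] by (auto simp: hd_rev)
  have app: "(\<exists>e\<in>set ar. fst e = fst (bin_app A) \<and> snd e = map (\<lambda>_. True) (snd (bin_app A))) \<and>
      (\<forall>a\<in>set (snd (bin_app A)). if fst a then snd a = [True] \<or> snd a = [False] else snd a \<in> binary ` set xs)"
    if "A \<in> set ss \<union> set us" for A
  proof -
    obtain C as where A: "A = (C, as)" by fastforce
    then have C: "C \<in> set Cs" "length as = arity C" "\<forall>x. Var x \<in> set as \<longrightarrow> x \<in> set xs"
      using assms that by (auto simp: iso_instance_def application_over_def)
    have "if fst (bin_arg a) then snd (bin_arg a) = [True] \<or> snd (bin_arg a) = [False]
        else snd (bin_arg a) \<in> binary ` set xs" if "a \<in> set as" for a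
      using C(3) that by (cases a) auto
    moreover have "(truth_table C, replicate (arity C) True) \<in> set ar"
      using C(1) by (auto simp: ar_def)
    ultimately show ?thesis
      using C(2) by (auto simp: A bin_app_def map_replicate_const o_def intro!: bexI[of _ "(truth_table C, replicate (arity C) True)"])
  qed
  show ?thesis
    unfolding valid_def fst_conv snd_conv set_append set_map image_Un[symmetric] ball_simps
    using bin app by blast
qed

text \<open>Digit words without leading zeros are the numerals of actual numbers, and an application
  with a known truth table and the right number of arguments comes from a constraint in
  \<open>Cs\<close>. So what passes the test is a genuine instance.\<close>

lemma validE:
  assumes "valid ar I"
  obtains xs ss us where "I = (map binary xs, map bin_app ss, map bin_app us)"
    "iso_instance (set Cs) (set xs) (set ss) (set us)"
proof -
  obtain X S U where I: "I = (X, S, U)" by (cases I)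
  define xs where "xs = map unbin X"
  have X: "binary (unbin x) = x" if "x \<in> set X" for x
    using assms that by (intro binary_unbin) (auto simp: valid_def I hd_rev)
  then have xs: "X = map binary xs"
    by (simp add: xs_def o_def map_idI)
  have app: "\<exists>B. bin_app B = A \<and> application_over (set Cs) (set xs) B" if "A \<in> set S \<union> set U" for A
  proof -
    have "\<exists>e\<in>set ar. fst e = fst A \<and> snd e = map (\<lambda>_. True) (snd A)"
      and args: "\<forall>a\<in>set (snd A). if fst a then snd a = [True] \<or> snd a = [False] else snd a \<in> set X"
      using assms that unfolding valid_def I fst_conv snd_conv set_append by blast+
    then obtain C where C: "C \<in> set Cs" "fst A = truth_table C" "replicate (arity C) True = map (\<lambda>_. True) (snd A)"
      unfolding ar_def by auto
    have len: "length (snd A) = arity C"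
      using arg_cong[OF C(3), of length] by simp
    define as where "as = map (\<lambda>a. if fst a then Const (hd (snd a)) else Var (unbin (snd a))) (snd A)"
    have "bin_arg (if fst a then Const (hd (snd a)) else Var (unbin (snd a))) = a" if "a \<in> set (snd A)" for a
      using bspec[OF args that] X by (cases a) (auto split: if_splits)
    then have "map bin_arg as = snd A"
      unfolding as_def map_map o_def by (rule map_idI)
    moreover have "x \<in> set xs" if "Var x \<in> set as" for x
      using that args by (auto simp: as_def xs_def split: if_splits)
    ultimately show ?thesis
      using C(1,2) len by (intro exI[of _ "(C, as)"]) (auto simp: bin_app_def application_over_def as_def prod_eq_iff)
  qed
  then obtain g where g: "\<And>A. A \<in> set S \<union> set U \<Longrightarrow> bin_app (g A) = A \<and> application_over (set Cs) (set xs) (g A)"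
    by metis
  have "I = (map binary xs, map bin_app (map g S), map bin_app (map g U))"
    using g xs by (simp add: I o_def map_idI)
  moreover have "iso_instance (set Cs) (set xs) (set (map g S)) (set (map g U))"
    using g by (auto simp: iso_instance_def)
  ultimately show ?thesis using that by blast
qed

lemma reduce_instance:
  assumes I: "iso_instance (set Cs) (set xs) (set ss) (set us)"
    and w: "w = enc_inst (map binary xs, map bin_app ss, map bin_app us)"
  shows "reduce D tab ar K w \<in> VCGI \<longleftrightarrow> isomorphic (set xs) (set ss) (set us)"
proof -
  have over: "\<forall>A\<in>set ss. application_over (set Cs) (set xs) A" "\<forall>A\<in>set us. application_over (set Cs) (set xs) A"
    using I by (auto simp: iso_instance_def)
  let ?v = "\<lambda>ss. graph_vertices xs (nat_hubs xs ss)" and ?e = "\<lambda>ss. graph_edges xs (nat_hubs xs ss)"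
  have "reduce D tab ar K w =
      bracket (enc_graph (?v ss) (?e ss) vertex_color @ enc_graph (?v us) (?e us) vertex_color)"
    unfolding reduce_def w dec_parse_inst
    by (simp add: valid_binary[OF I] hubs_binary[OF over(1)] hubs_binary[OF over(2)] enc_literal_graph_binary)
  moreover have "colored_graph (set (?v ss)) (edge_set (?e ss))" for ss
    by (rule colored_graph_literal_graph) (auto simp: set_nat_hubs small_lists_def)
  ultimately have "reduce D tab ar K w \<in> VCGI \<longleftrightarrow>
      colored_graph_iso (set (?v ss)) (edge_set (?e ss)) vertex_color (set (?v us)) (edge_set (?e us)) vertex_color"
    by (simp add: graph_pair_VCGI)
  also have "\<dots> \<longleftrightarrow> isomorphic (set xs) (set ss) (set us)"
    unfolding set_graph_vertices edge_set_graph_edges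
    by (rule isomorphic_iff_graph_iso[OF I, symmetric]) (auto simp: K set_nat_hubs)
  finally show ?thesis .
qed

lemma Nil_notin_VCGI: "[] \<notin> VCGI"
  by (auto simp: VCGI_def bracket_def)

theorem ISO_reducible:
  assumes "ptime D"
  shows "ISO\<^sub>c (set Cs) \<le>\<^sub>p\<^sub>m VCGI"
  unfolding poly_many_one_reducible_def
proof (intro exI conjI allI)
  show "polytime_computable (reduce D tab ar K)"
    by (rule ptime_polytime_computable) (rule ptime_reduce[OF assms])
  show "w \<in> ISO\<^sub>c (set Cs) \<longleftrightarrow> reduce D tab ar K w \<in> VCGI" for w
  proof
    assume "w \<in> ISO\<^sub>c (set Cs)"
    then obtain xs ss us where "iso_instance (set Cs) (set xs) (set ss) (set us)"
      "isomorphic (set xs) (set ss) (set us)" "w = enc_inst (map binary xs, map bin_app ss, map bin_app us)"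
      unfolding ISO\<^sub>c_def enc_inst_bin by blast
    then show "reduce D tab ar K w \<in> VCGI" using reduce_instance by blast
  next
    \<comment> \<open>The empty word is outside the target language, so the input must have passed
      both tests.\<close>
    assume red: "reduce D tab ar K w \<in> VCGI"
    then have w: "enc_inst (dec_inst (parse w)) = w" "valid ar (dec_inst (parse w))"
      using Nil_notin_VCGI by (auto simp: reduce_def split: if_splits)
    from validE[OF w(2)] obtain xs ss us where
      I: "dec_inst (parse w) = (map binary xs, map bin_app ss, map bin_app us)"
        "iso_instance (set Cs) (set xs) (set ss) (set us)" .
    then have "isomorphic (set xs) (set ss) (set us)"
      using reduce_instance[OF I(2)] w(1) red by auto
    then show "w \<in> ISO\<^sub>c (set Cs)"
      unfolding ISO\<^sub>c_def enc_inst_bin using I w(1) by auto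
  qed
qed

end

lemma schaefer_reducible:
  assumes "finite \<C>"
    and form: "\<And>C. C \<in> \<C> \<Longrightarrow> \<exists>\<phi>. formula_over (arity C) \<phi> \<and>
      (\<forall>xs. length xs = arity C \<longrightarrow> (holds C xs \<longleftrightarrow> (\<forall>cl\<in>set \<phi>. tr (map (lit_true xs) cl)))) \<and>
      (\<forall>cl\<in>set \<phi>. kc (map is_pos cl))"
    and "\<And>b. tr [b] = b" "\<And>b. kc [b]"
    and "decides tr kc (D :: literal_name list list \<Rightarrow> bool)" "ptime D"
  shows "ISO\<^sub>c \<C> \<le>\<^sub>p\<^sub>m VCGI"
proof -
  obtain Cs where Cs: "set Cs = \<C>" using finite_list[OF assms(1)] by blast
  obtain \<phi> where \<phi>: "\<And>C. C \<in> \<C> \<Longrightarrow> formula_over (arity C) (\<phi> C) \<and>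
      (\<forall>xs. length xs = arity C \<longrightarrow> (holds C xs \<longleftrightarrow> (\<forall>cl\<in>set (\<phi> C). tr (map (lit_true xs) cl)))) \<and>
      (\<forall>cl\<in>set (\<phi> C). kc (map is_pos cl))"
    using form by metis
  \<comment> \<open>Any common bound on the arities serves as \<open>K\<close>; their sum is one
    that also covers the empty list of constraints.\<close>
  interpret clause_language Cs \<phi> tr kc D "sum_list (map arity Cs)"
  proof
    show "arity C \<le> sum_list (map arity Cs)" if "C \<in> set Cs" for C
      using that by (simp add: member_le_sum_list)
  qed (use \<phi> Cs assms in auto)
  show ?thesis using ISO_reducible[OF assms(6)] by (simp add: Cs)
qed

lemma cnf_true_some_true: "cnf_true xs \<phi> \<longleftrightarrow> (\<forall>cl\<in>set \<phi>. some_true (map (lit_true xs) cl))"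
  by (auto simp: cnf_true_def some_true_def)

lemma xor_cnf_true_par: "xor_cnf_true xs \<phi> \<longleftrightarrow> (\<forall>cl\<in>set \<phi>. par (map (lit_true xs) cl))"
  by (simp add: xor_cnf_true_def par_odd filter_map o_def)

theorem theorem20:
  fixes \<C> :: "constraint set"
  assumes "finite \<C>"
    and "schaefer \<C>"
  shows "ISO\<^sub>c \<C> \<le>\<^sub>p\<^sub>m VCGI"
proof -
  have neg: "is_neg = (\<lambda>l. \<not> is_pos l)"
    using literal.exhaust_disc by (auto simp: fun_eq_iff)
  consider "\<forall>C\<in>\<C>. horn C" | "\<forall>C\<in>\<C>. anti_horn C" | "\<forall>C\<in>\<C>. affine_constraint C" | "\<forall>C\<in>\<C>. bijunctive C"
    using assms(2) unfolding schaefer_def by blast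
  then show ?thesis
  proof cases
    case 1
    show ?thesis
    proof (rule schaefer_reducible[OF assms(1) _ _ _ decides_horn ptime_cnf_check])
      fix C assume "C \<in> \<C>"
      then show "\<exists>\<phi>. formula_over (arity C) \<phi> \<and>
          (\<forall>xs. length xs = arity C \<longrightarrow> holds C xs = (\<forall>cl\<in>set \<phi>. some_true (map (lit_true xs) cl))) \<and>
          (\<forall>cl\<in>set \<phi>. length (filter id (map is_pos cl)) \<le> 1)"
        using 1 by (simp add: horn_def equiv_cnf_def cnf_true_some_true filter_map o_def)
    qed (auto simp: some_true_def)
  next
    case 2
    show ?thesis
    proof (rule schaefer_reducible[OF assms(1) _ _ _ decides_anti_horn ptime_cnf_check])
      fix C assume "C \<in> \<C>"
      then show "\<exists>\<phi>. formula_over (arity C) \<phi> \<and>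
          (\<forall>xs. length xs = arity C \<longrightarrow> holds C xs = (\<forall>cl\<in>set \<phi>. some_true (map (lit_true xs) cl))) \<and>
          (\<forall>cl\<in>set \<phi>. length (filter Not (map is_pos cl)) \<le> 1)"
        using 2 by (simp add: anti_horn_def equiv_cnf_def cnf_true_some_true filter_map o_def neg)
    qed (auto simp: some_true_def)
  next
    case 3
    show ?thesis
    proof (rule schaefer_reducible[OF assms(1) _ _ _ decides_affine ptime_affine_check])
      fix C assume "C \<in> \<C>"
      then show "\<exists>\<phi>. formula_over (arity C) \<phi> \<and>
          (\<forall>xs. length xs = arity C \<longrightarrow> holds C xs = (\<forall>cl\<in>set \<phi>. par (map (lit_true xs) cl))) \<and>
          (\<forall>cl\<in>set \<phi>. True)"
        using 3 by (simp add: affine_constraint_def equiv_xor_cnf_def xor_cnf_true_par)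
    qed auto
  next
    case 4
    show ?thesis
    proof (rule schaefer_reducible[OF assms(1) _ _ _ decides_bijunctive ptime_cnf_check])
      fix C assume "C \<in> \<C>"
      then show "\<exists>\<phi>. formula_over (arity C) \<phi> \<and>
          (\<forall>xs. length xs = arity C \<longrightarrow> holds C xs = (\<forall>cl\<in>set \<phi>. some_true (map (lit_true xs) cl))) \<and>
          (\<forall>cl\<in>set \<phi>. length (map is_pos cl) \<le> 2)"
        using 4 by (simp add: bijunctive_def equiv_cnf_def cnf_true_some_true)
    qed (auto simp: some_true_def)
  qed
qed

end
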